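(* Let $\underline{w}^{(n)}$ be a uniformly random element of the set of realizable words of length $2n$, and let $F^k_x$ be the number of occurrences of the letter $k$ in the signature of $\underline{w}^{(n)}$ between positions $0$ and $\lfloor x\rfloor$, for $x\in[0,n]$ and $k\in\{0,1,2\}$. (i) The following holds in probability: $$\left(\frac{F^0_n}{n},\frac{F^1_n}{n},\frac{F^2_n}{n}\right)\xrightarrow[n\to\infty]{}\left(\frac16,\frac23,\frac16\right).$$ (ii) The following convergence in distribution of processes holds: $$\frac{2}{\sqrt n}\left(F^0_{cn}-\frac{cn}{6},\,F^1_{cn}-\frac{2cn}{3},\,F^2_{cn}-\frac{cn}{6}\right)_{0\le c\le1}\xrightarrow[n\to\infty]{(d)}\left(W_c,-2W_c,W_c\right)_{0\le c\le1},$$ where $W$ is a Brownian motion of variance $2/9$.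
   Context: Let $n\ge 3$ and let $P_1,\ldots,P_n$ be $n$ distinct points on the unit circle of the complex plane in counterclockwise cyclic order; let $L_i$ be the perpendicular bisector of $[P_i,P_{i+1}]$ (indices modulo $n$). Assume generic position: the lines $L_i$ are pairwise distinct, no $P_j$ lies on any $L_i$, and the point $1$ lies on no $L_i$. The lines divide the plane into $2n$ regions, numbered counterclockwise starting with the region containing $1$; the occupancy word is $(v_1,\ldots,v_{2n})\in\{0,1\}^{2n}$ where $v_i$ is the number of points $P_j$ in the $i$th region. A word in $\{0,1\}^{2n}$ is realizable if it is the occupancy word of some such generic collection. The signature of a word $\underline v\in\{0,1\}^{2n}$ is $(\sigma_1,\ldots,\sigma_n)\in\{0,1,2\}^n$ with $\sigma_i=v_i+v_{i+n}$. Thus $F^k_x=\#\{1\le i\le\lfloor x\rfloor:\sigma_i=k\}$ for the signature of $\underline w^{(n)}$. A Brownian motion of variance $\sigma^2$ is a centered one started at $0$ with $\mathrm{Var}(W_c)=\sigma^2c$. Convergence in distribution of processes is in the space $\mathbb{D}([0,1],\mathbb{R}^3)$ of càdlàg functions with the Skorokhod $J_1$ topology. *)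

theory Defs
  imports "HOL-Probability.Probability"
begin

section \<open>Realizable words\<close>

definition ccw_unit_points :: "nat \<Rightarrow> (nat \<Rightarrow> complex) \<Rightarrow> bool" where
  "ccw_unit_points n P \<longleftrightarrow>
     (\<exists>t :: nat \<Rightarrow> real. strict_mono_on {1..n} t \<and> t n < t 1 + 2 * pi \<and> (\<forall>i\<in>{1..n}. P i = cis (t i)))"

definition perp_bisector :: "complex \<Rightarrow> complex \<Rightarrow> complex set" where
  "perp_bisector a b = {z. (z - midpoint a b) \<bullet> (b - a) = 0}"

(* For i in {1..n}, the index i mod n + 1 is i + 1 taken modulo n in {1..n}. *)
definition bis_line :: "nat \<Rightarrow> (nat \<Rightarrow> complex) \<Rightarrow> nat \<Rightarrow> complex set" where
  "bis_line n P i = perp_bisector (P i) (P (i mod n + 1))"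

definition generic_points :: "nat \<Rightarrow> (nat \<Rightarrow> complex) \<Rightarrow> bool" where
  "generic_points n P \<longleftrightarrow> 3 \<le> n \<and> ccw_unit_points n P \<and> inj_on (bis_line n P) {1..n} \<and>
     (\<forall>i\<in>{1..n}. \<forall>j\<in>{1..n}. P j \<notin> bis_line n P i) \<and> (\<forall>i\<in>{1..n}. 1 \<notin> bis_line n P i)"

definition regions :: "nat \<Rightarrow> (nat \<Rightarrow> complex) \<Rightarrow> complex set set" where
  "regions n P = components (- (\<Union>i\<in>{1..n}. bis_line n P i))"

(* All the lines pass through 0, so every region is an open sector and meets the unit circle in an
   arc.  The regions R 1, ..., R (2n) are in counterclockwise order starting from the one
   containing 1 iff one meets them in this order when running once through the circle from 1 = cis 0. *)
definition ccw_numbering :: "nat \<Rightarrow> (nat \<Rightarrow> complex) \<Rightarrow> (nat \<Rightarrow> complex set) \<Rightarrow> bool" where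
  "ccw_numbering n P R \<longleftrightarrow> bij_betw R {1..2*n} (regions n P) \<and> 1 \<in> R 1 \<and>
     (\<exists>t :: nat \<Rightarrow> real. strict_mono_on {1..2*n} t \<and> t 1 = 0 \<and> t (2*n) < 2 * pi \<and>
        (\<forall>i\<in>{1..2*n}. cis (t i) \<in> R i))"

definition occupancy_word :: "nat \<Rightarrow> (nat \<Rightarrow> complex) \<Rightarrow> (nat \<Rightarrow> nat) \<Rightarrow> bool" where
  "occupancy_word n P v \<longleftrightarrow>
     (\<exists>R. ccw_numbering n P R \<and> (\<forall>i\<in>{1..2*n}. v i = card {j\<in>{1..n}. P j \<in> R i}))"

(* Words of length 2n over {0,1} are functions on the positions {1..2n}, undefined elsewhere. *)
definition realizable_words :: "nat \<Rightarrow> (nat \<Rightarrow> nat) set" where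
  "realizable_words n =
     {v \<in> {1..2*n} \<rightarrow>\<^sub>E {0, 1}. \<exists>P. generic_points n P \<and> occupancy_word n P v}"

lemma finite_realizable_words: "finite (realizable_words n)"
proof -
  have "realizable_words n \<subseteq> {1..2*n} \<rightarrow>\<^sub>E {0, 1}"
    by (auto simp: realizable_words_def)
  then show ?thesis
    by (rule finite_subset) (intro finite_PiE, auto)
qed

(* There are no realizable words for n < 3, where pmf_of_set is unspecified (but still a probability
   distribution); this does not affect limits in n. *)
definition random_word :: "nat \<Rightarrow> (nat \<Rightarrow> nat) measure" where
  "random_word n = measure_pmf (pmf_of_set (realizable_words n))"

definition signature :: "nat \<Rightarrow> (nat \<Rightarrow> nat) \<Rightarrow> nat \<Rightarrow> nat" where
  "signature n v i = v i + v (i + n)"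

definition letter_count :: "nat \<Rightarrow> (nat \<Rightarrow> nat) \<Rightarrow> nat \<Rightarrow> real \<Rightarrow> real" where
  "letter_count n v k x = real (card {i\<in>{1..nat \<lfloor>x\<rfloor>}. signature n v i = k})"


section \<open>The Skorokhod space on the unit interval\<close>

(* Functions are undefined outside {0..1}, so that equality is equality on {0..1}. *)
definition cadlag_space :: "(real \<Rightarrow> 'a::topological_space) set" where
  "cadlag_space = {x \<in> extensional {0..1}.
     (\<forall>t\<in>{0..<1}. (x \<longlongrightarrow> x t) (at_right t)) \<and> (\<forall>t\<in>{0<..1}. \<exists>l. (x \<longlongrightarrow> l) (at_left t))}"

(* Such functions are automatically homeomorphisms of {0..1}. *)
definition time_changes :: "(real \<Rightarrow> real) set" where
  "time_changes = {l. strict_mono_on {0..1} l \<and> l ` {0..1} = {0..1}}"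

(* The open ball of radius e about x for the Skorokhod metric, i.e. the infimum over time changes l
   of max (sup_t |l t - t|) (sup_t |x t - y (l t)|). *)
definition skorokhod_ball ::
    "(real \<Rightarrow> 'a::metric_space) \<Rightarrow> real \<Rightarrow> (real \<Rightarrow> 'a) set" where
  "skorokhod_ball x e = {y \<in> cadlag_space. \<exists>l\<in>time_changes. \<exists>d<e. \<forall>t\<in>{0..1}.
     dist (l t) t \<le> d \<and> dist (x t) (y (l t)) \<le> d}"

definition skorokhod_J1 :: "(real \<Rightarrow> 'a::metric_space) topology" where
  "skorokhod_J1 = topology (\<lambda>U. U \<subseteq> cadlag_space \<and> (\<forall>x\<in>U. \<exists>e>0. skorokhod_ball x e \<subseteq> U))"

lemma skorokhod_ball_mono: "d \<le> e \<Longrightarrow> skorokhod_ball x d \<subseteq> skorokhod_ball x e"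
  unfolding skorokhod_ball_def by (intro Collect_mono impI) (meson less_le_trans)

lemma openin_skorokhod_J1:
  "openin skorokhod_J1 U \<longleftrightarrow> U \<subseteq> cadlag_space \<and> (\<forall>x\<in>U. \<exists>e>0. skorokhod_ball x e \<subseteq> U)"
proof -
  have "istopology (\<lambda>U :: (real \<Rightarrow> 'a) set.
          U \<subseteq> cadlag_space \<and> (\<forall>x\<in>U. \<exists>e>0. skorokhod_ball x e \<subseteq> U))"
    unfolding istopology_def
  proof (intro conjI allI impI)
    fix S T :: "(real \<Rightarrow> 'a) set"
    assume S: "S \<subseteq> cadlag_space \<and> (\<forall>x\<in>S. \<exists>e>0. skorokhod_ball x e \<subseteq> S)"
      and T: "T \<subseteq> cadlag_space \<and> (\<forall>x\<in>T. \<exists>e>0. skorokhod_ball x e \<subseteq> T)"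
    show "S \<inter> T \<subseteq> cadlag_space" using S by blast
    show "\<forall>x\<in>S \<inter> T. \<exists>e>0. skorokhod_ball x e \<subseteq> S \<inter> T"
    proof
      fix x assume "x \<in> S \<inter> T"
      then obtain d e where "d > 0" "skorokhod_ball x d \<subseteq> S" "e > 0" "skorokhod_ball x e \<subseteq> T"
        using S T by blast
      then show "\<exists>e>0. skorokhod_ball x e \<subseteq> S \<inter> T"
        using skorokhod_ball_mono[of "min d e" d x] skorokhod_ball_mono[of "min d e" e x]
        by (intro exI[of _ "min d e"]) auto
    qed
  next
    fix K :: "(real \<Rightarrow> 'a) set set"
    assume K: "\<forall>S\<in>K. S \<subseteq> cadlag_space \<and> (\<forall>x\<in>S. \<exists>e>0. skorokhod_ball x e \<subseteq> S)"
    show "\<Union>K \<subseteq> cadlag_space" using K by blast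
    show "\<forall>x\<in>\<Union>K. \<exists>e>0. skorokhod_ball x e \<subseteq> \<Union>K" using K by (meson UnionE Union_upper order_trans)
  qed
  then show ?thesis
    by (simp add: skorokhod_J1_def topology_inverse')
qed

lemma topspace_skorokhod_J1: "topspace skorokhod_J1 = cadlag_space"
proof
  show "topspace skorokhod_J1 \<subseteq> cadlag_space"
    using openin_topspace openin_skorokhod_J1 by blast
  have "openin skorokhod_J1 cadlag_space"
    unfolding openin_skorokhod_J1 by (auto simp: skorokhod_ball_def intro: exI[of _ 1])
  then show "cadlag_space \<subseteq> topspace skorokhod_J1"
    by (rule openin_subset)
qed


section \<open>Convergence of random elements and Brownian motion\<close>

definition converges_in_prob_to_const ::
    "(nat \<Rightarrow> 'w measure) \<Rightarrow> (nat \<Rightarrow> 'w \<Rightarrow> 'a::metric_space) \<Rightarrow> 'a \<Rightarrow> bool" where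
  "converges_in_prob_to_const M X a \<longleftrightarrow>
     (\<forall>e>0. (\<lambda>n. measure (M n) {\<omega> \<in> space (M n). dist (X n \<omega>) a > e}) \<longlonglongrightarrow> 0)"

definition borel_of_top :: "'a topology \<Rightarrow> 'a measure" where
  "borel_of_top T = sigma (topspace T) {U. openin T U}"

definition converges_in_distr ::
    "'a topology \<Rightarrow> (nat \<Rightarrow> 'w measure) \<Rightarrow> (nat \<Rightarrow> 'w \<Rightarrow> 'a) \<Rightarrow> 'v measure \<Rightarrow> ('v \<Rightarrow> 'a) \<Rightarrow> bool" where
  "converges_in_distr T M X N Y \<longleftrightarrow>
     (\<forall>n. X n \<in> M n \<rightarrow>\<^sub>M borel_of_top T) \<and> Y \<in> N \<rightarrow>\<^sub>M borel_of_top T \<and>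
     (\<forall>f :: 'a \<Rightarrow> real. continuous_map T euclideanreal f \<and> bounded (f ` topspace T) \<longrightarrow>
        (\<lambda>n. \<integral>\<omega>. f (X n \<omega>) \<partial>M n) \<longlonglongrightarrow> (\<integral>\<omega>. f (Y \<omega>) \<partial>N))"

(* Brownian motion of variance v on the time set {0..1}. *)
definition brownian_motion :: "'v measure \<Rightarrow> (real \<Rightarrow> 'v \<Rightarrow> real) \<Rightarrow> real \<Rightarrow> bool" where
  "brownian_motion N W v \<longleftrightarrow> prob_space N \<and>
     (\<forall>t\<in>{0..1}. W t \<in> borel_measurable N) \<and>
     (AE \<omega> in N. W 0 \<omega> = 0) \<and>
     (\<forall>\<omega>\<in>space N. continuous_on {0..1} (\<lambda>t. W t \<omega>)) \<and>
     (\<forall>s t. 0 \<le> s \<and> s < t \<and> t \<le> 1 \<longrightarrow>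
        distributed N lborel (\<lambda>\<omega>. W t \<omega> - W s \<omega>) (normal_density 0 (sqrt (v * (t - s))))) \<and>
     (\<forall>k t. mono_on {..k} t \<and> t ` {..k} \<subseteq> {0..1} \<longrightarrow>
        prob_space.indep_vars N (\<lambda>_. borel) (\<lambda>i \<omega>. W (t (Suc i)) \<omega> - W (t i) \<omega>) {..<k :: nat})"

end

theory Submission
  imports Defs "HOL-Library.Nat_Bijection"
begin

text \<open>
  Let each point open an interval of the circle that is closed by the midpoint of the arc to the next
  point. Superpose opposite regions. Each line is crossed at exactly one midpoint, so the signature
  satisfies $\sigma_k = 1 + s_k - s_{k-1}$, where the number $s_k$ of open intervals is at most 1.
  Hence the letters 0 and 2 of the signature alternate cyclically. Conversely, every word whose
  signature has alternating letters 0 and 2, both of which occur, is realized by points whose successive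
  distances grow or shrink geometrically. A realizable word is thus encoded by a first state and
  a word over three letters with an even number of letters 2; up to the at most $2^n$ words with
  constant signature this is a bijection. Changing the first letter other than 1 shows that the
  parity condition does not affect averages of slowly varying functions, so that the letter 2 may be
  taken to occur independently with probability $1/3$. With $S_j$ the number of letters 2
  among the first $j$ minus $j/3$, the counts of 0 and 2 are $j/6 + S_j/2$ up to a bounded error
  and that of 1 is $2j/3 - S_j$, and the walk $S$ satisfies an invariance principle. The latter
  follows from the central limit theorem along finitely many blocks and an exponential
  maximal inequality. Lipschitz functionals for the uniform distance suffice, since a function continuous in
  the Skorokhod topology is a pointwise supremum of those.
\<close>

section \<open>Increasing sequences with quasi-periods\<close>

text \<open>Everything cyclic is lifted to the real line: points, midpoints and lines become
  increasing sequences indexed by all integers, and occupancy becomes counting terms between two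
  separators. The obstacle of the converse is that lines are determined by points and cannot be
  placed freely. Midpoints are therefore controlled only up to a cell. The ratio 3 suffices because
  1/3 + 1/9 + ... = 1/2: a midpoint towards the next point stays inside the dominating cell. That
  the separators then fall in the right order follows from counting: a function that is monotone and
  periodic is constant. Two first states times about half of the 3^n codes make the number of
  realizable words asymptotic to 3^n. So the at most 2^n words with constant signature are
  negligible, and which of them are realizable need not be decided. A centered letter-2 indicator of
  probability 1/3 has variance 2/9, and the factor 2 in the theorem compensates the half in S/2. No
  compactness argument is used: the walk is compared with its values at m grid times, with an error
  that is uniform in large n and small for large m.\<close>

lemma strict_mono_int_step:
  fixes f :: "int \<Rightarrow> 'a::order"
  assumes "\<And>k. f k < f (k + 1)"
  shows "strict_mono f"
proof (rule strict_monoI)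
  fix x y :: int assume "x < y"
  then show "f x < f y"
    by (induction rule: int_gr_induct) (use assms order.strict_trans in blast)+
qed

lemma quasi_periodic_int:
  fixes f :: "int \<Rightarrow> real"
  assumes "\<And>k. f (k + n) = f k + p"
  shows "f (k + n * q) = f k + p * of_int q"
proof (induction q rule: int_induct[where k=0])
  case (step1 i)
  then show ?case using assms[of "k + n * i"] by (simp add: algebra_simps)
next
  case (step2 i)
  then show ?case using assms[of "k + n * (i - 1)"] by (simp add: algebra_simps)
qed simp

lemma int_reduce:
  assumes "n > 0"
  obtains i :: nat and q :: int where "i \<in> {1..n}" "j = int i + int n * q"
proof
  have "0 \<le> (j - 1) mod int n" "(j - 1) mod int n < int n" using assms by auto
  then show "nat ((j - 1) mod int n + 1) \<in> {1..n}" "j = int (nat ((j - 1) mod int n + 1)) + int n * ((j - 1) div int n)"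
    using mult_div_mod_eq[of "int n" "j - 1"] by (auto simp: algebra_simps)
qed

lemma int_last_true:
  fixes a b :: int
  assumes "P a" "\<not> P b" "a < b"
  shows "\<exists>k. a \<le> k \<and> k < b \<and> P k \<and> \<not> P (k + 1)"
proof (rule ccontr)
  assume *: "\<not> ?thesis"
  have "k \<le> b \<longrightarrow> P k" if "a \<le> k" for k
    using that by (induction rule: int_ge_induct) (use * assms in auto)
  with assms show False by auto
qed

text \<open>This models a finite cyclically ordered set by its lifts to the universal cover of the
  circle, so that no wrap-around occurs. Points and midpoints have period \<open>2 * pi\<close>.
  Directions of lines have period \<open>pi\<close>, since a line through 0 meets the circle in
  antipodal points.\<close>

locale quasi_periodic =
  fixes f :: "int \<Rightarrow> real" and n :: int and p :: real
  assumes mono: "strict_mono f" and shift: "f (k + n) = f k + p" and n_pos: "n > 0"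
begin

lemma p_pos: "p > 0"
  using strict_monoD[OF mono, of 0 n] shift[of 0] n_pos by simp

lemma shift_mult: "f (k + n * q) = f k + p * of_int q"
  by (rule quasi_periodic_int) (rule shift)

lemma less_iff [simp]: "f i < f j \<longleftrightarrow> i < j" and le_iff [simp]: "f i \<le> f j \<longleftrightarrow> i \<le> j"
  and eq_iff [simp]: "f i = f j \<longleftrightarrow> i = j"
  using mono by (auto simp: strict_mono_less strict_mono_less_eq strict_mono_eq)

lemma locate: "\<exists>!k. f k \<le> x \<and> x < f (k + 1)"
proof -
  obtain q :: int where q: "(x - f 0) / p < of_int q" using ex_less_of_int by blast
  obtain r :: int where r: "of_int r < (x - f 0) / p" using ex_of_int_less by blast
  have 1: "\<not> f (n * q) \<le> x" "f (n * r) \<le> x"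
    using q r shift_mult[of 0 q] shift_mult[of 0 r] p_pos by (auto simp: field_simps)
  then have "n * r < n * q" by (metis le_less_trans less_iff not_le)
  from int_last_true[of "\<lambda>k. f k \<le> x", OF 1(2,1) this]
  obtain k where k: "f k \<le> x" "x < f (k + 1)" by auto
  show ?thesis
  proof (rule ex1I[of _ k])
    fix j assume j: "f j \<le> x \<and> x < f (j + 1)"
    have "f j < f (k + 1)" "f k < f (j + 1)" using j k by linarith+
    then have "j < k + 1" "k < j + 1" by (simp_all only: less_iff)
    then show "j = k" by linarith
  qed (use k in auto)
qed

text \<open>The counting function of the sequence up to an additive constant, including a term at
  \<open>x\<close> itself. All later counts of points and separators are differences of such
  functions.\<close>

definition idx :: "real \<Rightarrow> int" where "idx x = (THE k. f k \<le> x \<and> x < f (k + 1))"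

lemma idx: "f (idx x) \<le> x" "x < f (idx x + 1)"
  using theI'[OF locate[of x]] by (auto simp: idx_def)

lemma idx_eq: "f k \<le> x \<Longrightarrow> x < f (k + 1) \<Longrightarrow> idx x = k"
  using locate[of x] idx[of x] by blast

lemma idx_le_iff: "k \<le> idx x \<longleftrightarrow> f k \<le> x"
proof
  assume "k \<le> idx x"
  then have "f k \<le> f (idx x)" by (simp only: le_iff)
  then show "f k \<le> x" using idx(1)[of x] by linarith
next
  assume "f k \<le> x"
  then have "f k < f (idx x + 1)" using idx(2)[of x] by linarith
  then have "k < idx x + 1" by (simp only: less_iff)
  then show "k \<le> idx x" by linarith
qed

lemma idx_shift: "idx (x + p) = idx x + n"
  using idx[of x] shift[of "idx x"] shift[of "idx x + 1"] by (intro idx_eq) (auto simp: algebra_simps)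

lemma idx_self [simp]: "idx (f k) = k"
  by (rule idx_eq) auto

lemma card_between: "x \<le> y \<Longrightarrow> int (card {k. x < f k \<and> f k \<le> y}) = idx y - idx x"
proof -
  assume "x \<le> y"
  have "{k. x < f k \<and> f k \<le> y} = {idx x<..idx y}"
    by (auto simp: idx_le_iff[symmetric] not_le[symmetric] simp del: not_le)
  moreover have "idx x \<le> idx y" using \<open>x \<le> y\<close> idx(1)[of x] by (simp add: idx_le_iff)
  ultimately show ?thesis by simp
qed

lemma quasi_periodic_translate: "quasi_periodic (\<lambda>k. f (k + a) + b) n p"
proof
  show "strict_mono (\<lambda>k. f (k + a) + b)" by (auto simp: strict_mono_def)
  show "f (k + n + a) + b = f (k + a) + b + p" for k
    using shift[of "k + a"] by (simp add: algebra_simps)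
qed (rule n_pos)

end

lemma enumerate_periodic:
  fixes S :: "real set" and p x :: real
  assumes per: "\<And>y. y \<in> S \<longleftrightarrow> y + p \<in> S" and p: "p > 0"
    and fin: "finite (S \<inter> {x<..x+p})" and n: "card (S \<inter> {x<..x+p}) = n" "n > 0"
  shows "\<exists>f. quasi_periodic f (int n) p \<and> range f = S \<and> f 0 \<le> x \<and> x < f 1"
proof -
  define F where "F = S \<inter> {x<..x+p}"
  define xs where "xs = sorted_list_of_set F"
  have len: "length xs = n" and set: "set xs = F" and so: "sorted_wrt (<) xs"
    using fin n by (auto simp: xs_def F_def)
  \<comment> \<open>The sorted window is continued periodically. The shift by 1 gives its first
    element the index 1, so that \<open>f 0 \<le> x < f 1\<close>.\<close>
  define f where "f k = xs ! nat ((k - 1) mod int n) + p * of_int ((k - 1) div int n)" for k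
  have inF: "xs ! nat (k mod int n) \<in> F" for k
    using len set n by (metis nth_mem nat_less_iff pos_mod_bound pos_mod_sign of_nat_0_less_iff)
  have less: "xs ! i < xs ! j" if "i < j" "j < n" for i j
    using so that len by (simp add: sorted_wrt_nth_less)
  have f_eq: "f (r + 1 + int n * q) = xs ! nat r + p * of_int q" if "0 \<le> r" "r < int n" for r q
    using that n by (simp add: f_def)
  have step: "f k < f (k + 1)" for k
  proof -
    define r q where "r = (k - 1) mod int n" and "q = (k - 1) div int n"
    have k: "k = r + 1 + int n * q" and r: "0 \<le> r" "r < int n"
      using n mult_div_mod_eq[of "int n" "k - 1"] by (auto simp: r_def q_def)
    have fk: "f k = xs ! nat r + p * of_int q" using f_eq r k by simp
    show ?thesis
    proof (cases "r + 1 < int n")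
      case True
      have "f (k + 1) = xs ! nat (r + 1) + p * of_int q"
        using f_eq[of "r + 1" q] r True k by (simp add: algebra_simps)
      then show ?thesis using fk True r less[of "nat r" "nat (r + 1)"] by simp
    next
      case False
      then have k': "k + 1 = 0 + 1 + int n * (q + 1)" using k r by (simp add: algebra_simps)
      have "f (k + 1) = xs ! 0 + p * of_int (q + 1)"
        unfolding k' using f_eq[of 0 "q + 1"] n by simp
      moreover have "xs ! nat r \<in> F" "xs ! 0 \<in> F" using inF[of r] inF[of 0] r by auto
      ultimately show ?thesis using fk by (auto simp: F_def algebra_simps)
    qed
  qed
  have sh: "f (k + int n) = f k + p" for k
  proof -
    define r q where "r = (k - 1) mod int n" and "q = (k - 1) div int n"
    have k: "k = r + 1 + int n * q" and r: "0 \<le> r" "r < int n"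
      using n mult_div_mod_eq[of "int n" "k - 1"] by (auto simp: r_def q_def)
    then show ?thesis using f_eq[of r q] f_eq[of r "q + 1"] by (simp add: algebra_simps)
  qed
  have qp: "quasi_periodic f (int n) p"
    by standard (use step strict_mono_int_step sh n in auto)
  have perq: "y + p * of_int q \<in> S \<longleftrightarrow> y \<in> S" for y and q :: int
  proof (induction q rule: int_induct[where k=0])
    case (step1 i)
    then show ?case using per[of "y + p * of_int i"] by (simp add: algebra_simps)
  next
    case (step2 i)
    then show ?case using per[of "y + p * of_int (i - 1)"] by (simp add: algebra_simps)
  qed simp
  have "range f = S"
  proof (intro equalityI subsetI)
    fix y assume "y \<in> range f"
    then show "y \<in> S" using inF by (auto simp: f_def perq F_def)
  next
    fix y assume y: "y \<in> S"
    define q where "q = \<lceil>(y - x) / p\<rceil> - 1"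
    have "y - p * of_int q \<in> F"
    proof -
      have "of_int q < (y - x) / p" "(y - x) / p \<le> of_int q + 1" unfolding q_def by linarith+
      then show ?thesis using y p perq[of y "-q"] by (auto simp: F_def field_simps)
    qed
    then obtain i where i: "i < n" "xs ! i = y - p * of_int q"
      using set len by (metis in_set_conv_nth)
    have "f (int i + 1 + int n * q) = y"
      using i by (simp add: f_def)
    then show "y \<in> range f" by blast
  qed
  moreover have "(int n - 1) mod int n = int n - 1" using n by (intro mod_pos_pos_trivial) auto
  then have "f 0 \<le> x" "x < f 1"
    using f_eq[of "int n - 1" "-1"] f_eq[of 0 0] inF[of "int n - 1"] inF[of 0] n
    by (auto simp: F_def)
  ultimately show ?thesis using qp by blast
qed

text \<open>Intended for midpoints of arcs modulo half a turn: a bisector is a midpoint together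
  with its antipode. The classes are pairwise distinct, so each of the \<open>n\<close> contributes
  exactly one element to a window of length \<open>p\<close>.\<close>

lemma enumerate_classes:
  fixes m :: "int \<Rightarrow> real" and n :: nat and p x :: real
  assumes n: "n > 0" and p: "p > 0" and sh: "\<And>j. m (j + int n) = m j + 2 * p"
    and dist: "\<And>i j l. m i = m j + p * of_int l \<Longrightarrow> i mod int n = j mod int n"
  shows "\<exists>f. quasi_periodic f (int n) p \<and> range f = {m j + p * of_int l | j l. True} \<and> f 0 \<le> x \<and> x < f 1"
proof (rule enumerate_periodic)
  let ?S = "{m j + p * of_int l | j l. True}"
  have *: "m j + p * of_int l + p * of_int q \<in> ?S" for j l q
    unfolding mem_Collect_eq by (intro exI[of _ j] exI[of _ "l + q"]) (simp add: algebra_simps)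
  show "y \<in> ?S \<longleftrightarrow> y + p \<in> ?S" for y
  proof
    assume "y \<in> ?S"
    then obtain j l where "y = m j + p * of_int l" by auto
    then show "y + p \<in> ?S" using *[of j l 1] by simp
  next
    assume "y + p \<in> ?S"
    then obtain j l where "y + p = m j + p * of_int l" by auto
    then have "y = m j + p * of_int l + p * of_int (-1)" by simp
    then show "y \<in> ?S" using *[of j l "-1"] by simp
  qed
  \<comment> \<open>The representative of the class of \<open>m j\<close> in the window
    \<open>{x<..x+p}\<close>.\<close>
  define g where "g j = m j - p * of_int (\<lceil>(m j - x) / p\<rceil> - 1)" for j
  have g: "x < g j" "g j \<le> x + p" for j
  proof -
    define c where "c = \<lceil>(m j - x) / p\<rceil>"
    have "of_int (c - 1) < (m j - x) / p" "(m j - x) / p \<le> of_int c"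
      unfolding c_def by linarith+
    then have "p * of_int (c - 1) < m j - x" "m j - x \<le> p * of_int c"
      using p by (simp_all add: pos_less_divide_eq pos_divide_le_eq mult.commute)
    then show "x < g j" "g j \<le> x + p" by (simp_all add: g_def c_def algebra_simps)
  qed
  have "bij_betw g {0..<int n} (?S \<inter> {x<..x+p})"
  proof (rule bij_betwI')
    fix i j assume ij: "i \<in> {0..<int n}" "j \<in> {0..<int n}"
    show "(g i = g j) = (i = j)"
    proof
      assume "g i = g j"
      then have "m i = m j + p * of_int (\<lceil>(m i - x) / p\<rceil> - \<lceil>(m j - x) / p\<rceil>)" by (simp add: g_def algebra_simps)
      from dist[OF this] show "i = j" using ij by simp
    qed auto
  next
    fix i
    have "g i = m i + p * of_int (- (\<lceil>(m i - x) / p\<rceil> - 1))" by (simp add: g_def algebra_simps)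
    then have "g i \<in> ?S" by blast
    then show "g i \<in> ?S \<inter> {x<..x+p}" using g[of i] by (auto simp del: mem_Collect_eq)
  next
    fix y assume y: "y \<in> ?S \<inter> {x<..x+p}"
    then obtain j l where jl: "y = m j + p * of_int l" by auto
    have "m j = m (j mod int n) + 2 * p * of_int (j div int n)"
      using quasi_periodic_int[of m "int n" "2 * p" "j mod int n" "j div int n", OF sh] by simp
    then obtain l' where l': "y = g (j mod int n) + p * of_int l'"
      using jl by (intro that[of "2 * (j div int n) + l + (\<lceil>(m (j mod int n) - x) / p\<rceil> - 1)"])
        (simp add: g_def algebra_simps)
    have "\<bar>p * of_int l'\<bar> < p" using y g[of "j mod int n"] l' by auto
    then have "\<bar>of_int l' :: real\<bar> < 1" using p by (simp add: abs_mult)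
    then have "l' = 0" by linarith
    then show "\<exists>i\<in>{0..<int n}. y = g i" using l' n by (intro bexI[of _ "j mod int n"]) auto
  qed
  from bij_betw_finite[OF this] bij_betw_same_card[OF this]
  show "finite (?S \<inter> {x<..x+p})" "card (?S \<inter> {x<..x+p}) = n" by auto
qed (use assms in auto)

section \<open>Lines, sectors and regions\<close>

text \<open>The line through 0 with angle \<open>s\<close>. After rotation by \<open>- s\<close>,
  the sign of the imaginary part tells the side of the line, which later separates the
  sectors.\<close>

definition line_at :: "real \<Rightarrow> complex set" where
  "line_at s = {z. Im (z * cis (- s)) = 0}"

text \<open>The bisector of a chord passes through the center and through the midpoint of the arc.
  The inner product factors into \<open>sin ((t - s) / 2)\<close>, positive for arcs shorter than a
  full turn, and the equation of \<open>line_at\<close>.\<close>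

lemma perp_bisector_cis:
  assumes "s < t" "t < s + 2 * pi"
  shows "perp_bisector (cis s) (cis t) = line_at ((s + t) / 2)"
proof -
  have sin: "sin ((t - s) / 2) > 0" using assms by (intro sin_gt_zero) auto
  have "(z - midpoint (cis s) (cis t)) \<bullet> (cis t - cis s)
      = 2 * sin ((t - s) / 2) * Im (z * cis (- ((s + t) / 2)))" for z
  proof -
    have 1: "cis t - cis s = Complex (2 * sin ((t + s) / 2) * sin ((s - t) / 2)) (2 * sin ((t - s) / 2) * cos ((t + s) / 2))"
      by (simp add: complex_eq_iff cos_diff_cos sin_diff_sin)
    have "midpoint (cis s) (cis t) \<bullet> (cis t - cis s) = (norm (cis t)^2 - norm (cis s)^2) / 2"
      unfolding power2_norm_eq_inner midpoint_def by (simp add: inner_simps inner_commute)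
    also have "\<dots> = 0" by simp
    finally have "(z - midpoint (cis s) (cis t)) \<bullet> (cis t - cis s) = z \<bullet> (cis t - cis s)"
      by (simp add: inner_diff_left)
    also have "\<dots> = 2 * sin ((t - s) / 2) * (Im z * cos ((s + t) / 2) - Re z * sin ((s + t) / 2))"
    proof -
      have "sin ((s - t) / 2) = - sin ((t - s) / 2)" by (metis minus_diff_eq minus_divide_left sin_minus)
      then show ?thesis unfolding 1 by (simp add: inner_complex_def add.commute[of t s]) (simp add: algebra_simps)
    qed
    also have "\<dots> = 2 * sin ((t - s) / 2) * Im (z * cis (- ((s + t) / 2)))" by simp
    finally show ?thesis .
  qed
  then show ?thesis using sin by (auto simp: perp_bisector_def line_at_def)
qed

lemma Im_polar: "Im (complex_of_real r * cis \<theta> * cis (- s)) = r * sin (\<theta> - s)"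
proof -
  have "complex_of_real r * cis \<theta> * cis (- s) = complex_of_real r * cis (\<theta> - s)"
    by (simp add: mult.assoc cis_mult)
  then show ?thesis by (simp only:) simp
qed

lemma cis_in_line_at: "cis \<theta> \<in> line_at s \<longleftrightarrow> (\<exists>l::int. \<theta> = s + pi * of_int l)"
  using Im_polar[of 1 \<theta> s] by (auto simp: line_at_def sin_zero_iff_int2 algebra_simps)

lemma line_at_shift: "line_at (s + pi * of_int l) = line_at s"
proof -
  show ?thesis
  proof (intro set_eqI)
    fix z :: complex
    obtain r \<theta> where z: "z = complex_of_real r * cis \<theta>" by (metis rcis_Ex rcis_def)
    have "sin (\<theta> - (s + pi * of_int l)) = 0 \<longleftrightarrow> sin (\<theta> - s) = 0"
    proof -
      have "\<theta> - (s + pi * of_int l) = of_int i * pi \<longleftrightarrow> \<theta> - s = of_int (i + l) * pi" for i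
        by (auto simp: algebra_simps)
      then show ?thesis unfolding sin_zero_iff_int2 by (metis diff_add_cancel)
    qed
    then show "z \<in> line_at (s + pi * of_int l) \<longleftrightarrow> z \<in> line_at s"
      unfolding line_at_def z mem_Collect_eq Im_polar by simp
  qed
qed

definition sector :: "real \<Rightarrow> real \<Rightarrow> complex set" where
  "sector a b = {complex_of_real r * cis \<theta> | r \<theta>. 0 < r \<and> a < \<theta> \<and> \<theta> < b}"

lemma sectorI: "0 < r \<Longrightarrow> a < \<theta> \<Longrightarrow> \<theta> < b \<Longrightarrow> complex_of_real r * cis \<theta> \<in> sector a b"
  by (auto simp: sector_def)

lemma cis_in_sectorI: "a < \<theta> \<Longrightarrow> \<theta> < b \<Longrightarrow> cis \<theta> \<in> sector a b"
  using sectorI[of 1 a \<theta> b] by simp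

lemma cis_in_sector: "cis x \<in> sector a b \<longleftrightarrow> (\<exists>l::int. a < x + 2 * pi * of_int l \<and> x + 2 * pi * of_int l < b)"
proof
  assume "cis x \<in> sector a b"
  then obtain r \<theta> where r: "0 < r" "a < \<theta>" "\<theta> < b" "cis x = complex_of_real r * cis \<theta>"
    by (auto simp: sector_def)
  have "1 = norm (complex_of_real r * cis \<theta>)" unfolding r(4)[symmetric] by simp
  then have "r = 1" using r(1) by (simp add: norm_mult)
  then have "cis x = cis \<theta>" using r by simp
  then have "cis (\<theta> - x) = 1" by (simp flip: cis_divide)
  then have "cos (\<theta> - x) = 1" by (simp add: complex_eq_iff)
  then obtain l :: int where "\<theta> - x = of_int l * (2 * pi)" by (auto simp: cos_one_2pi_int)
  then have "\<theta> = x + 2 * pi * of_int l" by (simp add: algebra_simps)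
  then show "\<exists>l::int. a < x + 2 * pi * of_int l \<and> x + 2 * pi * of_int l < b" using r by blast
next
  assume "\<exists>l::int. a < x + 2 * pi * of_int l \<and> x + 2 * pi * of_int l < b"
  then obtain l :: int where l: "a < x + 2 * pi * of_int l" "x + 2 * pi * of_int l < b" by blast
  have "cis (x + 2 * pi * of_int l) = cis x" by (simp add: cis_mult[symmetric])
  then show "cis x \<in> sector a b" using cis_in_sectorI[OF l] by simp
qed

lemma connected_sector: "connected (sector a b)"
proof -
  have "sector a b = (\<lambda>(r, \<theta>). complex_of_real r * cis \<theta>) ` ({0<..} \<times> {a<..<b})"
    by (auto simp: sector_def image_iff Bex_def) blast
  moreover have "connected \<dots>"
    by (intro connected_continuous_image connected_Times)
       (auto simp: case_prod_beta intro!: continuous_intros)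
  ultimately show ?thesis by simp
qed

lemma connected_one_side:
  assumes C: "connected C" "C \<inter> line_at s = {}" and z: "z \<in> C" "Im (z * cis (- s)) < 0" and w: "w \<in> C"
  shows "Im (w * cis (- s)) < 0"
proof (rule ccontr)
  let ?f = "\<lambda>z. Im (z * cis (- s))"
  assume "\<not> ?thesis"
  then have "0 \<le> ?f w" by simp
  have "connected (?f ` C)"
    by (intro connected_continuous_image C(1) continuous_intros)
  then have "0 \<in> ?f ` C"
    by (rule connectedD_interval[OF _ imageI[OF z(1)] imageI[OF w] less_imp_le[OF z(2)] \<open>0 \<le> ?f w\<close>])
  then obtain u where "u \<in> C" "?f u = 0" by (metis (no_types, lifting) imageE)
  then have "u \<in> C \<inter> line_at s" by (simp add: line_at_def)
  then show False using C(2) by blast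
qed

text \<open>Induction from below gives \<open>i \<le> k i\<close>, induction from the top gives
  \<open>k i \<le> i\<close>.\<close>

lemma strict_mono_self_map:
  fixes k :: "nat \<Rightarrow> nat"
  assumes "\<And>i j. i \<in> {1..N} \<Longrightarrow> j \<in> {1..N} \<Longrightarrow> i < j \<Longrightarrow> k i < k j" "k ` {1..N} \<subseteq> {1..N}" "i \<in> {1..N}"
  shows "k i = i"
proof -
  have 1: "i \<in> {1..N} \<longrightarrow> i \<le> k i" for i
  proof (induction i)
    case (Suc i)
    then show ?case using assms(1)[of i "Suc i"] assms(2) by (cases "i = 0") (auto simp: image_subset_iff Suc_le_eq)
  qed simp
  have 2: "i \<le> N \<longrightarrow> N - i \<ge> 1 \<longrightarrow> i + k (N - i) \<le> N" for i
  proof (induction i)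
    case 0
    have "N \<in> {1..N}" if "1 \<le> N" using that by simp
    then have "k N \<in> {1..N}" if "1 \<le> N" using assms(2) that by blast
    then show ?case by auto
  next
    case (Suc i)
    show ?case
    proof (intro impI)
      assume "Suc i \<le> N" "1 \<le> N - Suc i"
      then have "k (N - Suc i) < k (N - i)" by (intro assms(1)) auto
      then show "Suc i + k (N - Suc i) \<le> N" using Suc \<open>Suc i \<le> N\<close> by auto
    qed
  qed
  show ?thesis using 1[of i] 2[of "N - i"] assms(3) by auto
qed

section \<open>Regions cut out by the bisectors of a lifted configuration\<close>

lemma bis_line_cis:
  assumes "quasi_periodic t (int n) (2 * pi)" and n: "n \<ge> 2" and i: "i \<in> {1..n}"
  shows "bis_line n (\<lambda>i. cis (t (int i))) i = line_at ((t (int i) + t (int i + 1)) / 2)"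
proof -
  interpret T: quasi_periodic t "int n" "2 * pi" by fact
  \<comment> \<open>For \<open>i = n\<close> the successor is point 1, whose lift at index
    \<open>n + 1\<close> is one full turn further.\<close>
  have P: "cis (t (int (i mod n + 1))) = cis (t (int i + 1))"
  proof (cases "i = n")
    case True
    then show ?thesis using T.shift[of 1] by (simp add: cis_mult[symmetric] add.commute)
  qed (use i in \<open>simp add: add.commute\<close>)
  have "t (int i) < t (int i + 1)" by simp
  moreover have "t (int i + 1) < t (int i + int n)" using n by simp
  ultimately show ?thesis unfolding bis_line_def P
    by (intro perp_bisector_cis) (auto simp: T.shift)
qed

text \<open>Generic position in terms of lifts. \<open>mid_in\<close> and \<open>line_mid\<close>
  say that \<open>\<alpha>\<close> enumerates the angles of both ends of all bisectors,
  \<open>mid_inj\<close> that the bisectors are distinct, \<open>t_notin\<close> that no point lies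
  on one. \<open>zero\<close> says that 1 lies on none and fixes the numbering.\<close>

locale configuration = T: quasi_periodic t "int n" "2 * pi" + L: quasi_periodic \<alpha> "int n" pi
  for t \<alpha> :: "int \<Rightarrow> real" and n :: nat +
  fixes m :: "int \<Rightarrow> real"
  defines "m \<equiv> (\<lambda>j. (t j + t (j + 1)) / 2)"
  assumes n3: "n \<ge> 3"
    and mid_in: "m j \<in> range \<alpha>" and t_notin: "t j \<notin> range \<alpha>"
    and line_mid: "\<exists>j. \<exists>l::int. \<alpha> k = m j + pi * of_int l"
    and mid_inj: "m i = m j + pi * of_int l \<Longrightarrow> i mod int n = j mod int n"
    and zero: "\<alpha> 0 < 0" "0 < \<alpha> 1"
begin

abbreviation P :: "nat \<Rightarrow> complex" where "P i \<equiv> cis (t (int i))"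

lemma bis_line_eq: "i \<in> {1..n} \<Longrightarrow> bis_line n P i = line_at (m (int i))"
  unfolding m_def using n3 by (intro bis_line_cis T.quasi_periodic_axioms) auto

lemma lines_eq: "(\<Union>i\<in>{1..n}. bis_line n P i) = (\<Union>k. line_at (\<alpha> k))"
proof -
  have "(\<Union>i\<in>{1..n}. bis_line n P i) = (\<Union>i\<in>{1..n}. line_at (m (int i)))"
    using bis_line_eq by auto
  also have "\<dots> = (\<Union>k. line_at (\<alpha> k))"
  proof (intro equalityI subsetI)
    fix z assume "z \<in> (\<Union>i\<in>{1..n}. line_at (m (int i)))"
    then show "z \<in> (\<Union>k. line_at (\<alpha> k))" using mid_in by (metis (no_types, lifting) UN_iff UNIV_I image_iff)
  next
    fix z assume "z \<in> (\<Union>k. line_at (\<alpha> k))"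
    then obtain j and l :: int where z: "z \<in> line_at (m j)" using line_mid line_at_shift by (metis (no_types, lifting) UN_iff)
    obtain i q where i: "i \<in> {1..n}" and j: "j = int i + int n * q"
      using n3 by (metis int_reduce neq0_conv not_numeral_le_zero)
    have "m (k + int n) = m k + 2 * pi" for k
      using T.shift[of k] T.shift[of "k + 1"] by (simp add: m_def algebra_simps)
    from quasi_periodic_int[of m, OF this, of i q]
    have "m j = m i + pi * of_int (2 * q)"
      using j by (simp add: algebra_simps)
    then have "z \<in> line_at (m i)" using z line_at_shift by metis
    then show "z \<in> (\<Union>i\<in>{1..n}. line_at (m (int i)))" using i by auto
  qed
  finally show ?thesis .
qed

lemma generic: "generic_points n P"
  unfolding generic_points_def
proof (intro conjI ballI)
  show "3 \<le> n" by (rule n3)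
  have "t (int n) < t (1 + int n)" by simp
  then show "ccw_unit_points n P"
    unfolding ccw_unit_points_def by (intro exI[of _ "\<lambda>i. t (int i)"]) (auto simp: strict_mono_on_def T.shift simp del: T.less_iff, auto)
  show "inj_on (bis_line n P) {1..n}"
  proof (rule inj_onI)
    fix i j assume ij: "i \<in> {1..n}" "j \<in> {1..n}" "bis_line n P i = bis_line n P j"
    have "cis (m i) \<in> line_at (m i)" by (auto simp: cis_in_line_at intro: exI[of _ 0])
    then have "cis (m i) \<in> line_at (m j)" using ij by (simp add: bis_line_eq)
    then obtain l :: int where "m i = m j + pi * of_int l" by (auto simp: cis_in_line_at)
    from mid_inj[OF this] have "int (i mod n) = int (j mod n)" by (simp add: zmod_int)
    then show "i = j" using ij by (cases "i = n"; cases "j = n") auto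
  qed
  show "P j \<notin> bis_line n P i" if ij: "i \<in> {1..n}" "j \<in> {1..n}" for i j
  proof
    assume "P j \<in> bis_line n P i"
    then obtain l :: int where l: "t j = m i + pi * of_int l" using bis_line_eq[OF ij(1)] cis_in_line_at by auto
    obtain k where "m i = \<alpha> k" using mid_in by auto
    then have "t j = \<alpha> (k + int n * l)" using l L.shift_mult[of k l] by simp
    then show False using t_notin by auto
  qed
  show "1 \<notin> bis_line n P i" if i: "i \<in> {1..n}" for i
  proof
    assume "1 \<in> bis_line n P i"
    then obtain l :: int where l: "0 = m i + pi * of_int l" using cis_in_line_at[of 0] bis_line_eq[OF i] by auto
    obtain k where "m i = \<alpha> k" using mid_in by auto
    then have k: "0 = \<alpha> (k + int n * l)" using l L.shift_mult[of k l] by simp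
    then have "\<alpha> 0 < \<alpha> (k + int n * l)" "\<alpha> (k + int n * l) < \<alpha> 1" using zero by auto
    then show False by (simp only: L.less_iff)
  qed
qed

text \<open>The index is that of the upper boundary, so by \<open>zero\<close> the angle 0, that is
  the point 1, belongs to \<open>sec 1\<close>.\<close>

abbreviation sec :: "nat \<Rightarrow> complex set" where "sec i \<equiv> sector (\<alpha> (int i - 1)) (\<alpha> (int i))"

lemma sec_avoids: "sec i \<inter> (\<Union>k. line_at (\<alpha> k)) = {}"
proof (rule ccontr)
  assume "\<not> ?thesis"
  then obtain r \<theta> k where r: "0 < r" "\<alpha> (int i - 1) < \<theta>" "\<theta> < \<alpha> (int i)" "complex_of_real r * cis \<theta> \<in> line_at (\<alpha> k)"
    by (auto simp: sector_def)
  then have "cis \<theta> \<in> line_at (\<alpha> k)"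
    using Im_polar[of r \<theta>] Im_polar[of 1 \<theta>] by (auto simp: line_at_def)
  then obtain l :: int where "\<theta> = \<alpha> (k + int n * l)" using cis_in_line_at L.shift_mult by auto
  then show False using r by simp
qed

lemma in_some_sec:
  assumes "z \<notin> (\<Union>k. line_at (\<alpha> k))"
  shows "\<exists>i\<in>{1..2*n}. z \<in> sec i"
proof -
  have "z \<noteq> 0" using assms by (auto simp: line_at_def)
  \<comment> \<open>Full turns are removed so that the angle lies in
    \<open>[\<alpha> 0, \<alpha> 0 + 2 * pi)\<close>, which the sectors with numbers 1 to
    \<open>2 * n\<close> cover up to the lines.\<close>
  define a where "a = \<lfloor>(Arg z - \<alpha> 0) / (2 * pi)\<rfloor>"
  define \<theta> where "\<theta> = Arg z - 2 * pi * of_int a"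
  have z: "z = complex_of_real (norm z) * cis \<theta>"
  proof -
    have "cis \<theta> = cis (Arg z)" by (simp add: \<theta>_def cis_divide[symmetric])
    then show ?thesis using rcis_cmod_Arg[of z] by (simp add: rcis_def)
  qed
  have "of_int a \<le> (Arg z - \<alpha> 0) / (2 * pi)" "(Arg z - \<alpha> 0) / (2 * pi) < of_int a + 1"
    unfolding a_def by linarith+
  then have th: "\<alpha> 0 \<le> \<theta>" "\<theta> < \<alpha> 0 + 2 * pi" by (auto simp: \<theta>_def field_simps)
  define k where "k = L.idx \<theta>"
  have k: "\<alpha> k \<le> \<theta>" "\<theta> < \<alpha> (k + 1)" using L.idx by (auto simp: k_def)
  have "\<alpha> 0 < \<alpha> (k + 1)" "\<alpha> k < \<alpha> (int n * 2)"
    using th k L.shift_mult[of 0 2] by (simp_all del: L.less_iff)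
  then have "0 < k + 1" "k < int n * 2" by (simp_all only: L.less_iff)
  then have k2: "0 \<le> k" "k < 2 * int n" by simp_all
  have "\<alpha> k \<noteq> \<theta>"
  proof
    assume "\<alpha> k = \<theta>"
    then have "z \<in> line_at (\<alpha> k)"
      unfolding line_at_def mem_Collect_eq by (subst z, subst Im_polar) simp
    then show False using assms by blast
  qed
  then have "z \<in> sec (nat (k + 1))"
    using k k2 \<open>z \<noteq> 0\<close> by (subst z, intro sectorI) auto
  then show ?thesis using k2 by (intro bexI[of _ "nat (k + 1)"]) auto
qed

text \<open>A boundary line of sector \<open>i\<close> does it. If \<open>j \<le> i + n\<close>,
  sector \<open>j\<close> lies in the half turn after \<open>\<alpha> (int i)\<close> and sector
  \<open>i\<close> in the half turn before it. Otherwise the line at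
  \<open>\<alpha> (int i - 1)\<close> has sector \<open>i\<close> in the half turn after it and
  sector \<open>j\<close> in the second half turn.\<close>

lemma sec_separated:
  assumes "1 \<le> i" "i < j" "j \<le> 2 * n"
  shows "\<exists>k. (\<forall>z\<in>sec i. \<forall>w\<in>sec j. Im (z * cis (- \<alpha> k)) < 0 \<and> Im (w * cis (- \<alpha> k)) > 0)
     \<or> (\<forall>z\<in>sec i. \<forall>w\<in>sec j. Im (w * cis (- \<alpha> k)) < 0 \<and> Im (z * cis (- \<alpha> k)) > 0)"
proof -
  have pos: "Im (z * cis (- \<alpha> k)) > 0" if z: "z \<in> sec i" and that: "k \<le> int i - 1" "int i \<le> k + int n" for z k i
  proof -
    obtain r \<theta> where r: "0 < r" "\<alpha> (int i - 1) < \<theta>" "\<theta> < \<alpha> (int i)" "z = complex_of_real r * cis \<theta>"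
      using z unfolding sector_def by blast
    have "\<alpha> k \<le> \<alpha> (int i - 1)" "\<alpha> (int i) \<le> \<alpha> k + pi" using that by (auto simp flip: L.shift)
    then have "sin (\<theta> - \<alpha> k) > 0" using r by (intro sin_gt_zero) (auto simp del: L.le_iff L.less_iff)
    then show ?thesis using r unfolding r(4) Im_polar by simp
  qed
  have neg: "Im (z * cis (- \<alpha> k)) < 0" if "z \<in> sec i" "k + int n \<le> int i - 1" "int i \<le> k + 2 * int n" for z k i
  proof -
    have "cis (- \<alpha> (k + int n)) = - cis (- \<alpha> k)"
      by (simp add: L.shift cis_mult[symmetric] cis_divide[symmetric])
    then show ?thesis using pos[of z i "k + int n"] that by simp
  qed
  show ?thesis
  proof (cases "j \<le> i + n")
    case True
    have "\<forall>z\<in>sec i. \<forall>w\<in>sec j. Im (z * cis (- \<alpha> (int i))) < 0 \<and> Im (w * cis (- \<alpha> (int i))) > 0"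
    proof (intro ballI conjI)
      fix z w assume "z \<in> sec i" "w \<in> sec j"
      then show "Im (w * cis (- \<alpha> (int i))) > 0" using pos[of w j "int i"] True assms by simp
      have e: "- \<alpha> (int i) = - \<alpha> (int i - 2 * int n) + - (2 * pi)"
        using L.shift_mult[of "int i" "-2"] by (simp add: algebra_simps)
      have "cis (- \<alpha> (int i)) = cis (- \<alpha> (int i - 2 * int n))"
        unfolding e cis_mult[symmetric] by (simp add: complex_eq_iff)
      then show "Im (z * cis (- \<alpha> (int i))) < 0"
        using neg[of z i "int i - 2 * int n"] \<open>z \<in> sec i\<close> n3 by simp
    qed
    then show ?thesis by blast
  next
    case False
    then have "\<forall>z\<in>sec i. \<forall>w\<in>sec j. Im (w * cis (- \<alpha> (int i - 1))) < 0 \<and> Im (z * cis (- \<alpha> (int i - 1))) > 0"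
      using assms n3 by (intro ballI conjI neg[of _ j] pos[of _ i]) auto
    then show ?thesis by blast
  qed
qed

lemma connected_in_sec:
  assumes C: "connected C" "C \<inter> (\<Union>k. line_at (\<alpha> k)) = {}" and "z \<in> C" "w \<in> C"
    and z: "z \<in> sec i" "i \<in> {1..2*n}" and w: "w \<in> sec j" "j \<in> {1..2*n}"
  shows "i = j"
proof -
  have *: "False" if "z \<in> C" "w \<in> C" "z \<in> sec i" "w \<in> sec j" "1 \<le> i" "i < j" "j \<le> 2 * n" for z w i j
  proof -
    from sec_separated[OF that(5-7)] that(3,4) obtain k where
      "(Im (z * cis (- \<alpha> k)) < 0 \<and> Im (w * cis (- \<alpha> k)) > 0) \<or> (Im (w * cis (- \<alpha> k)) < 0 \<and> Im (z * cis (- \<alpha> k)) > 0)"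
      by blast
    moreover have "C \<inter> line_at (\<alpha> k) = {}" using C by blast
    ultimately show False
      using connected_one_side[OF C(1), of "\<alpha> k" z w] connected_one_side[OF C(1), of "\<alpha> k" w z] that(1,2) by auto
  qed
  show ?thesis using *[of z w i j] *[of w z j i] assms by (metis atLeastAtMost_iff linorder_neqE_nat)
qed

lemma sec_disjoint:
  assumes "z \<in> sec i" "z \<in> sec j" "i \<in> {1..2*n}" "j \<in> {1..2*n}"
  shows "i = j"
proof -
  have "connected (sec i)" by (rule connected_sector)
  from connected_in_sec[OF this sec_avoids assms(1) assms(1) assms(1) assms(3) assms(2) assms(4)]
  show ?thesis .
qed

lemma sec_mid: "cis ((\<alpha> (int i - 1) + \<alpha> (int i)) / 2) \<in> sec i"
proof -
  have "\<alpha> (int i - 1) < \<alpha> (int i)" by simp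
  then show ?thesis by (intro cis_in_sectorI) (simp_all del: L.less_iff)
qed

text \<open>Sectors are connected, avoid the lines, cover the complement of the lines, and no
  connected set avoiding the lines meets two of them. So they are its components.\<close>

lemma regions_eq: "regions n P = sec ` {1..2*n}"
proof -
  define X where "X = (\<Union>k. line_at (\<alpha> k))"
  have avoid: "sec i \<subseteq> - X" for i using sec_avoids[of i] unfolding X_def by blast
  have comp: "connected_component_set (- X) z = sec i" if z: "z \<in> sec i" "i \<in> {1..2*n}" for z i
  proof (intro equalityI subsetI)
    fix w assume w: "w \<in> connected_component_set (- X) z"
    then have "w \<in> - X" using connected_component_subset by blast
    then have "\<exists>j\<in>{1..2*n}. w \<in> sec j" unfolding X_def by (intro in_some_sec) simp
    then obtain j where j: "j \<in> {1..2*n}" "w \<in> sec j" by blast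
    have "connected_component_set (- X) z \<inter> X = {}" using connected_component_subset[of "- X" z] by blast
    moreover have "z \<in> connected_component_set (- X) z"
    proof -
      have "z \<in> - X" using avoid z(1) by (rule subsetD)
      then show ?thesis by (simp add: connected_component_refl)
    qed
    ultimately have "i = j"
      by (rule connected_in_sec[OF connected_connected_component[of "- X" z], unfolded X_def[symmetric], OF _ _ w z j(2,1)])
    then show "w \<in> sec i" using j(2) by simp
  next
    fix w assume "w \<in> sec i"
    then show "w \<in> connected_component_set (- X) z"
      by (rule subsetD[OF connected_component_maximal[OF z(1) connected_sector avoid]])
  qed
  have "components (- X) = sec ` {1..2*n}"
  proof (intro equalityI subsetI)
    fix C assume "C \<in> components (- X)"
    then obtain z where z: "z \<in> - X" "C = connected_component_set (- X) z" by (auto simp: components_def)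
    then have "\<exists>i\<in>{1..2*n}. z \<in> sec i" unfolding X_def by (intro in_some_sec) simp
    then obtain i where i: "i \<in> {1..2*n}" "z \<in> sec i" by blast
    show "C \<in> sec ` {1..2*n}" unfolding z(2) comp[OF i(2,1)] by (rule imageI[OF i(1)])
  next
    fix C assume "C \<in> sec ` {1..2*n}"
    then obtain i where i: "i \<in> {1..2*n}" "C = sec i" by (rule imageE)
    define z where "z = cis ((\<alpha> (int i - 1) + \<alpha> (int i)) / 2)"
    have z: "z \<in> sec i" unfolding z_def by (rule sec_mid)
    have "C = connected_component_set (- X) z" unfolding i(2) by (rule comp[OF z i(1), symmetric])
    moreover have "z \<in> - X" using avoid z by blast
    ultimately show "C \<in> components (- X)" unfolding components_def by (rule image_eqI)
  qed
  then show ?thesis unfolding regions_def lines_eq X_def .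
qed

lemma inj_sec: "inj_on sec {1..2*n}"
proof (rule inj_onI)
  fix i j assume ij: "i \<in> {1..2*n}" "j \<in> {1..2*n}" "sec i = sec j"
  show "i = j" by (rule sec_disjoint[OF sec_mid _ ij(1,2)]) (use sec_mid[of i] ij(3) in simp)
qed

lemma numbering_sec: "ccw_numbering n P sec"
  unfolding ccw_numbering_def
proof (intro conjI)
  show "bij_betw sec {1..2*n} (regions n P)"
    using inj_sec by (simp add: bij_betw_def regions_eq)
  show "1 \<in> sec 1" using cis_in_sectorI[of "\<alpha> 0" 0 "\<alpha> 1"] zero by simp
  \<comment> \<open>Middle angles of the sectors serve as test points, except that the numbering
    demands the angle 0 in the first region.\<close>
  define \<tau> where "\<tau> i = (if i = 1 then 0 else (\<alpha> (int i - 1) + \<alpha> (int i)) / 2)" for i :: nat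
  have "\<tau> i < \<tau> j" if "1 \<le> i" "i < j" for i j
  proof -
    have "\<alpha> (int i) \<le> \<alpha> (int j - 1)" "\<alpha> (int i - 1) < \<alpha> (int i)" "\<alpha> (int j - 1) < \<alpha> (int j)" "\<alpha> 1 \<le> \<alpha> (int i)"
      using that by simp_all
    then show ?thesis using that zero by (auto simp: \<tau>_def simp del: L.less_iff L.le_iff)
  qed
  moreover have "\<tau> (2 * n) < 2 * pi"
  proof -
    have "\<alpha> (2 * int n - 1) < \<alpha> (2 * int n)" by simp
    moreover have "\<alpha> (2 * int n) = \<alpha> 0 + 2 * pi" using L.shift_mult[of 0 2] by (simp add: mult.commute)
    ultimately show ?thesis using zero n3 by (simp add: \<tau>_def)
  qed
  moreover have "cis (\<tau> i) \<in> sec i" if "1 \<le> i" for i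
    using sec_mid[of i] cis_in_sectorI[of "\<alpha> 0" 0 "\<alpha> 1"] zero by (auto simp: \<tau>_def)
  ultimately show "\<exists>t. strict_mono_on {1..2 * n} t \<and> t 1 = 0 \<and> t (2 * n) < 2 * pi \<and> (\<forall>i\<in>{1..2 * n}. cis (t i) \<in> sec i)"
    by (intro exI[of _ \<tau>]) (auto simp: strict_mono_on_def \<tau>_def)
qed

text \<open>A numbering differs from \<open>sec\<close> by a self-map \<open>k\<close> of the
  indices. The test angles increase within one turn, which makes \<open>k\<close> strictly
  increasing, hence the identity.\<close>

lemma numbering_unique:
  assumes R: "ccw_numbering n P R" and i: "i \<in> {1..2*n}"
  shows "R i = sec i"
proof -
  note R' = R[unfolded ccw_numbering_def regions_eq]
  note bij = R'[THEN conjunct1] and 1 = R'[THEN conjunct2, THEN conjunct1]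
  from R'[THEN conjunct2, THEN conjunct2] obtain \<tau> where
    \<tau>: "strict_mono_on {1..2*n} \<tau>" "\<tau> 1 = 0" "\<tau> (2*n) < 2 * pi" "\<forall>i\<in>{1..2*n}. cis (\<tau> i) \<in> R i"
    by (elim exE conjE) (rule that)
  have "\<forall>i\<in>{1..2*n}. \<exists>k. k \<in> {1..2*n} \<and> R i = sec k"
  proof
    fix i assume "i \<in> {1..2*n}"
    then have "R i \<in> sec ` {1..2*n}" by (rule bspec[OF bij_betwE[OF bij]])
    then show "\<exists>k. k \<in> {1..2*n} \<and> R i = sec k" by (elim imageE) (intro exI conjI)
  qed
  from bchoice[OF this] obtain k where k: "\<And>i. i \<in> {1..2*n} \<Longrightarrow> k i \<in> {1..2*n} \<and> R i = sec (k i)" by blast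
  have one: "1 \<in> {1..2*n}" using n3 by simp
  have s1: "1 \<in> sec 1" using cis_in_sectorI[of "\<alpha> 0" 0 "\<alpha> 1"] zero by simp
  have k1: "k 1 = 1" using sec_disjoint[of 1 "k 1" 1] k[OF one] 1 s1 one by auto
  have kinj: "k i \<noteq> k j" if "i \<in> {1..2*n}" "j \<in> {1..2*n}" "i \<noteq> j" for i j
  proof
    assume "k i = k j"
    then have "R i = R j" using k[OF that(1)] k[OF that(2)] by simp
    then show False using inj_onD[OF bij_betw_imp_inj_on[OF bij] _ that(1,2)] that(3) by blast
  qed
  have \<tau>_le: "0 \<le> \<tau> i \<and> \<tau> i < 2 * pi" if "i \<in> {1..2*n}" for i
  proof -
    have "\<tau> 1 \<le> \<tau> i" "\<tau> i \<le> \<tau> (2*n)"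
      using strict_mono_on_leD[OF \<tau>(1) one that] strict_mono_on_leD[OF \<tau>(1) that, of "2*n"] that one by simp_all
    then show ?thesis using \<tau>(2,3) by auto
  qed
  \<comment> \<open>The first sector straddles the angle 0, so an angle in
    \<open>[0, 2 * pi)\<close> may enter it from either end. All other sectors lie within
    \<open>(0, 2 * pi)\<close>, which forces \<open>l = 0\<close>, and \<open>L.idx\<close> gives
    their number.\<close>
  have kidx: "int (k i) - 1 = L.idx (\<tau> i)" if i: "i \<in> {1..2*n}" "i \<noteq> 1" for i
  proof -
    have "cis (\<tau> i) \<in> sec (k i)" using bspec[OF \<tau>(4) i(1)] k[OF i(1)] by simp
    then obtain l :: int where l: "\<alpha> (int (k i) - 1) < \<tau> i + 2 * pi * of_int l" "\<tau> i + 2 * pi * of_int l < \<alpha> (int (k i))"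
      unfolding cis_in_sector by (elim exE conjE) (rule that)
    have ki: "1 < k i" "k i \<le> 2 * n" using k[OF i(1)] kinj[OF i(1) one i(2)] k1 by auto
    have "\<alpha> 1 \<le> \<alpha> (int (k i) - 1)" "\<alpha> (int (k i)) \<le> \<alpha> (int n * 2)" using ki by auto
    then have "0 < \<tau> i + 2 * pi * of_int l" "\<tau> i + 2 * pi * of_int l < 2 * pi"
      using l zero L.shift_mult[of 0 2] by (auto simp del: L.le_iff L.less_iff)
    then have "2 * pi * of_int l < 2 * pi * 1" "2 * pi * (-1) < 2 * pi * of_int l"
      using \<tau>_le[OF i(1)] by linarith+
    moreover have "0 < 2 * pi" by simp
    ultimately have "of_int l < (1::real)" "(-1::real) < of_int l" by (simp_all only: mult_less_cancel_left_pos)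
    then have "l = 0" by linarith
    then show ?thesis using l L.idx_eq[of "int (k i) - 1" "\<tau> i"] by simp
  qed
  have "k i < k j" if "i \<in> {1..2*n}" "j \<in> {1..2*n}" "i < j" for i j
  proof (cases "i = 1")
    case True
    then show ?thesis using k1 k[OF that(2)] kinj[OF that(1,2)] that by (simp add: Suc_leI order_neq_le_trans)
  next
    case False
    have "\<tau> i < \<tau> j" by (rule strict_mono_onD[OF \<tau>(1) that])
    then have "L.idx (\<tau> i) \<le> L.idx (\<tau> j)"
      using L.idx(1)[of "\<tau> i"] by (subst L.idx_le_iff) simp
    then show ?thesis using kidx[OF that(1) False] kidx[OF that(2)] that(3) kinj[OF that(1,2)] False that(1) by auto
  qed
  moreover have "k ` {1..2*n} \<subseteq> {1..2*n}" using k by blast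
  ultimately have "k i = i" using i by (rule strict_mono_self_map)
  then show ?thesis using k[OF i] by simp
qed

text \<open>A sector is shorter than a full turn, so each point on the circle has at most one lift
  in its angular interval. The map \<open>?g\<close> sends a lift to its index in
  \<open>{1..n}\<close>.\<close>

lemma card_sec: "card {j\<in>{1..n}. P j \<in> sec i} = card {j. \<alpha> (int i - 1) < t j \<and> t j < \<alpha> (int i)}"
proof -
  let ?g = "\<lambda>j. nat ((j - 1) mod int n + 1)"
  have n: "int n > 0" using n3 by simp
  have dec: "j = int (?g j) + int n * ((j - 1) div int n)" and gr: "?g j \<in> {1..n}" for j
    using mult_div_mod_eq[of "int n" "j - 1"] pos_mod_bound[OF n, of "j - 1"] pos_mod_sign[OF n, of "j - 1"]
    by (auto simp: algebra_simps)
  have "bij_betw ?g {j. \<alpha> (int i - 1) < t j \<and> t j < \<alpha> (int i)} {j\<in>{1..n}. P j \<in> sec i}"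
  proof (rule bij_betwI')
    fix x y assume xy: "x \<in> {j. \<alpha> (int i - 1) < t j \<and> t j < \<alpha> (int i)}" "y \<in> {j. \<alpha> (int i - 1) < t j \<and> t j < \<alpha> (int i)}"
    show "(?g x = ?g y) = (x = y)"
    proof
      assume g: "?g x = ?g y"
      define l where "l = (x - 1) div int n - (y - 1) div int n"
      have "x = int (?g y) + int n * ((x - 1) div int n)" "y = int (?g y) + int n * ((y - 1) div int n)"
        using dec[of x] dec[of y] unfolding g by blast+
      then have x: "x = y + int n * l" unfolding l_def right_diff_distrib by linarith
      have "\<alpha> (int i) \<le> \<alpha> (int i - 1 + int n)" using n3 by simp
      then have "\<bar>t x - t y\<bar> < 2 * pi" using xy pi_gt_zero L.shift[of "int i - 1"] by auto
      then have "\<bar>2 * pi * of_int l\<bar> < 2 * pi * 1" using x T.shift_mult[of y l] by simp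
      then have "\<bar>of_int l :: real\<bar> < 1" by (simp add: abs_mult)
      then have "l = 0" by linarith
      then show "x = y" using x by simp
    next
      assume "x = y"
      then show "?g x = ?g y" by (simp only:)
    qed
  next
    fix x assume x: "x \<in> {j. \<alpha> (int i - 1) < t j \<and> t j < \<alpha> (int i)}"
    have "t x = t (int (?g x)) + 2 * pi * of_int ((x - 1) div int n)"
      using dec[of x] T.shift_mult[of "int (?g x)" "(x - 1) div int n"] by simp
    then show "?g x \<in> {j\<in>{1..n}. P j \<in> sec i}" using x gr[of x] by (auto simp: cis_in_sector)
  next
    fix j assume j: "j \<in> {j\<in>{1..n}. P j \<in> sec i}"
    then obtain l :: int where l: "\<alpha> (int i - 1) < t (int j) + 2 * pi * of_int l" "t (int j) + 2 * pi * of_int l < \<alpha> (int i)"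
      by (auto simp: cis_in_sector)
    have "(int j + int n * l - 1) mod int n = (int j - 1) mod int n"
      by (metis add_diff_eq diff_add_eq mod_mult_self2)
    also have "\<dots> = int j - 1" using j by (auto intro!: mod_pos_pos_trivial)
    finally have "?g (int j + int n * l) = j" by simp
    then show "\<exists>x\<in>{j. \<alpha> (int i - 1) < t j \<and> t j < \<alpha> (int i)}. j = ?g x"
      using l T.shift_mult[of "int j" l] by (intro bexI[of _ "int j + int n * l"]) auto
  qed
  from bij_betw_same_card[OF this] show ?thesis by simp
qed

text \<open>This removes the plane from the problem: from here on, occupancy words are counts of
  terms of \<open>t\<close> between consecutive terms of \<open>\<alpha>\<close>.\<close>

lemma occupancy_iff:
  "occupancy_word n P v \<longleftrightarrow> (\<forall>i\<in>{1..2*n}. v i = card {j. \<alpha> (int i - 1) < t j \<and> t j < \<alpha> (int i)})"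
proof
  assume "occupancy_word n P v"
  then obtain R where R: "ccw_numbering n P R" "\<forall>i\<in>{1..2*n}. v i = card {j\<in>{1..n}. P j \<in> R i}"
    unfolding occupancy_word_def by (elim exE conjE) (rule that)
  show "\<forall>i\<in>{1..2*n}. v i = card {j. \<alpha> (int i - 1) < t j \<and> t j < \<alpha> (int i)}"
  proof
    fix i assume i: "i \<in> {1..2*n}"
    show "v i = card {j. \<alpha> (int i - 1) < t j \<and> t j < \<alpha> (int i)}"
      using bspec[OF R(2) i] unfolding numbering_unique[OF R(1) i] card_sec .
  qed
next
  assume v: "\<forall>i\<in>{1..2*n}. v i = card {j. \<alpha> (int i - 1) < t j \<and> t j < \<alpha> (int i)}"
  show "occupancy_word n P v"
    unfolding occupancy_word_def
  proof (intro exI[of _ sec] conjI numbering_sec ballI)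
    fix i assume "i \<in> {1..2*n}"
    then show "v i = card {j\<in>{1..n}. P j \<in> sec i}"
      unfolding card_sec by (rule bspec[OF v])
  qed
qed

end

section \<open>The states of a realizable word\<close>

lemma occupancy_word_cong:
  assumes n: "n > 0" and PQ: "\<And>i. i \<in> {1..n} \<Longrightarrow> P i = Q i"
  shows "occupancy_word n P v \<longleftrightarrow> occupancy_word n Q v"
proof -
  have "P (i mod n + 1) = Q (i mod n + 1)" for i
    using n by (intro PQ) (auto simp: Suc_leI)
  then have "bis_line n P i = bis_line n Q i" if "i \<in> {1..n}" for i
    using PQ[OF that] by (simp add: bis_line_def)
  then have r: "regions n P = regions n Q" by (simp add: regions_def)
  have c: "{j\<in>{1..n}. P j \<in> A} = {j\<in>{1..n}. Q j \<in> A}" for A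
    using PQ by auto
  show ?thesis by (simp only: occupancy_word_def ccw_numbering_def r c)
qed

lemma extend_ccw:
  fixes \<tau> :: "nat \<Rightarrow> real"
  assumes n: "n > 0" and \<tau>: "strict_mono_on {1..n} \<tau>" "\<tau> n < \<tau> 1 + p"
  obtains t where "quasi_periodic t (int n) p" "\<And>i. i \<in> {1..n} \<Longrightarrow> t (int i) = \<tau> i"
proof -
  define t where "t j = \<tau> (nat ((j - 1) mod int n + 1)) + p * of_int ((j - 1) div int n)" for j
  have t: "t (int i + int n * q) = \<tau> i + p * of_int q" if "i \<in> {1..n}" for i q
  proof -
    have e: "int i + int n * q - 1 = (int i - 1) + int n * q" by simp
    have "(int i - 1) mod int n = int i - 1" "(int i - 1) div int n = 0"
      using that by (auto intro: mod_pos_pos_trivial div_pos_pos_trivial)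
    then have "(int i + int n * q - 1) mod int n = int i - 1" "(int i + int n * q - 1) div int n = q"
      unfolding e using n by auto
    then show ?thesis by (simp add: t_def)
  qed
  have "quasi_periodic t (int n) p"
  proof
    show "strict_mono t"
    proof (rule strict_mono_int_step)
      fix k
      obtain i q where i: "i \<in> {1..n}" and k: "k = int i + int n * q" using int_reduce[OF n] by blast
      show "t k < t (k + 1)"
      proof (cases "i = n")
        case True
        then have k1: "k + 1 = int 1 + int n * (q + 1)" using k by (simp add: algebra_simps)
        have "t (k + 1) = \<tau> 1 + p * of_int (q + 1)" unfolding k1 by (rule t) (use n in simp)
        moreover have "t k = \<tau> i + p * of_int q" unfolding k by (rule t[OF i])
        ultimately show ?thesis using \<tau>(2) True by (simp add: algebra_simps)
      next
        case False
        then have i1: "Suc i \<in> {1..n}" using i by auto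
        have k1: "k + 1 = int (Suc i) + int n * q" using k by simp
        have "t (k + 1) = \<tau> (Suc i) + p * of_int q" unfolding k1 by (rule t[OF i1])
        moreover have "t k = \<tau> i + p * of_int q" unfolding k by (rule t[OF i])
        ultimately show ?thesis using strict_mono_onD[OF \<tau>(1) i i1] by simp
      qed
    qed
    show "t (k + int n) = t k + p" for k
    proof -
      obtain i q where i: "i \<in> {1..n}" and k: "k = int i + int n * q" using int_reduce[OF n] by blast
      have k1: "k + int n = int i + int n * (q + 1)" using k by (simp add: algebra_simps)
      show ?thesis unfolding k1 t[OF i] unfolding k t[OF i] by (simp add: algebra_simps)
    qed
  qed (use n in simp)
  moreover have "t (int i) = \<tau> i" if "i \<in> {1..n}" for i using t[OF that, of 0] by simp
  ultimately show ?thesis using that by blast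
qed

text \<open>The angles are extended quasi-periodically, and \<open>\<alpha>\<close> enumerates the
  midpoints modulo \<open>pi\<close>. The genericity assumptions then turn into the axioms of the
  locale.\<close>

lemma configuration_exists:
  assumes P: "generic_points n P"
  obtains t \<alpha> where "configuration t \<alpha> n" "\<And>i. i \<in> {1..n} \<Longrightarrow> P i = cis (t (int i))"
proof -
  have n3: "n \<ge> 3" using P by (simp add: generic_points_def)
  then have n: "n > 0" by simp
  have inj: "inj_on (bis_line n P) {1..n}" using P by (simp only: generic_points_def)
  have notin: "P j \<notin> bis_line n P i" if "i \<in> {1..n}" "j \<in> {1..n}" for i j
    using P that by (simp only: generic_points_def) blast
  have one: "1 \<notin> bis_line n P i" if "i \<in> {1..n}" for i
    using P that by (simp only: generic_points_def) blast
  obtain \<tau> :: "nat \<Rightarrow> real" where "strict_mono_on {1..n} \<tau>" "\<tau> n < \<tau> 1 + 2 * pi"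
      and \<tau>: "\<And>i. i \<in> {1..n} \<Longrightarrow> P i = cis (\<tau> i)"
    using P unfolding generic_points_def ccw_unit_points_def by blast
  from extend_ccw[OF n this(1,2)] obtain t where t: "quasi_periodic t (int n) (2 * pi)"
    and t\<tau>: "\<And>i. i \<in> {1..n} \<Longrightarrow> t (int i) = \<tau> i" by blast
  interpret T: quasi_periodic t "int n" "2 * pi" by fact
  have Pt: "P i = cis (t (int i))" if "i \<in> {1..n}" for i using \<tau> t\<tau> that by simp
  define m where "m j = (t j + t (j + 1)) / 2" for j
  have line: "bis_line n P i = line_at (m (int i))" if i: "i \<in> {1..n}" for i
  proof -
    have "i mod n + 1 \<in> {1..n}" using n by (auto simp: Suc_leI)
    then show ?thesis using bis_line_cis[OF t, of i] i n3 Pt[of i] Pt[of "i mod n + 1"]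
      by (simp add: bis_line_def m_def)
  qed
  have msh: "m (j + int n) = m j + 2 * pi" for j
    using T.shift[of j] T.shift[of "j + 1"] by (simp add: m_def algebra_simps)
  have mq: "m (j + int n * q) = m j + pi * of_int (2 * q)" for j q
    using quasi_periodic_int[of m "int n" "2 * pi" j q, OF msh] by (simp add: algebra_simps)
  \<comment> \<open>Congruent midpoints span the same bisector, and distinct indices have distinct
    bisectors.\<close>
  have dist: "i mod int n = j mod int n" if ij: "m i = m j + pi * of_int l" for i j l
  proof -
    obtain a q where a: "a \<in> {1..n}" "i = int a + int n * q" using int_reduce[OF n] by blast
    obtain b r where b: "b \<in> {1..n}" "j = int b + int n * r" using int_reduce[OF n] by blast
    have "m a = m b + pi * of_int (2 * r + l - 2 * q)"
      using ij mq[of a q] mq[of b r] a b by (simp add: algebra_simps)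
    then have "line_at (m a) = line_at (m b)" using line_at_shift by metis
    then have "bis_line n P a = bis_line n P b" using a b line by simp
    then have "a = b" by (rule inj_onD[OF inj _ a(1) b(1)])
    then show ?thesis unfolding a(2) b(2) by simp
  qed
  have "\<exists>f. quasi_periodic f (int n) pi \<and> range f = {m j + pi * of_int l | j l. True} \<and> f 0 \<le> 0 \<and> 0 < f 1"
    by (rule enumerate_classes[where m = m, OF n pi_gt_zero msh]) (erule dist)
  then obtain \<alpha> where \<alpha>: "quasi_periodic \<alpha> (int n) pi" "range \<alpha> = {m j + pi * of_int l | j l. True}"
    "\<alpha> 0 \<le> 0" "0 < \<alpha> 1" by blast
  have on: "cis x \<in> bis_line n P i" if "i \<in> {1..n}" "x = m (int i) + pi * of_int l" for x i l
    using line[OF that(1)] that(2) cis_in_line_at by auto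
  have red: "\<exists>i\<in>{1..n}. \<exists>l. m j + pi * of_int q = m (int i) + pi * of_int l" for j q
  proof -
    obtain a r where a: "a \<in> {1..n}" "j = int a + int n * r" using int_reduce[OF n] by blast
    then show ?thesis using mq[of a r] by (intro bexI[of _ a] exI[of _ "2 * r + q"]) (auto simp: algebra_simps)
  qed
  have rep: "\<exists>i\<in>{1..n}. \<exists>l. x = m (int i) + pi * of_int l" if x: "x \<in> range \<alpha>" for x
  proof -
    obtain j q where "x = m j + pi * of_int q" using x unfolding \<alpha>(2) by blast
    then show ?thesis using red[of j q] by simp
  qed
  \<comment> \<open>The enumeration only provides \<open>\<alpha> 0 \<le> 0\<close>; the inequality
    is strict because the point 1 lies on no bisector.\<close>
  have "\<alpha> 0 \<noteq> 0"
  proof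
    assume "\<alpha> 0 = 0"
    then obtain i l where "i \<in> {1..n}" "0 = m (int i) + pi * of_int l" using rep[of "\<alpha> 0"] by auto
    then have "cis 0 \<in> bis_line n P i" using on by blast
    then show False using one[OF \<open>i \<in> {1..n}\<close>] by simp
  qed
  moreover have "t j \<notin> range \<alpha>" for j
  proof
    assume "t j \<in> range \<alpha>"
    then obtain i l where i: "i \<in> {1..n}" "t j = m (int i) + pi * of_int l" using rep by blast
    obtain b r where b: "b \<in> {1..n}" "j = int b + int n * r" using int_reduce[OF n] by blast
    have "t b = m (int i) + pi * of_int (l - 2 * r)"
      using i b T.shift_mult[of b r] by (simp add: algebra_simps)
    then have "P b \<in> bis_line n P i" using on[OF i(1)] Pt[OF b(1)] by metis
    then show False using notin[OF i(1) b(1)] by simp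
  qed
  moreover have "m j \<in> range \<alpha>" for j
  proof -
    have "m j = m j + pi * of_int 0" by simp
    then show ?thesis unfolding \<alpha>(2) by blast
  qed
  moreover have "\<exists>j. \<exists>l::int. \<alpha> k = m j + pi * of_int l" for k
    using rep[OF rangeI] by blast
  ultimately have "configuration_axioms t \<alpha> n"
    unfolding configuration_axioms_def m_def[symmetric] using \<alpha>(3,4) n3 dist
    by (auto simp: order_le_less)
  then have "configuration t \<alpha> n" by (intro configuration.intro t \<alpha>(1))
  then show ?thesis using that Pt by blast
qed

section \<open>Open intervals and the recursion for the signature\<close>

context configuration
begin

lemma mid_between: "t j < m j" "m j < t (j + 1)"
proof -
  have "t j < t (j + 1)" by simp
  then show "t j < m j" "m j < t (j + 1)" by (simp_all add: m_def del: T.less_iff)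
qed

sublocale M: quasi_periodic m "int n" "2 * pi"
proof
  show "strict_mono m"
    using mid_between by (intro strict_mono_int_step) (metis order.strict_trans)
  show "m (k + int n) = m k + 2 * pi" for k
    using T.shift[of k] T.shift[of "k + 1"] by (simp add: m_def algebra_simps)
qed (use n3 in simp)

text \<open>This is 1 from a point to the following midpoint, and 0 from there to the next point.\<close>

definition strand_state :: "real \<Rightarrow> int" where "strand_state x = T.idx x - M.idx x"

text \<open>Points and midpoints alternate on the circle, so their counting functions differ by 0 or
  1.\<close>

lemma strand_state_bounds: "0 \<le> strand_state x" "strand_state x \<le> 1"
proof -
  have "t (M.idx x) \<le> x" "m (T.idx x - 1) \<le> x"
    using M.idx(1)[of x] T.idx(1)[of x] mid_between[of "M.idx x"] mid_between[of "T.idx x - 1"] by auto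
  then have "M.idx x \<le> T.idx x" "T.idx x - 1 \<le> M.idx x"
    by (simp_all only: T.idx_le_iff M.idx_le_iff)
  then show "0 \<le> strand_state x" "strand_state x \<le> 1" by (auto simp: strand_state_def)
qed

text \<open>Since \<open>idx\<close> counts a term at its own position, the interval is already
  closed at its midpoint.\<close>

lemma strand_state_mid: "strand_state (m j) = 0"
  using T.idx_eq[of j "m j"] mid_between[of j] by (simp add: strand_state_def)

lemma strand_state_shift: "strand_state (x + 2 * pi) = strand_state x"
  by (simp add: strand_state_def T.idx_shift M.idx_shift)

text \<open>The number of open intervals at the two opposite ends of one line. As \<open>idx\<close>
  includes the endpoint, it is the state just after the line is crossed.\<close>

definition state :: "int \<Rightarrow> int" where "state k = strand_state (\<alpha> k) + strand_state (\<alpha> (k + int n))"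

text \<open>Exactly one end of each line is the midpoint of the arc it bisects. If both ends were
  midpoints, \<open>mid_inj\<close> would put their indices in one class modulo \<open>n\<close>, so
  they would differ by full turns and not by half a turn.\<close>

lemma separator_cases:
  obtains j where "m j = \<alpha> k" "\<And>i. m i \<noteq> \<alpha> (k + int n)" | j where "m j = \<alpha> (k + int n)" "\<And>i. m i \<noteq> \<alpha> k"
proof -
  have not_both: False if "m i = \<alpha> k" "m j = \<alpha> (k + int n)" for i j
  proof -
    have "m j = m i + pi * of_int 1" using that by (simp add: L.shift)
    from mid_inj[OF this] obtain q where q: "j = i + int n * q"
      by (metis add.commute mod_eqE mult.commute)
    have "m j = m i + pi * (2 * of_int q)" using M.shift_mult[of i q] q by simp
    then have "of_int (2 * q) = (1 :: real)" using \<open>m j = m i + pi * of_int 1\<close> by simp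
    then have "2 * q = 1" by linarith
    then show False by presburger
  qed
  obtain j and l :: int where jl: "\<alpha> k = m j + pi * of_int l" using line_mid by blast
  show ?thesis
  proof (cases "even l")
    case True
    then obtain q where "l = 2 * q" by (auto elim: evenE)
    then have "m (j + int n * q) = \<alpha> k" using jl M.shift_mult[of j q] by simp
    then show ?thesis using not_both that by metis
  next
    case False
    then obtain q where "l = 2 * q + 1" by (auto elim: oddE)
    then have "m (j + int n * (q + 1)) = \<alpha> (k + int n)"
      using jl M.shift_mult[of j "q + 1"] by (simp add: L.shift algebra_simps)
    then show ?thesis using not_both that by metis
  qed
qed

text \<open>At the end of the line that is a midpoint the strand state is 0, so only the opposite
  end can contribute.\<close>

lemma state_bounds: "0 \<le> state k" "state k \<le> 1"
proof -
  show "0 \<le> state k" using strand_state_bounds by (simp add: state_def)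
  show "state k \<le> 1"
    by (rule separator_cases[of k]) (metis add_0 add_0_right state_def strand_state_bounds(2) strand_state_mid)+
qed

lemma state_shift: "state (k + int n) = state k"
proof -
  have "\<alpha> (k + int n + int n) = \<alpha> k + 2 * pi" by (simp only: L.shift)
  then have "strand_state (\<alpha> (k + int n + int n)) = strand_state (\<alpha> k)" by (simp only: strand_state_shift)
  then show ?thesis by (simp add: state_def)
qed

lemma idx_points: "int (card {j. \<alpha> (k - 1) < t j \<and> t j < \<alpha> k}) = T.idx (\<alpha> k) - T.idx (\<alpha> (k - 1))"
proof -
  have "{j. \<alpha> (k - 1) < t j \<and> t j < \<alpha> k} = {j. \<alpha> (k - 1) < t j \<and> t j \<le> \<alpha> k}"
    using t_notin by (auto simp: order_le_less)
  then show ?thesis by (simp add: T.card_between)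
qed

lemma idx_mids: "M.idx (\<alpha> k) - M.idx (\<alpha> (k - 1)) = int (card {j. m j = \<alpha> k})"
proof -
  have "{j. \<alpha> (k - 1) < m j \<and> m j \<le> \<alpha> k} = {j. m j = \<alpha> k}"
  proof (intro equalityI subsetI)
    fix j assume "j \<in> {j. \<alpha> (k - 1) < m j \<and> m j \<le> \<alpha> k}"
    moreover obtain i where "m j = \<alpha> i" using mid_in by auto
    ultimately show "j \<in> {j. m j = \<alpha> k}" by auto
  qed auto
  then show ?thesis using M.card_between[of "\<alpha> (k - 1)" "\<alpha> k"] by simp
qed

text \<open>Between two consecutive lines, every point in the two opposite regions opens an
  interval. Crossing the next line meets exactly one midpoint, which closes one.\<close>

lemma state_step:
  "int (card {j. \<alpha> (k - 1) < t j \<and> t j < \<alpha> k}) +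
   int (card {j. \<alpha> (k + int n - 1) < t j \<and> t j < \<alpha> (k + int n)}) + state (k - 1) = 1 + state k"
proof -
  have one: "card {j. m j = \<alpha> i} = 1" if "m j = \<alpha> i" for i j
  proof -
    have "{j. m j = \<alpha> i} = {j}" unfolding that[symmetric] by simp
    then show ?thesis by simp
  qed
  have "card {j. m j = \<alpha> k} + card {j. m j = \<alpha> (k + int n)} = 1"
    by (rule separator_cases[of k]) (use one in auto)
  then show ?thesis
    using idx_points[of k] idx_points[of "k + int n"] idx_mids[of k] idx_mids[of "k + int n"]
    by (simp add: state_def strand_state_def algebra_simps)
qed

end

lemma realizable_states:
  assumes v: "v \<in> realizable_words n"
  obtains s :: "nat \<Rightarrow> nat" where "\<And>k. s k \<le> 1" "s n = s 0"
    "\<And>k. k \<in> {1..n} \<Longrightarrow> v k + v (k + n) + s (k - 1) = 1 + s k"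
proof -
  obtain P where P: "generic_points n P" "occupancy_word n P v" using v by (auto simp: realizable_words_def)
  obtain t \<alpha> where c: "configuration t \<alpha> n" and Pt: "\<And>i. i \<in> {1..n} \<Longrightarrow> P i = cis (t (int i))"
    using configuration_exists[OF P(1)] by blast
  interpret configuration t \<alpha> n "\<lambda>j. (t j + t (j + 1)) / 2" by fact
  have "occupancy_word n (\<lambda>i. cis (t (int i))) v"
    using P(2) occupancy_word_cong[of n P "\<lambda>i. cis (t (int i))" v, OF _ Pt] n3 by simp
  then have occ: "v i = card {j. \<alpha> (int i - 1) < t j \<and> t j < \<alpha> (int i)}" if "i \<in> {1..2*n}" for i
    using that by (auto simp: occupancy_iff)
  show ?thesis
  proof (rule that[of "\<lambda>k. nat (state (int k))"])
    show "nat (state (int k)) \<le> 1" for k using state_bounds[of "int k"] by simp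
    show "nat (state (int n)) = nat (state (int 0))" using state_shift[of 0] by simp
    show "v k + v (k + n) + nat (state (int (k - 1))) = 1 + nat (state (int k))" if "k \<in> {1..n}" for k
      using state_step[of "int k"] occ[of k] occ[of "k + n"] that state_bounds[of "int k"] state_bounds[of "int k - 1"]
      by (simp add: of_nat_diff)
  qed
qed

section \<open>Placing points according to a word\<close>

text \<open>The data of a word and its states, continued to all integers with periods
  \<open>2 * int n\<close> and \<open>int n\<close>. By \<open>step\<close> the states are constant
  iff the signature is constantly 1, so \<open>ex0\<close> and \<open>ex1\<close> express that it is
  not.\<close>

locale word_states =
  fixes n :: nat and vv ss :: "int \<Rightarrow> nat"
  assumes n3: "n \<ge> 3" and vv_le: "vv k \<le> 1" and ss_le: "ss k \<le> 1"
    and vv_shift: "vv (k + 2 * int n) = vv k" and ss_shift: "ss (k + int n) = ss k"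
    and step: "vv k + vv (k + int n) + ss (k - 1) = 1 + ss k"
    and ex1: "\<exists>k. ss k = 1" and ex0: "\<exists>k. ss k = 0"
begin

lemma ss_shift_mult: "ss (k + int n * q) = ss k"
proof -
  have "real (ss (k + int n * q)) = real (ss k) + 0 * of_int q"
    by (rule quasi_periodic_int) (simp add: ss_shift)
  then show ?thesis by simp
qed

text \<open>The signature letter is 2 here, so both opposite cells carry a point.\<close>

lemma up_cell: "ss (k - 1) = 0 \<Longrightarrow> ss k \<noteq> 0 \<Longrightarrow> vv k = 1"
  using step[of k] vv_le[of k] vv_le[of "k + int n"] ss_le[of k] by auto

lemma shift_beyond: "\<exists>q. k \<le> a + int n * q"
proof -
  have "int n * (\<bar>k\<bar> + \<bar>a\<bar>) \<ge> 1 * (\<bar>k\<bar> + \<bar>a\<bar>)" using n3 by (intro mult_right_mono) auto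
  then show ?thesis by (intro exI[of _ "\<bar>k\<bar> + \<bar>a\<bar>"]) auto
qed

lemma shift_below: "\<exists>q. a + int n * q \<le> k"
proof -
  obtain q where "a - k \<le> 0 + int n * q" using shift_beyond by blast
  then show ?thesis by (intro exI[of _ "- q"]) auto
qed

text \<open>Distances forward to a state 1 and backward to a state 0. They are finite because both
  states occur and recur with period \<open>n\<close>.\<close>

definition ahead :: "int \<Rightarrow> nat" where "ahead k = (LEAST e. ss (k + int e) = 1)"
definition behind :: "int \<Rightarrow> nat" where "behind k = (LEAST e. ss (k - int e) = 0)"

lemma ahead_ex: "\<exists>e. ss (k + int e) = 1"
proof -
  obtain a where "ss a = 1" using ex1 by blast
  moreover obtain q where "k \<le> a + int n * q" using shift_beyond by blast
  ultimately show ?thesis by (intro exI[of _ "nat (a + int n * q - k)"]) (simp add: ss_shift_mult)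
qed

lemma behind_ex: "\<exists>e. ss (k - int e) = 0"
proof -
  obtain a where "ss a = 0" using ex0 by blast
  moreover obtain q where "a + int n * q \<le> k" using shift_below by blast
  ultimately show ?thesis by (intro exI[of _ "nat (k - (a + int n * q))"]) (simp add: ss_shift_mult)
qed

lemma ahead_Suc: "ss k = 0 \<Longrightarrow> ahead k = Suc (ahead (k + 1))"
proof -
  assume k: "ss k = 0"
  obtain e where "ss (k + int e) = 1" using ahead_ex by blast
  from Least_Suc[of "\<lambda>e. ss (k + int e) = 1", OF this] k
  show ?thesis by (simp add: ahead_def add.assoc)
qed

lemma behind_Suc: "ss k = 1 \<Longrightarrow> behind k = Suc (behind (k - 1))"
proof -
  assume k: "ss k = 1"
  obtain e where "ss (k - int e) = 0" using behind_ex by blast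
  from Least_Suc[of "\<lambda>e. ss (k - int e) = 0", OF this] k
  show ?thesis by (simp add: behind_def diff_diff_eq)
qed

text \<open>The lengths of the cells shrink by the factor 3 along a run of states 0 and grow by 3 along a run
  of states 1. So the first, respectively last, cell of a run outweighs the rest of it, which
  forces midpoints of consecutive points into the cells prescribed by the states.\<close>

definition gap :: "int \<Rightarrow> real" where
  "gap k = 3 ^ (if ss k = 0 then ahead k else behind k)"

lemma ss_cases: "ss k = 0 \<or> ss k = 1"
  using ss_le[of k] by auto

lemma gap_ge: "gap k \<ge> 3"
  using ss_cases[of k] by (auto simp: gap_def ahead_Suc behind_Suc)

lemma gap_pos: "gap k > 0"
  using gap_ge[of k] by linarith

lemma gap_shift: "gap (k + int n) = gap k"
proof -
  have "k + int n + int e = k + int e + int n" "k + int n - int e = k - int e + int n" for e by auto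
  then show ?thesis by (simp only: gap_def ahead_def behind_def ss_shift)
qed

lemma gap_contract: "ss k = 0 \<Longrightarrow> ss (k + 1) = 0 \<Longrightarrow> gap k = 3 * gap (k + 1)"
  by (simp add: gap_def ahead_Suc[of k])

lemma gap_expand: "ss k = 1 \<Longrightarrow> ss (k - 1) = 1 \<Longrightarrow> gap k = 3 * gap (k - 1)"
  by (simp add: gap_def behind_Suc[of k])

text \<open>The primitive of \<open>gap\<close> in both directions. It gives the left ends of the
  cells; the point of an occupied cell \<open>k\<close> will sit just after
  \<open>Y k\<close>.\<close>

definition Y :: "int \<Rightarrow> real" where "Y k = sum gap {0..<k} - sum gap {k..<0}"

lemma Y_step: "Y (k + 1) = Y k + gap k"
proof (cases "k \<ge> 0")
  case True
  then have "{0..<k+1} = insert k {0..<k}" by auto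
  then show ?thesis using True by (simp add: Y_def)
next
  case False
  then have "{k..<0} = insert k {k+1..<0}" by auto
  then show ?thesis using False by (simp add: Y_def)
qed

definition period :: real where "period = Y (int n)"

lemma Y_shift: "Y (k + int n) = Y k + period"
proof (induction k rule: int_induct[where k=0])
  case base
  show ?case by (simp add: period_def Y_def)
next
  case (step1 i)
  have "Y (i + 1 + int n) = Y (i + int n) + gap (i + int n)" using Y_step[of "i + int n"] by (simp add: algebra_simps)
  then show ?case using step1 by (simp add: Y_step gap_shift)
next
  case (step2 i)
  have "Y (i + int n) = Y (i - 1 + int n) + gap (i - 1 + int n)" using Y_step[of "i - 1 + int n"] by (simp add: algebra_simps)
  then show ?case using step2 Y_step[of "i - 1"] by (simp add: gap_shift)
qed

sublocale Y: quasi_periodic Y "int n" period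
proof
  show "strict_mono Y" by (rule strict_mono_int_step) (simp add: Y_step gap_pos)
qed (use n3 Y_shift in auto)

text \<open>A geometric series of ratio 1/3: all cells of the run after the first add up to less
  than half of the first. \<open>Y_expand\<close> is the mirror image for runs of states 1.\<close>

lemma Y_contract:
  assumes "a \<le> b" "\<And>i. a \<le> i \<Longrightarrow> i \<le> b \<Longrightarrow> ss i = 0"
  shows "Y (b + 1) - Y (a + 1) \<le> (gap a - gap b) / 2"
  using assms
proof (induction b rule: int_ge_induct)
  case (step i)
  have "gap i = 3 * gap (i + 1)" using step by (intro gap_contract) auto
  then show ?case using step Y_step[of "i + 1"] by auto
qed simp

lemma Y_expand:
  assumes "a \<le> b" "\<And>i. a \<le> i \<Longrightarrow> i \<le> b \<Longrightarrow> ss i = 1"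
  shows "Y b - Y a \<le> (gap b - gap a) / 2"
  using assms
proof (induction b rule: int_ge_induct)
  case (step i)
  have "gap (i + 1) = 3 * gap i" using gap_expand[of "i + 1"] step by auto
  then show ?case using step Y_step[of i] by auto
qed simp

text \<open>The recursion for the states telescopes over a period, so the word has the right number
  of points.\<close>

lemma sum_vv: "sum vv {1..2 * int n} = n"
proof -
  have e: "{1..2 * int n} = {1..int n} \<union> (\<lambda>k. k + int n) ` {1..int n}"
  proof (intro equalityI subsetI)
    fix x assume "x \<in> {1..2 * int n}"
    then show "x \<in> {1..int n} \<union> (\<lambda>k. k + int n) ` {1..int n}"
      by (cases "x \<le> int n") (auto intro!: image_eqI[of _ _ "x - int n"])
  qed auto
  have "sum vv {1..2 * int n} = sum vv {1..int n} + (\<Sum>k\<in>{1..int n}. vv (k + int n))"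
  proof -
    have "(\<Sum>k\<in>(\<lambda>k. k + int n) ` {1..int n}. vv k) = (\<Sum>k\<in>{1..int n}. vv (k + int n))"
      by (subst sum.reindex) (simp_all add: o_def)
    moreover have "sum vv ({1..int n} \<union> (\<lambda>k. k + int n) ` {1..int n}) = sum vv {1..int n} + sum vv ((\<lambda>k. k + int n) ` {1..int n})"
      by (rule sum.union_disjoint) auto
    ultimately show ?thesis unfolding e by simp
  qed
  also have "\<dots> = (\<Sum>k\<in>{1..int n}. vv k + vv (k + int n))" by (simp add: sum.distrib)
  finally have *: "int (sum vv {1..2 * int n}) = (\<Sum>k\<in>{1..int n}. int (vv k + vv (k + int n)))" by simp
  have "int (vv k + vv (k + int n)) = 1 + int (ss k) - int (ss (k - 1))" for k
    using step[of k] by linarith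
  then have "int (sum vv {1..2 * int n}) = (\<Sum>k\<in>{1..int n}. 1 + int (ss k) - int (ss (k - 1)))"
    using * by simp
  also have "\<dots> = int m + int (ss (int m)) - int (ss 0)" if "m = n" for m
  proof -
    have "(\<Sum>k\<in>{1..int m}. 1 + int (ss k) - int (ss (k - 1))) = int m + int (ss (int m)) - int (ss 0)" for m
    proof (induction m)
      case (Suc m)
      have "{1..int (Suc m)} = insert (int (Suc m)) {1..int m}" by auto
      then show ?case using Suc by simp
    qed simp
    then show ?thesis using that by simp
  qed
  finally have "int (sum vv {1..2 * int n}) = int n + int (ss (int n)) - int (ss 0)" by simp
  then have "int (sum vv {1..2 * int n}) = int n" using ss_shift[of 0] by (simp del: of_nat_sum)
  then show ?thesis by (simp only: of_nat_eq_iff)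
qed

text \<open>\<open>u j\<close> is the cell of the point with index \<open>j\<close>; there are
  \<open>n\<close> points in the \<open>2 * n\<close> cells of a full turn.\<close>

lemma points_enumeration:
  obtains u :: "int \<Rightarrow> int" where "quasi_periodic (\<lambda>j. of_int (u j)) (int n) (2 * real n)" "range u = {k. vv k = 1}"
proof -
  define S where "S = real_of_int ` {k. vv k = 1}"
  have bij: "bij_betw real_of_int {k\<in>{1..2 * int n}. vv k = 1} (S \<inter> {0<..0 + 2 * real n})"
  proof (rule bij_betw_imageI)
    show "real_of_int ` {k\<in>{1..2 * int n}. vv k = 1} = S \<inter> {0<..0 + 2 * real n}"
    proof (intro equalityI subsetI)
      fix x assume "x \<in> S \<inter> {0<..0 + 2 * real n}"
      then obtain k where "x = of_int k" "vv k = 1" "0 < real_of_int k" "real_of_int k \<le> 2 * real n" by (auto simp: S_def)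
      moreover then have "1 \<le> k" "k \<le> 2 * int n" by linarith+
      ultimately show "x \<in> real_of_int ` {k\<in>{1..2 * int n}. vv k = 1}" by auto
    next
      fix x assume "x \<in> real_of_int ` {k\<in>{1..2 * int n}. vv k = 1}"
      then obtain k where "x = of_int k" "vv k = 1" "1 \<le> k" "k \<le> 2 * int n" by auto
      moreover then have "0 < real_of_int k" "real_of_int k \<le> 2 * real n" by linarith+
      ultimately show "x \<in> S \<inter> {0<..0 + 2 * real n}" by (auto simp: S_def)
    qed
  qed (simp add: inj_on_def)
  have crd: "card {k\<in>{1..2 * int n}. vv k = 1} = n"
  proof -
    have "card {k\<in>{1..2 * int n}. vv k = 1} = (\<Sum>k\<in>{k\<in>{1..2 * int n}. vv k = 1}. 1)" by simp
    also have "\<dots> = (\<Sum>k\<in>{1..2 * int n}. if vv k = 1 then 1 else 0)" by (rule sum.inter_filter) simp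
    also have "\<dots> = sum vv {1..2 * int n}"
    proof (rule sum.cong)
      show "(if vv k = 1 then 1 else 0) = vv k" for k using vv_le[of k] by auto
    qed simp
    finally show ?thesis by (simp only: sum_vv)
  qed
  have fin: "finite {k\<in>{1..2 * int n}. vv k = 1}" by (rule finite_subset[of _ "{1..2 * int n}"]) auto
  have c: "finite (S \<inter> {0<..0 + 2 * real n})" "card (S \<inter> {0<..0 + 2 * real n}) = n"
    using bij_betw_finite[OF bij] fin bij_betw_same_card[OF bij, symmetric] by (blast, simp only: crd)
  have per: "y \<in> S \<longleftrightarrow> y + 2 * real n \<in> S" for y
  proof
    assume "y \<in> S"
    then obtain k where "y = of_int k" "vv k = 1" by (auto simp: S_def)
    then show "y + 2 * real n \<in> S" unfolding S_def by (intro image_eqI[of _ _ "k + 2 * int n"]) (auto simp: vv_shift)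
  next
    assume "y + 2 * real n \<in> S"
    then obtain k where k: "y + 2 * real n = of_int k" "vv k = 1" by (auto simp: S_def)
    then show "y \<in> S" using vv_shift[of "k - 2 * int n"] unfolding S_def by (intro image_eqI[of _ _ "k - 2 * int n"]) auto
  qed
  obtain f where f: "quasi_periodic f (int n) (2 * real n)" "range f = S"
    using enumerate_periodic[of S "2 * real n" 0 n, OF per _ c] n3 by auto
  have fi: "f j = of_int \<lfloor>f j\<rfloor>" for j using f(2) rangeI[of f j] by (auto simp: S_def)
  show ?thesis
  proof (rule that[of "\<lambda>j. \<lfloor>f j\<rfloor>"])
    show "quasi_periodic (\<lambda>j. real_of_int \<lfloor>f j\<rfloor>) (int n) (2 * real n)" using f(1) by (simp flip: fi)
    have "real_of_int ` range (\<lambda>j. \<lfloor>f j\<rfloor>) = real_of_int ` {k. vv k = 1}"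
      using f(2) by (simp add: image_image S_def flip: fi)
    then show "range (\<lambda>j. \<lfloor>f j\<rfloor>) = {k. vv k = 1}" by (rule inj_image_eq_iff[THEN iffD1, rotated]) (simp add: inj_def)
  qed
qed

end

text \<open>The perturbation by $\eta$ times distinct powers of 2 ensures, for all but countably many $\eta$,
  that midpoints are incongruent modulo the period: a sum of two powers of 2 determines both.\<close>

locale word_points = word_states +
  fixes u :: "int \<Rightarrow> int" and \<eta> :: real and w t mid :: "int \<Rightarrow> real"
  assumes u: "quasi_periodic (\<lambda>j. of_int (u j)) (int n) (2 * real n)" and range_u: "range u = {k. vv k = 1}"
    and eta: "0 < \<eta>" "\<eta> * 2 ^ (2 * n) < 1 / 2"
  defines "w \<equiv> (\<lambda>k. 2 ^ nat (k mod (2 * int n)))"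
    and "t \<equiv> (\<lambda>j. Y (u j) + \<eta> * w (u j))"
    and "mid \<equiv> (\<lambda>j. (t j + t (j + 1)) / 2)"
begin

sublocale U: quasi_periodic "\<lambda>j. of_int (u j)" "int n" "2 * real n" by (rule u)

lemma u_less [simp]: "u i < u j \<longleftrightarrow> i < j" using U.less_iff[of i j] by simp
lemma u_eq [simp]: "u i = u j \<longleftrightarrow> i = j" using U.eq_iff[of i j] by (simp del: U.eq_iff)

lemma u_shift: "u (j + int n * q) = u j + 2 * int n * q"
proof -
  have "real_of_int (u (j + int n * q)) = real_of_int (u j + 2 * int n * q)" using U.shift_mult[of j q] by simp
  then show ?thesis by linarith
qed

lemma vv_u [simp]: "vv (u j) = 1" using range_u by blast

lemma u_surj: "vv k = 1 \<Longrightarrow> \<exists>j. u j = k" using range_u by (metis (mono_tags) imageE mem_Collect_eq)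

lemma no_point: "u j < k \<Longrightarrow> k < u (j + 1) \<Longrightarrow> vv k = 0"
proof (rule ccontr)
  assume k: "u j < k" "k < u (j + 1)" "vv k \<noteq> 0"
  then obtain i where "k = u i" using u_surj[of k] vv_le[of k] by (auto simp: le_Suc_eq)
  then show False using k by auto
qed

lemma around: "vv k = 0 \<Longrightarrow> \<exists>j. u j < k \<and> k < u (j + 1)"
proof -
  assume k: "vv k = 0"
  have "real_of_int (u (U.idx (of_int k))) \<le> of_int k" "of_int k < real_of_int (u (U.idx (of_int k) + 1))"
    by (rule U.idx)+
  then have "u (U.idx (of_int k)) \<le> k" "k < u (U.idx (of_int k) + 1)" by linarith+
  moreover have "u (U.idx (of_int k)) \<noteq> k"
  proof
    assume e: "u (U.idx (of_int k)) = k"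
    show False using vv_u[of "U.idx (of_int k)"] k unfolding e by simp
  qed
  ultimately show ?thesis by (intro exI[of _ "U.idx (of_int k)"]) auto
qed

text \<open>A state can rise only at an occupied cell. So from one point up to the next the states
  read 1, ..., 1, 0, ..., 0, where one of the two runs may be missing.\<close>

lemma state_antimono:
  assumes "u j \<le> a" "a \<le> b" "b < u (j + 1)" "ss a = 0"
  shows "ss b = 0"
  using assms(2,3)
proof (induction b rule: int_ge_induct)
  case (step i)
  then have "ss i = 0" "vv (i + 1) = 0" using assms(1) no_point[of j "i + 1"] by auto
  then show ?case using up_cell[of "i + 1"] by fastforce
qed (use assms in simp)

text \<open>Without a point in \<open>n\<close> consecutive cells the states would not increase over
  a whole period, hence would be constant, against \<open>ex0\<close> and
  \<open>ex1\<close>.\<close>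

lemma point_in_period: "\<exists>k. x < k \<and> k \<le> x + int n \<and> vv k = 1"
proof (rule ccontr)
  assume *: "\<not> ?thesis"
  define j where "j = U.idx (of_int x)"
  have "real_of_int (u j) \<le> of_int x" "of_int x < real_of_int (u (j + 1))" unfolding j_def by (rule U.idx)+
  then have j: "u j \<le> x" "x < u (j + 1)" by linarith+
  then have j2: "x + int n < u (j + 1)" using * vv_u[of "j + 1"] by (meson not_le)
  obtain a where a: "ss a = 0" using ex0 by blast
  obtain b where b: "ss b = 1" using ex1 by blast
  define a' where "a' = x + (a - x) mod int n"
  define b' where "b' = x + (b - x) mod int n"
  have "a = a' + int n * ((a - x) div int n)" "b = b' + int n * ((b - x) div int n)"
    by (simp_all add: a'_def b'_def)
  then have ss': "ss a' = 0" "ss b' = 1" using a b ss_shift_mult by metis+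
  have r: "x \<le> a'" "a' < x + int n" "x \<le> b'" "b' < x + int n" using n3 by (auto simp: a'_def b'_def)
  have "ss (x + int n) = 0" using state_antimono[of j a' "x + int n"] j j2 r ss' by simp
  then have "ss x = 0" by (simp add: ss_shift)
  then have "ss b' = 0" using state_antimono[of j x b'] j j2 r by simp
  then show False using ss' by simp
qed

lemma w_bounds: "0 < \<eta> * w k" "\<eta> * w k < 1 / 2"
proof -
  have "nat (k mod (2 * int n)) \<le> 2 * n" using n3 pos_mod_bound[of "2 * int n" k] by linarith
  then have "w k \<le> 2 ^ (2 * n)" unfolding w_def by (intro power_increasing) auto
  then have "\<eta> * w k \<le> \<eta> * 2 ^ (2 * n)" using eta by (intro mult_left_mono) auto
  then show "\<eta> * w k < 1 / 2" using eta by linarith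
  show "0 < \<eta> * w k" using eta by (simp add: w_def)
qed

lemma t_bounds: "Y (u j) < t j" "t j < Y (u j) + 1 / 2"
  using w_bounds[of "u j"] by (auto simp: t_def)

lemma mid_bounds: "(Y (u j) + Y (u (j + 1))) / 2 < mid j" "mid j < (Y (u j) + Y (u (j + 1))) / 2 + 1 / 2"
  using t_bounds[of j] t_bounds[of "j + 1"] by (auto simp: mid_def field_simps)

text \<open>All states from this point up to the next are 0, so the way to the next point is at most
  3/2 of the first cell. Half of it is 3/4 of that cell. As a cell has length at least 3, a margin
  of 3/4 remains for the perturbation of less than 1/2.\<close>

lemma mid_state0:
  assumes "ss (u j) = 0"
  shows "Y (u j) + 1 / 2 < mid j" "mid j < Y (u j + 1)"
proof -
  let ?k = "u j" and ?k' = "u (j + 1)"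
  have kk: "?k + 1 \<le> ?k'" using u_less[of j "j + 1"] by linarith
  have "Y (?k' - 1 + 1) - Y (?k + 1) \<le> (gap ?k - gap (?k' - 1)) / 2"
    using kk assms by (intro Y_contract) (auto intro: state_antimono[of j ?k])
  then have 1: "Y ?k' \<le> Y (?k + 1) + gap ?k / 2" using gap_pos[of "?k' - 1"] by (simp add: field_simps)
  have "Y (?k + 1) \<le> Y ?k'" using kk by simp
  then show "Y ?k + 1 / 2 < mid j" "mid j < Y (?k + 1)"
    using mid_bounds[of j] 1 Y_step[of ?k] gap_ge[of ?k] by (auto simp: field_simps simp del: Y.le_iff Y.less_iff)
qed

text \<open>The mirror image: all states between the two points are 1, and the last cell before the
  next point dominates.\<close>

lemma mid_state1:
  assumes "ss (u (j + 1) - 1) = 1"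
  shows "Y (u (j + 1) - 1) + 1 / 2 < mid j" "mid j < Y (u (j + 1))"
proof -
  let ?k = "u j" and ?k' = "u (j + 1)"
  have kk: "?k \<le> ?k' - 1" using u_less[of j "j + 1"] by linarith
  have "ss i = 1" if "?k \<le> i" "i \<le> ?k' - 1" for i
    using that assms state_antimono[of j i "?k' - 1"] ss_cases[of i] by auto
  then have "Y (?k' - 1) - Y ?k \<le> (gap (?k' - 1) - gap ?k) / 2"
    using kk by (intro Y_expand) auto
  then have 1: "Y (?k' - 1) \<le> Y ?k + gap (?k' - 1) / 2" using gap_pos[of ?k] by (simp add: field_simps)
  have "Y ?k \<le> Y (?k' - 1)" using kk by simp
  then show "Y (?k' - 1) + 1 / 2 < mid j" "mid j < Y ?k'"
    using mid_bounds[of j] 1 Y_step[of "?k' - 1"] gap_ge[of "?k' - 1"] by (auto simp: field_simps simp del: Y.le_iff Y.less_iff)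
qed

text \<open>Here the cells grow up to \<open>z - 1\<close> and shrink from \<open>z\<close> on, so
  these two cells dominate. On which side of \<open>Y z\<close> the midpoint falls is left open;
  this is harmless as the cell \<open>z\<close> carries no point.\<close>

lemma mid_change:
  assumes z: "u j < z" "z < u (j + 1)" and s: "ss (z - 1) = 1" "ss z = 0"
  shows "Y (z - 1) + 1 / 2 < mid j" "mid j < Y (z + 1)"
proof -
  let ?k = "u j" and ?k' = "u (j + 1)"
  have "ss i = 1" if "?k \<le> i" "i \<le> z - 1" for i
    using that z s state_antimono[of j i "z - 1"] ss_cases[of i] by auto
  then have "Y (z - 1) - Y ?k \<le> (gap (z - 1) - gap ?k) / 2"
    using z by (intro Y_expand) auto
  then have 1: "Y (z - 1) \<le> Y ?k + gap (z - 1) / 2" using gap_pos[of ?k] by (simp add: field_simps)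
  have "Y (?k' - 1 + 1) - Y (z + 1) \<le> (gap z - gap (?k' - 1)) / 2"
    using z s by (intro Y_contract) (auto intro: state_antimono[of j z])
  then have 2: "Y ?k' \<le> Y (z + 1) + gap z / 2" using gap_pos[of "?k' - 1"] by (simp add: field_simps)
  have "Y (z + 1) \<le> Y ?k'" "Y ?k \<le> Y (z - 1)" using z by simp_all
  then show "Y (z - 1) + 1 / 2 < mid j" "mid j < Y (z + 1)"
    using mid_bounds[of j] 1 2 Y_step[of "z - 1"] Y_step[of z] gap_ge[of "z - 1"] gap_ge[of z]
    by (auto simp: field_simps simp del: Y.le_iff Y.less_iff)
qed

definition occupied :: "int \<Rightarrow> bool" where "occupied k \<longleftrightarrow> vv k + vv (k + int n) \<noteq> 0"

lemma occupied_shift: "occupied (k + int n * q) \<longleftrightarrow> occupied k"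
proof -
  have "occupied k \<longleftrightarrow> \<not> (ss (k - 1) = 1 \<and> ss k = 0)" for k
    using step[of k] ss_le[of k] ss_le[of "k - 1"] by (auto simp: occupied_def)
  moreover have "ss (k + int n * q - 1) = ss (k - 1)" using ss_shift_mult[of "k - 1" q] by (simp add: algebra_simps)
  ultimately show ?thesis by (simp add: ss_shift_mult)
qed

lemma not_occupied: "\<not> occupied k \<Longrightarrow> ss (k - 1) = 1 \<and> ss k = 0 \<and> vv k = 0 \<and> vv (k + int n) = 0"
  using step[of k] ss_le[of "k - 1"] by (auto simp: occupied_def)

lemma occupied_point: "occupied (u j)" by (simp add: occupied_def)

text \<open>The points of occupied cells live in \<open>[Y k, Y k + 1 / 2]\<close>, so no separator
  may enter this slot. This combines the three positions of a midpoint: in the first cell, in the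
  last cell, or around the place where the state drops.\<close>

lemma mid_avoids:
  assumes "occupied k"
  shows "\<not> (Y k \<le> mid j \<and> mid j \<le> Y k + 1 / 2)"
proof
  assume *: "Y k \<le> mid j \<and> mid j \<le> Y k + 1 / 2"
  have no: False if "Y a + 1 / 2 < mid j" "mid j < Y (a + 1)" for a
  proof -
    have "Y k < Y (a + 1)" "Y a < Y k" using that * by linarith+
    then show False by simp
  qed
  have no2: False if "Y (z - 1) + 1 / 2 < mid j" "mid j < Y (z + 1)" "\<not> occupied z" for z
  proof -
    have "Y k < Y (z + 1)" "Y (z - 1) < Y k" using that * by linarith+
    then have "k = z" by simp
    then show False using assms that by simp
  qed
  show False
  proof (cases "ss (u j) = 0 \<or> ss (u (j + 1) - 1) = 1")
    case True
    then show False using no[of "u j"] no[of "u (j + 1) - 1"] mid_state0[of j] mid_state1[of j] by auto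
  next
    case False
    \<comment> \<open>The remaining case: the states drop from 1 to 0 between the two points. The
      signature letter at the drop is 0, so that cell is not occupied and its slot need not be
      avoided.\<close>
    then have f: "ss (u j) = 1" "ss (u (j + 1) - 1) = 0" using ss_cases by metis+
    then have "u j \<noteq> u (j + 1) - 1" by auto
    then have "u j < u (j + 1) - 1" using u_less[of j "j + 1"] by linarith
    from int_last_true[of "\<lambda>i. ss i = 1", OF f(1) _ this] f(2)
    obtain a where a: "u j \<le> a" "a < u (j + 1) - 1" "ss a = 1" "ss (a + 1) \<noteq> 1" by auto
    then have s: "ss (a + 1) = 0" using ss_cases by metis
    then have "\<not> occupied (a + 1)" using step[of "a + 1"] a by (simp add: occupied_def)
    moreover have "Y (a + 1 - 1) + 1 / 2 < mid j" "mid j < Y (a + 1 + 1)"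
      using a s by (intro mid_change; simp)+
    ultimately show False using no2 by blast
  qed
qed

lemma mid_shift: "mid (j + int n * q) = mid j + period * of_int (2 * q)"
proof -
  have "t (j + int n * q) = t j + period * of_int (2 * q)" for j
  proof -
    have "u (j + int n * q) = u j + int n * (2 * q)" using u_shift[of j q] by (simp add: algebra_simps)
    moreover have "w (u j + int n * (2 * q)) = w (u j)"
      by (simp add: w_def mult.assoc[symmetric] mult.commute[of "int n" 2])
    ultimately show ?thesis using Y.shift_mult[of "u j" "2 * q"] by (simp add: t_def)
  qed
  from this[of j] this[of "j + 1"] show ?thesis by (simp add: mid_def algebra_simps)
qed

lemma w_pair_inj:
  assumes "w (u i) + w (u (i + 1)) = w (u j) + w (u (j + 1))"
  shows "i mod int n = j mod int n"
proof -
  define r where "r k = nat (u k mod (2 * int n))" for k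
  have rr: "r a = r b \<Longrightarrow> a mod int n = b mod int n" for a b
  proof -
    assume "r a = r b"
    moreover have "0 \<le> u a mod (2 * int n)" "0 \<le> u b mod (2 * int n)" using n3 by auto
    ultimately have "u a mod (2 * int n) = u b mod (2 * int n)" by (simp only: r_def eq_nat_nat_iff)
    then obtain q where "u a = u b + 2 * int n * q" by (metis mod_eqE)
    then have "u a = u (b + int n * q)" by (simp add: u_shift)
    then show "a mod int n = b mod int n" by simp
  qed
  have ne: "r a \<noteq> r (a + 1)" for a
  proof
    assume "r a = r (a + 1)"
    from rr[OF this] have "int n dvd (a + 1) - a" by (metis mod_eq_dvd_iff)
    then show False using n3 by simp
  qed
  have "real (2 ^ r i + 2 ^ r (i + 1)) = real (2 ^ r j + 2 ^ r (j + 1))"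
    using assms by (simp add: w_def r_def)
  then have "(2::nat) ^ r i + 2 ^ r (i + 1) = 2 ^ r j + 2 ^ r (j + 1)" by (simp only: of_nat_eq_iff)
  then have "set_encode {r i, r (i + 1)} = set_encode {r j, r (j + 1)}"
    using ne by (simp add: set_encode_def)
  then have "{r i, r (i + 1)} = {r j, r (j + 1)}" by (simp add: set_encode_eq)
  then consider "r i = r j" | "r i = r (j + 1)" "r (i + 1) = r j" by (auto simp: doubleton_eq_iff)
  then show ?thesis
  proof cases
    \<comment> \<open>The two exponents agree crosswise. Then \<open>n\<close> would divide 2, which
      is where \<open>n \<ge> 3\<close> matters.\<close>
    case 2
    then have "int n dvd i - (j + 1)" "int n dvd (i + 1) - j" using rr mod_eq_dvd_iff by metis+
    then have "int n dvd (i + 1 - j) - (i - (j + 1))" by (rule dvd_diff[rotated])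
    then have "int n dvd 2" by simp
    then have "int n \<le> 2" by (rule zdvd_imp_le) simp
    then show ?thesis using n3 by simp
  qed (rule rr)
qed

end

text \<open>The perturbation is now assumed to be generic. That such a value of
  \<open>\<eta>\<close> exists is shown in \<open>realizable\<close>, with the help of
  \<open>w_pair_inj\<close>.\<close>

locale word_configuration = word_points +
  assumes mid_inj: "mid i = mid j + period * of_int l \<Longrightarrow> i mod int n = j mod int n"
begin

lemma separators_enumeration:
  obtains \<alpha> where "quasi_periodic \<alpha> (int n) period" "range \<alpha> = {mid j + period * of_int l | j l. True}"
    "\<alpha> 0 \<le> x" "x < \<alpha> 1"
proof -
  have "\<exists>\<alpha>. quasi_periodic \<alpha> (int n) period \<and> range \<alpha> = {mid j + period * of_int l | j l. True} \<and> \<alpha> 0 \<le> x \<and> x < \<alpha> 1"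
  proof (rule enumerate_classes[where m = mid])
    show "mid (j + int n) = mid j + 2 * period" for j using mid_shift[of j 1] by simp
  qed (use n3 Y.p_pos in simp, rule Y.p_pos, erule mid_inj)
  then show ?thesis using that by blast
qed

lemma mid_class_avoids:
  assumes "occupied k"
  shows "\<not> (Y k \<le> mid j + period * of_int l \<and> mid j + period * of_int l \<le> Y k + 1 / 2)"
proof -
  have "occupied (k + int n * (- l))" unfolding occupied_shift by (rule assms)
  from mid_avoids[OF this, of j] show ?thesis unfolding Y.shift_mult by (simp add: algebra_simps)
qed

text \<open>In state 0 a point of cell \<open>k\<close> has its midpoint with the next point in that
  cell. In state 1 a point of cell \<open>k + 1\<close> has its midpoint with the previous point in
  cell \<open>k\<close>. The points may lie on either of the two opposite sides, which is the role
  of \<open>i\<close>.\<close>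

lemma mid_after_occupied:
  assumes "occupied k" "occupied (k + 1)"
  shows "\<exists>j l. Y k < mid j + period * of_int l \<and> mid j + period * of_int l < Y (k + 1)"
proof (cases "ss k = 0")
  case True
  have *: "\<exists>j l. Y k < mid j + period * of_int l \<and> mid j + period * of_int l < Y (k + 1)"
    if i: "vv (k + int n * i) = 1" for i
  proof -
    obtain j where j: "u j = k + int n * i" using u_surj[OF i] by blast
    have "ss (u j) = 0" using True ss_shift_mult j by simp
    from mid_state0[OF this] have "Y (k + int n * i) < mid j" "mid j < Y (k + 1 + int n * i)"
      unfolding j by (simp_all add: algebra_simps)
    then show ?thesis
      using Y.shift_mult[of k i] Y.shift_mult[of "k + 1" i] by (intro exI[of _ j] exI[of _ "- i"]) auto
  qed
  show ?thesis using *[of 0] *[of 1] assms(1) vv_le[of k] vv_le[of "k + int n"] by (auto simp: occupied_def le_Suc_eq)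
next
  case False
  have *: "\<exists>j l. Y k < mid j + period * of_int l \<and> mid j + period * of_int l < Y (k + 1)"
    if i: "vv (k + 1 + int n * i) = 1" for i
  proof -
    obtain j' where "u j' = k + 1 + int n * i" using u_surj[OF i] by blast
    then obtain j where j: "u (j + 1) = k + 1 + int n * i" by (metis diff_add_cancel)
    have j1: "u (j + 1) - 1 = k + int n * i" using j by simp
    have "ss (u (j + 1) - 1) = 1" using False ss_cases[of k] ss_shift_mult unfolding j1 by simp
    from mid_state1[OF this] have "Y (k + int n * i) < mid j" "mid j < Y (k + 1 + int n * i)"
      unfolding j1 unfolding j by simp_all
    then show ?thesis
      using Y.shift_mult[of k i] Y.shift_mult[of "k + 1" i] by (intro exI[of _ j] exI[of _ "- i"]) auto
  qed
  show ?thesis using *[of 0] *[of 1] assms(2) vv_le[of "k + 1"] vv_le[of "k + 1 + int n"] by (auto simp: occupied_def le_Suc_eq)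
qed

text \<open>Each of the opposite cells \<open>z\<close> and \<open>z + int n\<close> lies between
  two consecutive points, whose midpoint is near it. If the two separators coincided, one pair of
  consecutive points would enclose \<open>n\<close> successive cells, against
  \<open>point_in_period\<close>.\<close>

lemma mids_around_empty:
  assumes z: "\<not> occupied z"
  shows "\<exists>i j l. mid i \<noteq> mid j + period * of_int l \<and> Y (z - 1) < mid i \<and> mid i < Y (z + 1) \<and>
    Y (z - 1) < mid j + period * of_int l \<and> mid j + period * of_int l < Y (z + 1)"
proof -
  note z' = not_occupied[OF z]
  obtain i where i: "u i < z" "z < u (i + 1)" using around z' by blast
  obtain j where j: "u j < z + int n" "z + int n < u (j + 1)" using around z' by blast
  have s: "ss (z + int n - 1) = 1" "ss (z + int n) = 0" using z' ss_shift[of "z - 1"] ss_shift[of z] by (simp_all add: algebra_simps)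
  have 1: "Y (z - 1) < mid i" "mid i < Y (z + 1)" using mid_change[OF i] z' by auto
  have "Y (z - 1 + int n) < mid j" "mid j < Y (z + 1 + int n)"
    using mid_change[OF j s] by (simp_all add: algebra_simps)
  then have 2: "Y (z - 1) < mid j + period * of_int (-1)" "mid j + period * of_int (-1) < Y (z + 1)"
    using Y_shift[of "z - 1"] Y_shift[of "z + 1"] by auto
  have "mid i \<noteq> mid j + period * of_int (-1)"
  proof
    assume "mid i = mid j + period * of_int (-1)"
    from mid_inj[OF this] obtain q where q: "j = i + int n * q" by (metis mod_eqE)
    have uj: "u j = u i + 2 * int n * q" "u (j + 1) = u (i + 1) + 2 * int n * q"
      using u_shift[of i q] u_shift[of "i + 1" q] q by (simp_all add: algebra_simps)
    show False
    proof (cases "q \<le> 0")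
      case True
      then have "2 * int n * q \<le> 0" using n3 by (simp add: mult_nonneg_nonpos)
      then have "z + int n < u (i + 1)" using uj j by linarith
      moreover obtain k where "z < k" "k \<le> z + int n" "vv k = 1" using point_in_period by blast
      ultimately show False using no_point[of i k] i by simp
    next
      case False
      then have "2 * int n * q \<ge> 2 * int n * 1" by (intro mult_left_mono) auto
      then have "u i < z - int n" using uj j by linarith
      moreover obtain k where "z - int n < k" "k \<le> z - int n + int n" "vv k = 1" using point_in_period by blast
      ultimately show False using no_point[of i k] i by simp
    qed
  qed
  then show ?thesis using 1 2 by blast
qed

text \<open>The separators are located by counting. Every step to an adjacent occupied cell passes
  at least one separator, and every step over an empty cell at least two. There are only
  \<open>n\<close> per period, so all these bounds are equalities, and the regions match the
  numbering of the cells.\<close>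

lemma realizes: "\<exists>P. generic_points n P \<and> occupancy_word n P (\<lambda>i. vv (int i))"
proof -
  define k0 where "k0 = u 0"
  have k0: "occupied k0" by (simp add: k0_def occupied_point)
  obtain \<alpha> where \<alpha>: "quasi_periodic \<alpha> (int n) period" "range \<alpha> = {mid j + period * of_int l | j l. True}"
    "\<alpha> 0 \<le> Y k0" "Y k0 < \<alpha> 1" using separators_enumeration by blast
  interpret A: quasi_periodic \<alpha> "int n" period by (rule \<alpha>(1))
  have in_range: "\<exists>i. \<alpha> i = mid j + period * of_int l" for j l
  proof -
    have "mid j + period * of_int l \<in> range \<alpha>" unfolding \<alpha>(2) by blast
    then show ?thesis by (metis imageE)
  qed
  \<comment> \<open>The excess of separators over cells passed up to \<open>Y k\<close>. Being
    periodic and monotone along occupied cells, it is constant there.\<close>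
  define f where "f k = A.idx (Y k) - k" for k
  have f_shift: "f (k + int n * q) = f k" for k q
  proof -
    have "A.idx (Y k + period * of_int q) = A.idx (Y k) + int n * q"
      by (rule A.idx_eq)
        (use A.idx[of "Y k"] A.shift_mult[of "A.idx (Y k)" q] A.shift_mult[of "A.idx (Y k) + 1" q] in \<open>auto simp: algebra_simps\<close>)
    then show ?thesis by (simp add: f_def Y.shift_mult)
  qed
  have idx_gt: "A.idx x < i" if "x < \<alpha> i" for x i
  proof -
    have "\<not> i \<le> A.idx x" using that by (simp only: A.idx_le_iff not_le)
    then show ?thesis by simp
  qed
  \<comment> \<open>The induction is strong because an empty cell is passed in a double
    step.\<close>
  have mono: "occupied k \<Longrightarrow> occupied (k + int r) \<Longrightarrow> f k \<le> f (k + int r)" for k r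
  proof (induction r arbitrary: k rule: less_induct)
    case (less r)
    show ?case
    proof (cases "r = 0")
      case False
      show ?thesis
      proof (cases "occupied (k + 1)")
        case True
        obtain j l where "Y k < mid j + period * of_int l" "mid j + period * of_int l < Y (k + 1)"
          using mid_after_occupied[OF less.prems(1) True] by blast
        then obtain i where i: "Y k < \<alpha> i" "\<alpha> i < Y (k + 1)" using in_range by metis
        have "A.idx (Y k) < i" using i by (rule_tac idx_gt)
        moreover have "i \<le> A.idx (Y (k + 1))" using i by (simp add: A.idx_le_iff)
        ultimately have "f k \<le> f (k + 1)" by (simp add: f_def)
        also have "\<dots> \<le> f (k + 1 + int (r - 1))"
          using False True less.prems by (intro less.IH) (auto simp: of_nat_diff)
        finally show ?thesis using False by (simp add: of_nat_diff)
      next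
        case F2: False
        obtain a b l where "mid a \<noteq> mid b + period * of_int l" "Y (k + 1 - 1) < mid a" "mid a < Y (k + 1 + 1)"
          "Y (k + 1 - 1) < mid b + period * of_int l" "mid b + period * of_int l < Y (k + 1 + 1)"
          using mids_around_empty[OF F2] by blast
        moreover obtain i where "\<alpha> i = mid a" using in_range[of a 0] by auto
        moreover obtain i' where "\<alpha> i' = mid b + period * of_int l" using in_range by blast
        ultimately have i: "\<alpha> i \<noteq> \<alpha> i'" "Y k < \<alpha> i" "\<alpha> i < Y (k + 2)" "Y k < \<alpha> i'" "\<alpha> i' < Y (k + 2)"
          by (simp_all add: algebra_simps)
        have "A.idx (Y k) < i" "A.idx (Y k) < i'" using i by (auto intro: idx_gt)
        moreover have "i \<le> A.idx (Y (k + 2))" "i' \<le> A.idx (Y (k + 2))" using i by (simp_all add: A.idx_le_iff)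
        moreover have "i \<noteq> i'" using i(1) by auto
        ultimately have "f k \<le> f (k + 2)" by (simp add: f_def)
        also have "\<dots> \<le> f (k + 2 + int (r - 2))"
        proof -
          \<comment> \<open>For \<open>r = 1\<close> the empty cell would be the occupied end
            itself. After an empty cell the state is 0, so the following cell is not empty.\<close>
          have "r \<noteq> 1" using F2 less.prems by auto
          then have r: "r \<ge> 2" using False by simp
          have "ss (k + 1) = 0" using not_occupied[OF F2] by simp
          moreover have "k + 2 - 1 = k + 1" by simp
          ultimately have "occupied (k + 2)" using not_occupied[of "k + 2"] by (metis zero_neq_one)
          then show ?thesis using r less.prems by (intro less.IH) (auto simp: of_nat_diff)
        qed
        also have "k + 2 + int (r - 2) = k + int r"
          using F2 less.prems False by (cases "r = 1") (auto simp: of_nat_diff)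
        finally show ?thesis .
      qed
    qed simp
  qed
  have mono': "f k \<le> f k'" if "occupied k" "occupied k'" for k k'
  proof -
    obtain q where "k \<le> k' + int n * q" using shift_beyond by blast
    then have "f k \<le> f (k + int (nat (k' + int n * q - k)))"
      using that occupied_shift by (intro mono) auto
    also have "\<dots> = f (k' + int n * q)" using \<open>k \<le> k' + int n * q\<close> by simp
    finally show ?thesis by (simp add: f_shift)
  qed
  have "f k0 = - k0" using A.idx_eq[of 0 "Y k0"] \<alpha> by (simp add: f_def)
  then have fk: "A.idx (Y k) = k - k0" if "occupied k" for k
    using mono'[OF that k0] mono'[OF k0 that] by (simp add: f_def)
  \<comment> \<open>The separators are renumbered so that an occupied cell \<open>k\<close> has its
    slot between \<open>\<beta> (k - 1)\<close> and \<open>\<beta> k\<close>, as in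
    \<open>sec\<close>.\<close>
  define \<beta> where "\<beta> k = \<alpha> (k - k0 + 1)" for k
  have cell: "\<beta> (k - 1) < Y k" "Y k + 1 / 2 < \<beta> k" if k: "occupied k" for k
  proof -
    have b: "\<beta> (k - 1) \<le> Y k" "Y k < \<beta> k" using A.idx[of "Y k"] fk[OF k] by (simp_all add: \<beta>_def)
    have av: "\<not> (Y k \<le> \<beta> i \<and> \<beta> i \<le> Y k + 1 / 2)" for i
    proof -
      have "\<beta> i \<in> range \<alpha>" by (simp add: \<beta>_def)
      then obtain j l where "\<beta> i = mid j + period * of_int l" unfolding \<alpha>(2) by blast
      then show ?thesis using mid_class_avoids[OF k] by metis
    qed
    show "\<beta> (k - 1) < Y k" "Y k + 1 / 2 < \<beta> k" using b av[of "k - 1"] av[of k] by linarith+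
  qed
  interpret B: quasi_periodic \<beta> "int n" period
    unfolding \<beta>_def using A.quasi_periodic_translate[of "1 - k0" 0] by (simp add: algebra_simps)
  have tcell: "\<beta> (u j - 1) < t j" "t j < \<beta> (u j)" for j
    using cell[OF occupied_point[of j]] t_bounds[of j] by linarith+
  \<comment> \<open>Opposite regions were superposed, so one \<open>period\<close> is half a turn
    and is scaled to \<open>pi\<close>. The origin \<open>x0\<close> is put inside the first
    region.\<close>
  define c where "c = pi / period"
  have c: "c > 0" "c * period = pi" using Y.p_pos by (auto simp: c_def)
  define x0 where "x0 = (\<beta> 0 + \<beta> 1) / 2"
  define T where "T j = c * (t j - x0)" for j
  define \<gamma> where "\<gamma> k = c * (\<beta> k - x0)" for k
  have t_mono: "t j < t (j + 1)" for j
  proof -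
    have "u j \<le> u (j + 1) - 1" using u_less[of j "j + 1"] by linarith
    then have "\<beta> (u j) \<le> \<beta> (u (j + 1) - 1)" by simp
    then show ?thesis using tcell[of j] tcell[of "j + 1"] by linarith
  qed
  have qT: "quasi_periodic T (int n) (2 * pi)"
  proof
    show "strict_mono T" using t_mono c by (intro strict_mono_int_step) (simp add: T_def)
    show "T (j + int n) = T j + 2 * pi" for j
    proof -
      have "u (j + int n) = u j + int n * 2" using u_shift[of j 1] by simp
      then have "t (j + int n) = t j + period * 2"
        using Y.shift_mult[of "u j" 2] by (simp add: t_def w_def mult.commute)
      then show ?thesis using c by (simp add: T_def algebra_simps)
    qed
  qed (use n3 in simp)
  have q\<gamma>: "quasi_periodic \<gamma> (int n) pi"
  proof
    show "strict_mono \<gamma>" using c by (intro strict_mono_int_step) (simp add: \<gamma>_def)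
    show "\<gamma> (j + int n) = \<gamma> j + pi" for j using c by (simp add: \<gamma>_def B.shift algebra_simps)
  qed (use n3 in simp)
  have Tmid: "(T j + T (j + 1)) / 2 = c * (mid j - x0)" for j
    by (simp add: T_def mid_def field_simps)
  have range\<beta>: "range \<beta> = {mid j + period * of_int l | j l. True}"
  proof -
    have "range \<beta> = range \<alpha>"
    proof (intro equalityI subsetI)
      fix y assume "y \<in> range \<alpha>"
      then obtain i where "y = \<alpha> i" by blast
      then have "y = \<beta> (i + k0 - 1)" by (simp add: \<beta>_def)
      then show "y \<in> range \<beta>" by blast
    qed (auto simp: \<beta>_def)
    then show ?thesis using \<alpha>(2) by simp
  qed
  have between: "j' = u j" if "\<beta> (j' - 1) < t j" "t j < \<beta> j'" for j j'
  proof -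
    have "\<beta> (j' - 1) < \<beta> (u j)" "\<beta> (u j - 1) < \<beta> j'" using that tcell[of j] by linarith+
    then have "j' - 1 < u j" "u j - 1 < j'" by (simp_all only: B.less_iff)
    then show ?thesis by simp
  qed
  have "configuration_axioms T \<gamma> n"
  proof (rule configuration_axioms.intro)
    show "3 \<le> n" by (rule n3)
    show "(T j + T (j + 1)) / 2 \<in> range \<gamma>" for j
    proof -
      have "mid j + period * of_int 0 \<in> range \<beta>" unfolding range\<beta> by blast
      then obtain i where "mid j = \<beta> i" by auto
      then show ?thesis unfolding Tmid by (auto simp: \<gamma>_def)
    qed
    show "T j \<notin> range \<gamma>" for j
    proof
      assume "T j \<in> range \<gamma>"
      then obtain k where "t j = \<beta> k" using c by (auto simp: T_def \<gamma>_def)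
      then have "\<beta> (u j - 1) < \<beta> k" "\<beta> k < \<beta> (u j)" using tcell[of j] by simp_all
      then show False by simp
    qed
    show "\<exists>j. \<exists>l::int. \<gamma> k = (T j + T (j + 1)) / 2 + pi * of_int l" for k
    proof -
      have "\<beta> k \<in> range \<beta>" by simp
      then obtain j l where "\<beta> k = mid j + period * of_int l" unfolding range\<beta> by blast
      then have "\<gamma> k = c * (mid j - x0) + c * period * of_int l" by (simp add: \<gamma>_def algebra_simps)
      then show ?thesis unfolding Tmid c(2) by blast
    qed
    show "i mod int n = j mod int n" if "(T i + T (i + 1)) / 2 = (T j + T (j + 1)) / 2 + pi * of_int l" for i j l
    proof -
      have "c * (mid i - x0) = c * (mid j - x0) + c * period * of_int l" using that unfolding Tmid c(2) .
      then have "c * mid i = c * (mid j + period * of_int l)" by (simp add: algebra_simps)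
      then have "mid i = mid j + period * of_int l" using c(1) by simp
      then show ?thesis by (rule mid_inj)
    qed
    have "\<beta> 0 < \<beta> 1" by simp
    then have "\<beta> 0 - x0 < 0" "0 < \<beta> 1 - x0" by (auto simp: x0_def field_simps simp del: B.less_iff)
    then show "\<gamma> 0 < 0" "0 < \<gamma> 1" using c by (simp_all add: \<gamma>_def mult_pos_neg)
  qed
  then interpret C: configuration T \<gamma> n "\<lambda>j. (T j + T (j + 1)) / 2"
    by (intro configuration.intro qT q\<gamma>)
  have count: "vv (int i) = card {j. \<gamma> (int i - 1) < T j \<and> T j < \<gamma> (int i)}" for i
  proof -
    have "{j. \<gamma> (int i - 1) < T j \<and> T j < \<gamma> (int i)} = {j. u j = int i}"
    proof (intro equalityI subsetI CollectI)
      fix j assume "j \<in> {j. \<gamma> (int i - 1) < T j \<and> T j < \<gamma> (int i)}"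
      then show "u j = int i" using between[of "int i" j] c(1) by (auto simp: \<gamma>_def T_def)
    next
      fix j assume "j \<in> {j. u j = int i}"
      then have "u j = int i" by simp
      then show "\<gamma> (int i - 1) < T j \<and> T j < \<gamma> (int i)"
        using tcell[of j] c(1) by (simp add: \<gamma>_def T_def)
    qed
    also have "card \<dots> = vv (int i)"
    proof (cases "vv (int i) = 0")
      case True
      then have "{j. u j = int i} = {}" using vv_u by (metis (mono_tags) empty_Collect_eq zero_neq_one)
      then show ?thesis using True by simp
    next
      case False
      then have v1: "vv (int i) = 1" using vv_le[of "int i"] by simp
      then obtain j where "u j = int i" using u_surj by blast
      then have "{j. u j = int i} = {j}" by (metis (mono_tags, lifting) Collect_cong singleton_conv u_eq)
      then show ?thesis using v1 by simp
    qed
    finally show ?thesis by simp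
  qed
  have "generic_points n (\<lambda>i. cis (T (int i)))" by (rule C.generic)
  moreover have "occupancy_word n (\<lambda>i. cis (T (int i))) (\<lambda>i. vv (int i))"
    unfolding C.occupancy_iff using count by blast
  ultimately show ?thesis by blast
qed

end

section \<open>Choice of the perturbation\<close>

context word_states
begin

lemma realizable: "\<exists>P. generic_points n P \<and> occupancy_word n P (\<lambda>i. vv (int i))"
proof -
  obtain u where u: "quasi_periodic (\<lambda>j. of_int (u j)) (int n) (2 * real n)" "range u = {k. vv k = 1}"
    using points_enumeration by blast
  define w :: "int \<Rightarrow> real" where "w k = 2 ^ nat (k mod (2 * int n))" for k
  \<comment> \<open>The value of \<open>\<eta>\<close> at which the midpoints \<open>i\<close> and
    \<open>j\<close> would be congruent with quotient \<open>l\<close>. These are countably many. A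
    vanishing denominator occurs only for indices in the same class, by \<open>w_pair_inj\<close>.
    The bound on \<open>\<eta>\<close> keeps every perturbation below 1/2.\<close>
  define g where "g = (\<lambda>(i, j, l::int). - (Y (u i) + Y (u (i + 1)) - Y (u j) - Y (u (j + 1)) - 2 * period * of_int l)
     / (w (u i) + w (u (i + 1)) - w (u j) - w (u (j + 1))))"
  have "countable (range g)" by simp
  moreover have "uncountable {0<..<1 / 2 ^ (2 * n + 1) :: real}" by (simp add: uncountable_open_interval)
  ultimately have "\<not> {0<..<1 / 2 ^ (2 * n + 1)} \<subseteq> range g" using countable_subset by blast
  then obtain \<eta> where "\<eta> \<in> {0<..<1 / 2 ^ (2 * n + 1)}" and notin: "\<eta> \<notin> range g" by blast
  then have \<eta>: "0 < \<eta>" "\<eta> < 1 / 2 ^ (2 * n + 1)" by simp_all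
  have small: "\<eta> * 2 ^ (2 * n) < 1 / 2" using \<eta>(2) by (simp add: field_simps)
  interpret P: word_points n vv ss u \<eta> w "\<lambda>j. Y (u j) + \<eta> * w (u j)"
    "\<lambda>j. (Y (u j) + \<eta> * w (u j) + (Y (u (j + 1)) + \<eta> * w (u (j + 1)))) / 2"
    unfolding w_def by unfold_locales (use u \<eta> small n3 in \<open>auto intro: quasi_periodic.mono quasi_periodic.shift\<close>)
  have "word_configuration n vv ss u \<eta>"
  proof (unfold_locales, fold w_def)
    fix i j l
    assume e: "(Y (u i) + \<eta> * w (u i) + (Y (u (i + 1)) + \<eta> * w (u (i + 1)))) / 2 =
       (Y (u j) + \<eta> * w (u j) + (Y (u (j + 1)) + \<eta> * w (u (j + 1)))) / 2 + period * real_of_int l"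
    let ?A = "Y (u i) + Y (u (i + 1)) - Y (u j) - Y (u (j + 1)) - 2 * period * of_int l"
    let ?D = "w (u i) + w (u (i + 1)) - w (u j) - w (u (j + 1))"
    have "?A + \<eta> * ?D = 0" using e by (simp add: field_simps)
    moreover have "D = 0 \<or> \<eta> = - A / D" if "A + \<eta> * D = 0" for A D
      using that by (metis add.commute eq_neg_iff_add_eq_0 nonzero_eq_divide_eq)
    ultimately have "?D = 0 \<or> \<eta> = - ?A / ?D" by blast
    moreover have "\<eta> \<noteq> - ?A / ?D" using notin unfolding g_def by (metis (mono_tags, lifting) case_prod_conv rangeI)
    ultimately have "w (u i) + w (u (i + 1)) = w (u j) + w (u (j + 1))" by simp
    then show "i mod int n = j mod int n" by (rule P.w_pair_inj)
  qed
  then show ?thesis by (rule word_configuration.realizes)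
qed

end

lemma states_realizable:
  fixes v s :: "nat \<Rightarrow> nat"
  assumes n: "n \<ge> 3" and v: "v \<in> {1..2*n} \<rightarrow>\<^sub>E {0, 1}" and s: "\<And>k. s k \<le> 1" "s n = s 0"
    and step: "\<And>k. k \<in> {1..n} \<Longrightarrow> v k + v (k + n) + s (k - 1) = 1 + s k"
    and ex: "\<exists>k\<le>n. s k = 1" "\<exists>k\<le>n. s k = 0"
  shows "v \<in> realizable_words n"
proof -
  define vv where "vv k = v (nat ((k - 1) mod (2 * int n) + 1))" for k
  define ss where "ss k = s (nat (k mod int n))" for k
  have vvi: "vv (int i) = v i" if "i \<in> {1..2*n}" for i
  proof -
    have "(int i - 1) mod (2 * int n) = int i - 1" using that by (intro mod_pos_pos_trivial) auto
    then show ?thesis by (simp add: vv_def)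
  qed
  have vv_shift: "vv (k + 2 * int n) = vv k" for k
  proof -
    have "k + 2 * int n - 1 = k - 1 + 2 * int n" by simp
    then show ?thesis unfolding vv_def by (simp only: mod_add_self2)
  qed
  have vv_shift': "vv (k + 2 * int n * q) = vv k" for k q
  proof -
    have "k + 2 * int n * q - 1 = k - 1 + 2 * int n * q" by simp
    then show ?thesis unfolding vv_def by (simp only: mod_mult_self2)
  qed
  have ss_shift: "ss (k + int n * q) = ss k" for k q by (simp add: ss_def)
  have ssi: "ss (int i) = s i" if "i \<le> n" for i
    using that s(2) by (cases "i = n") (auto simp: ss_def)
  have "word_states n vv ss"
  proof
    show "vv k \<le> 1" for k
    proof -
      have "0 \<le> (k - 1) mod (2 * int n)" "(k - 1) mod (2 * int n) < 2 * int n" using n by auto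
      then have "nat ((k - 1) mod (2 * int n) + 1) \<in> {1..2*n}" by auto
      then have "vv k \<in> {0, 1}" unfolding vv_def by (rule PiE_mem[OF v])
      then show ?thesis by auto
    qed
    show "vv k + vv (k + int n) + ss (k - 1) = 1 + ss k" for k
    proof -
      obtain r q where r: "r \<in> {1..n}" and k: "k = int r + int n * q" using int_reduce[of n k] n by auto
      have "ss (k - 1) = ss (int (r - 1))" using ss_shift[of "int (r - 1)" q] r k by (simp add: of_nat_diff algebra_simps)
      also have "\<dots> = s (r - 1)" by (rule ssi) (use r in auto)
      finally have 1: "ss (k - 1) = s (r - 1)" .
      have 2: "ss k = s r" using ss_shift[of "int r" q] ssi[of r] r k by simp
      \<comment> \<open>A shift by \<open>n\<close> exchanges the opposite positions
        \<open>r\<close> and \<open>r + n\<close>, which leaves their sum unchanged; hence the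
        distinction by the parity of \<open>q\<close>.\<close>
      have "vv k + vv (k + int n) = v r + v (r + n)"
      proof (cases "even q")
        case True
        then obtain p where p: "q = 2 * p" by (rule evenE)
        have e: "k = int r + 2 * int n * p" "k + int n = int (r + n) + 2 * int n * p"
          using k p by (simp_all add: algebra_simps)
        show ?thesis unfolding e(2) unfolding e(1) vv_shift' using vvi[of r] vvi[of "r + n"] r by auto
      next
        case False
        then obtain p where p: "q = 2 * p + 1" by (rule oddE)
        have e: "k = int (r + n) + 2 * int n * p" "k + int n = int r + 2 * int n * (p + 1)"
          using k p by (simp_all add: algebra_simps)
        show ?thesis unfolding e(2) unfolding e(1) vv_shift' using vvi[of r] vvi[of "r + n"] r by auto
      qed
      then show ?thesis using step[OF r] 1 2 by simp
    qed
    show "\<exists>k. ss k = 1" "\<exists>k. ss k = 0" using ex ssi by metis+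
    show "ss k \<le> 1" for k unfolding ss_def by (rule s)
    show "ss (k + int n) = ss k" for k using ss_shift[of k 1] by simp
  qed (rule n, rule vv_shift)
  then obtain P where P: "generic_points n P" "occupancy_word n P (\<lambda>i. vv (int i))"
    using word_states.realizable by blast
  have "occupancy_word n P v"
    using P(2) unfolding occupancy_word_def by (simp add: vvi)
  then show ?thesis using P(1) v by (auto simp: realizable_words_def)
qed

section \<open>Coding realizable words\<close>

definition twos :: "(nat \<Rightarrow> nat) \<Rightarrow> nat \<Rightarrow> nat" where
  "twos c k = card {i\<in>{1..k}. c i = 2}"

definition code_state :: "nat \<Rightarrow> (nat \<Rightarrow> nat) \<Rightarrow> nat \<Rightarrow> nat" where
  "code_state a c k = (a + twos c k) mod 2"

text \<open>The letter 2 of a code stands for a signature letter 0 or 2, where the alternation started by \<open>a\<close>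
  determines which one; 0 and 1 tell where the point is when the signature letter is 1.\<close>

definition code_word :: "nat \<Rightarrow> nat \<Rightarrow> (nat \<Rightarrow> nat) \<Rightarrow> nat \<Rightarrow> nat" where
  "code_word n a c = (\<lambda>i\<in>{1..2*n}.
     if i \<le> n then (if c i = 2 then 1 - code_state a c (i - 1) else 1 - c i)
     else (if c (i - n) = 2 then 1 - code_state a c (i - n - 1) else c (i - n)))"

definition codes :: "nat \<Rightarrow> (nat \<Rightarrow> nat) set" where
  "codes n = {1..n} \<rightarrow>\<^sub>E {0, 1, 2}"

text \<open>Every letter 2 toggles the state, so evenness means that the states close up
  cyclically.\<close>

definition even_codes :: "nat \<Rightarrow> (nat \<Rightarrow> nat) set" where
  "even_codes n = {c \<in> codes n. even (twos c n)}"

text \<open>Without a letter 2 the code word does not depend on the first state and its signature is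
  constant. Such words are only counted, in \<open>card_flat_words\<close>.\<close>

definition proper_codes :: "nat \<Rightarrow> (nat \<Rightarrow> nat) set" where
  "proper_codes n = {c \<in> even_codes n. \<exists>k\<in>{1..n}. c k = 2}"

lemma finite_codes [simp]: "finite (codes n)" "finite (even_codes n)" "finite (proper_codes n)"
proof -
  show "finite (codes n)" unfolding codes_def by (intro finite_PiE) auto
  then show "finite (even_codes n)" by (simp add: even_codes_def)
  then show "finite (proper_codes n)" by (simp add: proper_codes_def)
qed

lemma card_codes: "card (codes n) = 3 ^ n"
  by (simp add: codes_def card_PiE numeral_3_eq_3)

lemma twos_0 [simp]: "twos c 0 = 0" by (simp add: twos_def)

lemma twos_Suc: "twos c (Suc k) = twos c k + (if c (Suc k) = 2 then 1 else 0)"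
proof -
  have "{i\<in>{1..Suc k}. c i = 2} = (if c (Suc k) = 2 then insert (Suc k) {i\<in>{1..k}. c i = 2} else {i\<in>{1..k}. c i = 2})"
    by (auto simp: le_Suc_eq)
  then show ?thesis by (simp add: twos_def)
qed

lemma code_mem: "c \<in> codes n \<Longrightarrow> k \<in> {1..n} \<Longrightarrow> c k = 0 \<or> c k = 1 \<or> c k = 2"
  unfolding codes_def by (drule (1) PiE_mem) auto

lemma code_state_le: "code_state a c k \<le> 1" by (simp add: code_state_def)

lemma code_state_step: "k \<ge> 1 \<Longrightarrow> code_state a c k = (if c k = 2 then 1 - code_state a c (k - 1) else code_state a c (k - 1))"
  using twos_Suc[of c "k - 1"] by (auto simp: code_state_def) presburger+

lemma code_word_low:
  assumes "k \<in> {1..n}"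
  shows "code_word n a c k = (if c k = 2 then 1 - code_state a c (k - 1) else 1 - c k)"
proof -
  have "k \<in> {1..2*n}" "k \<le> n" using assms by auto
  then show ?thesis by (simp only: code_word_def restrict_apply if_True)
qed

lemma code_word_high:
  assumes "k \<in> {1..n}"
  shows "code_word n a c (k + n) = (if c k = 2 then 1 - code_state a c (k - 1) else c k)"
proof -
  have "k + n \<in> {1..2*n}" "\<not> k + n \<le> n" "k + n - n = k" using assms by auto
  then show ?thesis by (simp only: code_word_def restrict_apply if_True if_False)
qed

lemma code_word_step:
  assumes c: "c \<in> codes n" and k: "k \<in> {1..n}"
  shows "code_word n a c k + code_word n a c (k + n) + code_state a c (k - 1) = 1 + code_state a c k"
proof -
  have "k \<ge> 1" using k by simp
  then show ?thesis
    unfolding code_word_low[OF k] code_word_high[OF k] code_state_step[OF \<open>k \<ge> 1\<close>]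
    using code_mem[OF c k] code_state_le[of a c "k - 1"] by auto
qed

lemma code_word_PiE:
  assumes cc: "c \<in> codes n"
  shows "code_word n a c \<in> {1..2 * n} \<rightarrow>\<^sub>E {0, 1}"
proof (rule PiE_I)
  fix i assume i: "i \<in> {1..2*n}"
  show "code_word n a c i \<in> {0, 1}"
  proof (cases "i \<le> n")
    case True
    then show ?thesis using i code_mem[OF cc, of i] code_state_le[of a c "i - 1"] by (auto simp: code_word_def)
  next
    case False
    then have "i - n \<in> {1..n}" using i by auto
    then show ?thesis using False i code_mem[OF cc, of "i - n"] code_state_le[of a c "i - n - 1"] by (auto simp: code_word_def)
  qed
next
  fix i assume "i \<notin> {1..2*n}"
  then show "code_word n a c i = undefined" unfolding code_word_def restrict_apply by (rule if_not_P)
qed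

lemma code_word_realizable:
  assumes n: "n \<ge> 3" and a: "a \<le> 1" and c: "c \<in> proper_codes n"
  shows "code_word n a c \<in> realizable_words n"
proof (rule states_realizable[where s = "code_state a c"])
  have cc: "c \<in> codes n" and ev: "even (twos c n)" using c by (auto simp: proper_codes_def even_codes_def)
  show "code_word n a c \<in> {1..2 * n} \<rightarrow>\<^sub>E {0, 1}" by (rule code_word_PiE[OF cc])
  show "code_state a c n = code_state a c 0"
  proof -
    obtain q where "twos c n = 2 * q" using ev by (rule evenE)
    then show ?thesis by (simp add: code_state_def)
  qed
  obtain k where k: "k \<in> {1..n}" "c k = 2" using c by (auto simp: proper_codes_def)
  then have "code_state a c k = 1 - code_state a c (k - 1)" by (simp add: code_state_step)
  then have "code_state a c k = 1 \<and> code_state a c (k - 1) = 0 \<or> code_state a c k = 0 \<and> code_state a c (k - 1) = 1"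
    using code_state_le[of a c "k - 1"] by auto
  moreover have "k \<le> n" "k - 1 \<le> n" using k(1) by auto
  ultimately show "\<exists>k\<le>n. code_state a c k = 1" "\<exists>k\<le>n. code_state a c k = 0" by blast+
  show "code_state a c k \<le> 1" for k by (rule code_state_le)
  show "code_word n a c k + code_word n a c (k + n) + code_state a c (k - 1) = 1 + code_state a c k" if "k \<in> {1..n}" for k
    by (rule code_word_step[OF cc that])
qed (rule n)

text \<open>Two opposite entries that differ reveal the letter 0 or 1. Equal entries mean the letter
  2 and reveal the state before it. As a letter 2 occurs, the first state can be recovered from that
  state.\<close>

lemma code_word_inj: "inj_on (\<lambda>(a, c). code_word n a c) ({0, 1} \<times> proper_codes n)"
proof (rule inj_onI, clarify)
  fix a c a' c'
  assume a: "a \<in> {0, 1 :: nat}" "a' \<in> {0, 1}" and c: "c \<in> proper_codes n" "c' \<in> proper_codes n"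
    and e: "code_word n a c = code_word n a' c'"
  have cc: "c \<in> codes n" "c' \<in> codes n" using c by (auto simp: proper_codes_def even_codes_def)
  have k1: "c k = c' k" and k2: "c k = 2 \<Longrightarrow> code_state a c (k - 1) = code_state a' c' (k - 1)" if k: "k \<in> {1..n}" for k
  proof -
    have "code_word n a c k = code_word n a' c' k" "code_word n a c (k + n) = code_word n a' c' (k + n)"
      using e by simp_all
    then show "c k = c' k" "c k = 2 \<Longrightarrow> code_state a c (k - 1) = code_state a' c' (k - 1)"
      using code_mem[OF cc(1) k] code_mem[OF cc(2) k] code_state_le[of a c "k - 1"] code_state_le[of a' c' "k - 1"]
      by (auto simp: code_word_low[OF k] code_word_high[OF k] split: if_splits)
  qed
  have cc': "c = c'" using cc k1 unfolding codes_def by (intro PiE_ext)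
  obtain k where k: "k \<in> {1..n}" "c k = 2" using c by (auto simp: proper_codes_def)
  from k2[OF k] have "(a + twos c (k - 1)) mod 2 = (a' + twos c (k - 1)) mod 2" by (simp add: code_state_def cc')
  then have "a = a'" using a by auto presburger+
  then show "a = a' \<and> c = c'" using cc' by simp
qed

lemma realizable_code_word:
  assumes v: "v \<in> realizable_words n" and k: "k \<in> {1..n}" "signature n v k \<noteq> 1"
  shows "\<exists>a\<in>{0, 1}. \<exists>c\<in>proper_codes n. v = code_word n a c"
proof -
  obtain s where s: "\<And>k. s k \<le> 1" "s n = s 0" "\<And>k. k \<in> {1..n} \<Longrightarrow> v k + v (k + n) + s (k - 1) = 1 + s k"
    using realizable_states[OF v] by blast
  have vP: "v \<in> {1..2*n} \<rightarrow>\<^sub>E {0, 1}" using v by (simp add: realizable_words_def)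
  have v01: "v i \<le> 1" if "i \<in> {1..2*n}" for i using PiE_mem[OF vP that] by auto
  \<comment> \<open>At signature letter 1 the entry in the first half is \<open>1 - c i\<close>,
    according to \<open>code_word\<close>; the code inverts this. The first state is
    \<open>s 0\<close>.\<close>
  define c where "c = (\<lambda>i\<in>{1..n}. if signature n v i = 1 then 1 - v i else 2)"
  have c2: "c i = 2 \<longleftrightarrow> signature n v i \<noteq> 1" if "i \<in> {1..n}" for i
    using that by (cases "v i") (auto simp: c_def)
  have cc: "c \<in> codes n" using v01 unfolding codes_def c_def by (auto simp: le_Suc_eq)
  have st: "i \<le> n \<Longrightarrow> code_state (s 0) c i = s i" for i
  proof (induction i)
    case 0
    have "s 0 < 2" using s(1)[of 0] by simp
    then show ?case by (simp add: code_state_def)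
  next
    case (Suc i)
    have i: "Suc i \<in> {1..n}" using Suc.prems by simp
    have "code_state (s 0) c i = s i" using Suc by simp
    then show ?case using code_state_step[of "Suc i" "s 0" c] c2[OF i] s(3)[OF i] s(1)[of i] s(1)[of "Suc i"]
      by (auto simp: signature_def)
  qed
  have "v = code_word n (s 0) c"
  proof (rule PiE_ext[OF vP code_word_PiE[OF cc]])
    fix i assume i: "i \<in> {1..2*n}"
    show "v i = code_word n (s 0) c i"
    proof (cases "i \<le> n")
      case True
      then have i': "i \<in> {1..n}" using i by simp
      have "i - 1 \<le> n" using i' by auto
      then show ?thesis using c2[OF i'] s(3)[OF i'] s(1)[of i] s(1)[of "i - 1"] v01[OF i] v01[of "i + n"] i' st[of "i - 1"]
        by (auto simp: code_word_low signature_def c_def)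
    next
      case False
      define j where "j = i - n"
      have j: "j \<in> {1..n}" "i = j + n" using i False by (auto simp: j_def)
      have "j - 1 \<le> n" using j by auto
      then show ?thesis using c2[OF j(1)] s(3)[OF j(1)] s(1)[of j] s(1)[of "j - 1"] v01[of j] v01[OF i] j st[of "j - 1"]
        by (auto simp: code_word_high signature_def c_def)
    qed
  qed
  moreover have "even (twos c n)"
  proof -
    have "code_state (s 0) c n = code_state (s 0) c 0" using st[of n] st[of 0] s(2) by simp
    then have "(s 0 + twos c n) mod 2 = s 0 mod 2" by (simp add: code_state_def)
    moreover have "even y" if "(x + y) mod 2 = x mod 2" for x y :: nat using that by presburger
    ultimately show ?thesis by blast
  qed
  moreover have "s 0 \<in> {0, 1}" using s(1)[of 0] by auto
  moreover have "c k = 2" using c2[OF k(1)] k(2) by simp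
  ultimately have "c \<in> proper_codes n" "s 0 \<in> {0, 1}" "v = code_word n (s 0) c"
    using cc k(1) unfolding proper_codes_def even_codes_def by blast+
  then show ?thesis by blast
qed

text \<open>With constant signature the second half of the word is the complement of the
  first.\<close>

lemma card_flat_words:
  "card {v \<in> realizable_words n. \<forall>k\<in>{1..n}. signature n v k = 1} \<le> 2 ^ n"
proof -
  let ?A = "{v \<in> realizable_words n. \<forall>k\<in>{1..n}. signature n v k = 1}"
  have vP: "v \<in> {1..2*n} \<rightarrow>\<^sub>E {0, 1}" if "v \<in> ?A" for v using that by (simp add: realizable_words_def)
  have "card ?A \<le> card ({1..n} \<rightarrow>\<^sub>E {0, 1 :: nat})"
  proof (rule card_inj_on_le[of "\<lambda>v. restrict v {1..n}"])
    show "inj_on (\<lambda>v. restrict v {1..n}) ?A"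
    proof (rule inj_onI)
      fix v w assume v: "v \<in> ?A" and w: "w \<in> ?A" and e: "restrict v {1..n} = restrict w {1..n}"
      have low: "v i = w i" if "i \<in> {1..n}" for i using fun_cong[OF e, of i] that by simp
      show "v = w"
      proof (rule PiE_ext[OF vP[OF v] vP[OF w]])
        fix i assume i: "i \<in> {1..2*n}"
        show "v i = w i"
        proof (cases "i \<le> n")
          case False
          define j where "j = i - n"
          have j: "j \<in> {1..n}" "i = j + n" using i False by (auto simp: j_def)
          have "signature n v j = 1" "signature n w j = 1" using v w j(1) by auto
          then show ?thesis using low[OF j(1)] by (auto simp: signature_def j(2))
        qed (use i low in simp)
      qed
    qed
    show "(\<lambda>v. restrict v {1..n}) ` ?A \<subseteq> {1..n} \<rightarrow>\<^sub>E {0, 1}"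
    proof (intro subsetI, elim imageE)
      fix w v assume v: "v \<in> ?A" "w = restrict v {1..n}"
      have "v i \<in> {0, 1}" if "i \<in> {1..n}" for i by (rule PiE_mem[OF vP[OF v(1)]]) (use that in auto)
      then show "w \<in> {1..n} \<rightarrow>\<^sub>E {0, 1}" unfolding v(2) restrict_PiE_iff by blast
    qed
    show "finite ({1..n} \<rightarrow>\<^sub>E {0, 1 :: nat})" by (intro finite_PiE) auto
  qed
  also have "\<dots> = 2 ^ n" by (simp add: card_PiE numeral_2_eq_2)
  finally show ?thesis .
qed

section \<open>Averages over realizable words and over all codes\<close>

lemma sum_diff_le:
  fixes g :: "'a \<Rightarrow> real"
  assumes "finite A" "B \<subseteq> A" "card (A - B) \<le> N" "\<And>x. x \<in> A \<Longrightarrow> \<bar>g x\<bar> \<le> b" "0 \<le> b"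
  shows "\<bar>sum g A - sum g B\<bar> \<le> b * real N"
proof -
  have "\<bar>sum g A - sum g B\<bar> = \<bar>sum g (A - B)\<bar>" using assms by (simp add: sum_diff)
  also have "\<dots> \<le> (\<Sum>x\<in>A - B. \<bar>g x\<bar>)" by (rule sum_abs)
  also have "\<dots> \<le> (\<Sum>x\<in>A - B. b)" using assms by (intro sum_mono) auto
  also have "\<dots> = b * real (card (A - B))" by simp
  also have "\<dots> \<le> b * real N" using assms by (intro mult_left_mono) auto
  finally show ?thesis .
qed

lemma sum_realizable_words:
  fixes g :: "(nat \<Rightarrow> nat) \<Rightarrow> real"
  assumes n: "n \<ge> 3" and b: "\<And>v. \<bar>g v\<bar> \<le> b" "0 \<le> b"
  shows "\<bar>sum g (realizable_words n) - (\<Sum>a\<in>{0, 1}. \<Sum>c\<in>proper_codes n. g (code_word n a c))\<bar> \<le> b * 2 ^ n"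
proof -
  let ?W = "(\<lambda>(a, c). code_word n a c) ` ({0, 1} \<times> proper_codes n)"
  have sub: "?W \<subseteq> realizable_words n" using code_word_realizable[OF n] by auto
  have "realizable_words n - ?W \<subseteq> {v \<in> realizable_words n. \<forall>k\<in>{1..n}. signature n v k = 1}"
    using realizable_code_word by fastforce
  then have "card (realizable_words n - ?W) \<le> card {v \<in> realizable_words n. \<forall>k\<in>{1..n}. signature n v k = 1}"
    by (intro card_mono) (auto simp: finite_realizable_words)
  also have "\<dots> \<le> 2 ^ n" by (rule card_flat_words)
  finally have "\<bar>sum g (realizable_words n) - sum g ?W\<bar> \<le> b * real (2 ^ n)"
    using b sub by (intro sum_diff_le finite_realizable_words) auto
  moreover have "sum g ?W = (\<Sum>a\<in>{0, 1}. \<Sum>c\<in>proper_codes n. g (code_word n a c))"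
    by (subst sum.reindex[OF code_word_inj]) (simp add: o_def case_prod_beta' sum.cartesian_product)
  ultimately show ?thesis by simp
qed

definition flip_index :: "(nat \<Rightarrow> nat) \<Rightarrow> nat" where
  "flip_index c = (LEAST k. 1 \<le> k \<and> c k \<noteq> 1)"

text \<open>An involution that changes the parity of the number of letters 2.\<close>

definition flip :: "(nat \<Rightarrow> nat) \<Rightarrow> nat \<Rightarrow> nat" where
  "flip c = c(flip_index c := 2 - c (flip_index c))"

text \<open>The flipped letter is 0 or 2 before and after, so its position remains the first one
  with a letter other than 1. This makes \<open>flip\<close> an involution. The count of letters 2
  changes by 1 from that position on.\<close>

lemma flip_properties:
  assumes c: "c \<in> codes n" and ne: "\<exists>k\<in>{1..n}. c k \<noteq> 1"
  shows "flip c \<in> codes n" "\<exists>k\<in>{1..n}. flip c k \<noteq> 1" "flip (flip c) = c"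
    "even (twos (flip c) n) \<longleftrightarrow> odd (twos c n)" "\<bar>int (twos (flip c) j) - int (twos c j)\<bar> \<le> 1"
proof -
  define k where "k = flip_index c"
  obtain k' where k': "k' \<in> {1..n}" "c k' \<noteq> 1" using ne by blast
  have k: "1 \<le> k" "c k \<noteq> 1" unfolding k_def flip_index_def
    using LeastI[of "\<lambda>k. 1 \<le> k \<and> c k \<noteq> 1" k'] k' by auto
  have "k \<le> k'" unfolding k_def flip_index_def using k' by (intro Least_le) auto
  then have kn: "k \<in> {1..n}" using k k' by auto
  have f: "flip c = c(k := 2 - c k)" by (simp add: flip_def k_def)
  have ck: "c k = 0 \<or> c k = 2" using code_mem[OF c kn] k by auto
  show "flip c \<in> codes n" using c kn ck unfolding f codes_def by (auto simp: PiE_iff extensional_def)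
  show "\<exists>k\<in>{1..n}. flip c k \<noteq> 1" using kn ck by (intro bexI[of _ k]) (auto simp: f)
  have "flip_index (flip c) = k"
    unfolding flip_index_def
  proof (rule Least_equality)
    show "1 \<le> k \<and> flip c k \<noteq> 1" using k ck by (auto simp: f)
    fix y assume y: "1 \<le> y \<and> flip c y \<noteq> 1"
    show "k \<le> y"
    proof (rule ccontr)
      assume "\<not> k \<le> y"
      then have "1 \<le> y \<and> c y \<noteq> 1" using y by (auto simp: f)
      then have "k \<le> y" unfolding k_def flip_index_def by (rule Least_le)
      then show False using \<open>\<not> k \<le> y\<close> by simp
    qed
  qed
  then have "flip (flip c) = (flip c)(k := 2 - flip c k)" by (simp only: flip_def[of "flip c"])
  then show "flip (flip c) = c" using ck by (auto simp: f)
  have tw: "int (twos (flip c) j) = int (twos c j) + (if k \<le> j then (if c k = 2 then -1 else 1) else 0)" for j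
  proof (induction j)
    case 0
    show ?case using k by simp
  next
    case (Suc j)
    show ?case
    proof (cases "k = Suc j")
      case True
      then show ?thesis using Suc ck by (auto simp: twos_Suc f)
    next
      case False
      then have "flip c (Suc j) = c (Suc j)" by (simp add: f)
      moreover have "k \<le> Suc j \<longleftrightarrow> k \<le> j" using False by auto
      ultimately show ?thesis using Suc by (simp add: twos_Suc)
    qed
  qed
  from tw[of n] kn have "int (twos (flip c) n) = int (twos c n) + (if c k = 2 then -1 else 1)" by simp
  then have "even (int (twos (flip c) n)) \<longleftrightarrow> odd (int (twos c n))" by (auto split: if_splits)
  then show "even (twos (flip c) n) \<longleftrightarrow> odd (twos c n)" by simp
  show "\<bar>int (twos (flip c) j) - int (twos c j)\<bar> \<le> 1" using tw[of j] by auto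
qed

text \<open>\<open>flip\<close> matches even with odd codes, and \<open>h\<close> varies by at most
  \<open>\<delta>\<close> within a pair. The code consisting of letters 1 alone has no partner; it
  causes the term \<open>b\<close>.\<close>

lemma sum_even_codes:
  fixes h :: "(nat \<Rightarrow> nat) \<Rightarrow> real"
  assumes b: "\<And>c. \<bar>h c\<bar> \<le> b"
    and \<delta>: "\<And>c c'. c \<in> codes n \<Longrightarrow> c' \<in> codes n \<Longrightarrow> (\<And>j. \<bar>int (twos c' j) - int (twos c j)\<bar> \<le> 1) \<Longrightarrow> \<bar>h c - h c'\<bar> \<le> \<delta>"
    and "0 \<le> \<delta>"
  shows "\<bar>2 * sum h (even_codes n) - sum h (codes n)\<bar> \<le> 3 ^ n * \<delta> + b"
proof -
  define one :: "nat \<Rightarrow> nat" where "one = (\<lambda>i\<in>{1..n}. 1)"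
  define Od where "Od = {c \<in> codes n. odd (twos c n)}"
  define E where "E = even_codes n - {one}"
  have "{i\<in>{1..n}. one i = 2} = {}" by (auto simp: one_def)
  then have one2: "twos one n = 0" by (simp only: twos_def card.empty)
  have "one \<in> codes n" unfolding codes_def one_def restrict_PiE_iff by blast
  then have one: "one \<in> even_codes n" using one2 by (simp add: even_codes_def)
  have only: "\<exists>k\<in>{1..n}. c k \<noteq> 1" if "c \<in> codes n" "c \<noteq> one" for c
  proof (rule ccontr)
    assume *: "\<not> ?thesis"
    have "one \<in> codes n" using one by (simp add: even_codes_def)
    then have "c = one" using that(1) * unfolding codes_def by (intro PiE_ext) (auto simp: one_def)
    then show False using that by simp
  qed
  have oneO: "one \<notin> Od" using one by (auto simp: Od_def even_codes_def)
  have bij: "bij_betw flip E Od"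
  proof (rule bij_betw_byWitness[where f' = flip])
    have EX: "\<exists>k\<in>{1..n}. c k \<noteq> 1" "c \<in> codes n" if "c \<in> E \<or> c \<in> Od" for c
      using that only[of c] oneO by (auto simp: E_def Od_def even_codes_def)
    show "\<forall>c\<in>E. flip (flip c) = c"
      by (rule ballI, rule flip_properties(3)[OF EX(2,1)[OF disjI1]])
    show "\<forall>c\<in>Od. flip (flip c) = c"
      by (rule ballI, rule flip_properties(3)[OF EX(2,1)[OF disjI2]])
    show "flip ` E \<subseteq> Od"
    proof (rule image_subsetI)
      fix d assume d: "d \<in> E"
      note fp = flip_properties[OF EX(2)[OF disjI1[OF d]] EX(1)[OF disjI1[OF d]]]
      show "flip d \<in> Od" using fp(1,4) d by (simp add: Od_def E_def even_codes_def)
    qed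
    show "flip ` Od \<subseteq> E"
    proof (rule image_subsetI)
      fix d assume d: "d \<in> Od"
      note fp = flip_properties[OF EX(2)[OF disjI2[OF d]] EX(1)[OF disjI2[OF d]]]
      have "flip d \<noteq> one" using fp(2) by (auto simp: one_def)
      then show "flip d \<in> E" using fp(1,4) d by (simp add: Od_def E_def even_codes_def)
    qed
  qed
  have fin: "finite E" "finite Od" by (auto simp: E_def Od_def)
  have "sum h (codes n) = sum h (even_codes n) + sum h Od"
  proof -
    have "codes n = even_codes n \<union> Od" "even_codes n \<inter> Od = {}" by (auto simp: even_codes_def Od_def)
    then show ?thesis using fin by (simp add: sum.union_disjoint)
  qed
  moreover have "sum h (even_codes n) = h one + sum h E"
    using one by (simp add: E_def sum.remove)
  moreover have "sum h Od = (\<Sum>c\<in>E. h (flip c))" using sum.reindex_bij_betw[OF bij, of h] by simp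
  ultimately have "2 * sum h (even_codes n) - sum h (codes n) = h one + (\<Sum>c\<in>E. h c - h (flip c))"
    by (simp add: sum_subtractf)
  also have "\<bar>\<dots>\<bar> \<le> \<bar>h one\<bar> + \<bar>\<Sum>c\<in>E. h c - h (flip c)\<bar>" by (rule abs_triangle_ineq)
  also have "\<dots> \<le> b + (\<Sum>c\<in>E. \<delta>)"
  proof (intro add_mono b order.trans[OF sum_abs] sum_mono \<delta>)
    fix c assume "c \<in> E"
    then have c: "c \<in> codes n" "\<exists>k\<in>{1..n}. c k \<noteq> 1" using only by (auto simp: E_def even_codes_def)
    then show "c \<in> codes n" "flip c \<in> codes n" "\<bar>int (twos (flip c) j) - int (twos c j)\<bar> \<le> 1" for j
      using flip_properties(1,5)[OF c] by auto
  qed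
  also have "(\<Sum>c\<in>E. \<delta>) \<le> 3 ^ n * \<delta>"
  proof -
    have "card E \<le> card (codes n)" by (intro card_mono) (auto simp: E_def even_codes_def)
    then have "real (card E) \<le> 3 ^ n" unfolding card_codes by (simp flip: of_nat_le_iff)
    then show ?thesis using \<open>0 \<le> \<delta>\<close> by (simp add: mult_right_mono)
  qed
  finally show ?thesis by simp
qed

text \<open>The two first states compensate the restriction to even codes, so all codes together
  carry weight 1. Words of constant signature cost \<open>b * 2 ^ n\<close>. Even codes without a
  letter 2 cost the same, twice.\<close>

lemma sum_realizable_words_codes:
  fixes g H :: "(nat \<Rightarrow> nat) \<Rightarrow> real"
  assumes n: "n \<ge> 3" and b: "\<And>v. \<bar>g v\<bar> \<le> b" "\<And>c. \<bar>H c\<bar> \<le> b"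
    and \<epsilon>: "\<And>a c. a \<le> 1 \<Longrightarrow> c \<in> codes n \<Longrightarrow> \<bar>g (code_word n a c) - H c\<bar> \<le> \<epsilon>" "0 \<le> \<epsilon>"
    and \<delta>: "\<And>c c'. c \<in> codes n \<Longrightarrow> c' \<in> codes n \<Longrightarrow> (\<And>j. \<bar>int (twos c' j) - int (twos c j)\<bar> \<le> 1) \<Longrightarrow> \<bar>H c - H c'\<bar> \<le> \<delta>"
      "0 \<le> \<delta>"
  shows "\<bar>sum g (realizable_words n) - sum H (codes n)\<bar> \<le> 3 * b * 2 ^ n + b + 3 ^ n * (2 * \<epsilon> + \<delta>)"
proof -
  have b0: "0 \<le> b" using b(1) abs_ge_zero order.trans by blast
  have pc: "proper_codes n \<subseteq> codes n" by (auto simp: proper_codes_def even_codes_def)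
  have "card (proper_codes n) \<le> card (codes n)" by (intro card_mono pc) simp
  then have card: "real (card (proper_codes n)) \<le> 3 ^ n" unfolding card_codes by (simp flip: of_nat_le_iff)
  have 1: "\<bar>sum g (realizable_words n) - (\<Sum>a\<in>{0, 1}. \<Sum>c\<in>proper_codes n. g (code_word n a c))\<bar> \<le> b * 2 ^ n"
    using n b(1) b0 by (rule sum_realizable_words)
  have "\<bar>(\<Sum>c\<in>proper_codes n. g (code_word n a c)) - sum H (proper_codes n)\<bar> \<le> 3 ^ n * \<epsilon>" if "a \<le> 1" for a
  proof -
    have "\<bar>(\<Sum>c\<in>proper_codes n. g (code_word n a c)) - sum H (proper_codes n)\<bar> \<le> (\<Sum>c\<in>proper_codes n. \<bar>g (code_word n a c) - H c\<bar>)"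
      unfolding sum_subtractf[symmetric] by (rule sum_abs)
    also have "\<dots> \<le> (\<Sum>c\<in>proper_codes n. \<epsilon>)" using \<epsilon>(1)[OF that] pc by (intro sum_mono) auto
    also have "\<dots> \<le> 3 ^ n * \<epsilon>" using card \<epsilon>(2) by (simp add: mult_right_mono)
    finally show ?thesis .
  qed
  from this[of 0] this[of 1]
  have 2: "\<bar>(\<Sum>a\<in>{0, 1}. \<Sum>c\<in>proper_codes n. g (code_word n a c)) - 2 * sum H (proper_codes n)\<bar> \<le> 2 * (3 ^ n * \<epsilon>)"
    by simp
  have "card (even_codes n - proper_codes n) \<le> card ({1..n} \<rightarrow>\<^sub>E {0, 1 :: nat})"
  proof (intro card_mono subsetI)
    fix c assume c: "c \<in> even_codes n - proper_codes n"
    then have cc: "c \<in> codes n" and no: "\<forall>k\<in>{1..n}. c k \<noteq> 2" by (auto simp: even_codes_def proper_codes_def)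
    show "c \<in> {1..n} \<rightarrow>\<^sub>E {0, 1}"
      using cc code_mem[OF cc] no by (auto simp: codes_def PiE_iff)
  qed (intro finite_PiE, auto)
  also have "\<dots> = 2 ^ n" by (simp add: card_PiE numeral_2_eq_2)
  finally have "card (even_codes n - proper_codes n) \<le> 2 ^ n" .
  then have "\<bar>sum H (even_codes n) - sum H (proper_codes n)\<bar> \<le> b * real (2 ^ n)"
    using b(2) b0 by (intro sum_diff_le) (auto simp: proper_codes_def)
  then have 3: "\<bar>sum H (even_codes n) - sum H (proper_codes n)\<bar> \<le> b * 2 ^ n" by simp
  have 4: "\<bar>2 * sum H (even_codes n) - sum H (codes n)\<bar> \<le> 3 ^ n * \<delta> + b"
    using b(2) \<delta> by (rule sum_even_codes)
  show ?thesis using 1 2 3 4 unfolding abs_le_iff by (simp add: algebra_simps)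
qed

section \<open>Lipschitz functionals on the Skorokhod space\<close>

text \<open>The uniform distance, truncated at 1 so that the supremum exists for arbitrary
  functions.\<close>

definition path_dist :: "(real \<Rightarrow> 'a::metric_space) \<Rightarrow> (real \<Rightarrow> 'a) \<Rightarrow> real" where
  "path_dist x y = (SUP t\<in>{0..1}. min 1 (dist (x t) (y t)))"

lemma path_dist_upper: "t \<in> {0..1} \<Longrightarrow> min 1 (dist (x t) (y t)) \<le> path_dist x y"
  unfolding path_dist_def by (rule cSUP_upper) (auto intro!: bdd_aboveI[of _ 1])

lemma path_dist_least: "(\<And>t. t \<in> {0..1} \<Longrightarrow> min 1 (dist (x t) (y t)) \<le> e) \<Longrightarrow> path_dist x y \<le> e"
  unfolding path_dist_def by (rule cSUP_least) auto

lemma path_dist_nonneg: "0 \<le> path_dist x y"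
  by (rule order.trans[OF _ path_dist_upper[of 0]]) auto

lemma path_dist_le_1: "path_dist x y \<le> 1"
  by (rule path_dist_least) auto

lemma path_dist_commute: "path_dist x y = path_dist y x"
  by (simp add: path_dist_def dist_commute)

lemma path_dist_self: "path_dist x x = 0"
  by (rule antisym[OF path_dist_least path_dist_nonneg]) auto

lemma path_dist_triangle: "path_dist x z \<le> path_dist x y + path_dist y z"
proof (rule path_dist_least)
  fix t :: real assume t: "t \<in> {0..1}"
  have "min 1 (dist (x t) (z t)) \<le> min 1 (dist (x t) (y t)) + min 1 (dist (y t) (z t))"
    using dist_triangle[of "x t" "z t" "y t"] zero_le_dist[of "x t" "y t"] zero_le_dist[of "y t" "z t"]
    unfolding min_def by (smt (verit))
  also have "\<dots> \<le> path_dist x y + path_dist y z" using path_dist_upper[OF t] by (intro add_mono)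
  finally show "min 1 (dist (x t) (z t)) \<le> path_dist x y + path_dist y z" .
qed

text \<open>The piece in force changes only at the times \<open>j / n\<close>. For
  \<open>n = 0\<close> the index is always 0, so that the lemma also covers a single continuous
  piece.\<close>

lemma cadlag_step:
  fixes G :: "nat \<Rightarrow> real \<Rightarrow> 'a::topological_space"
  assumes G: "\<And>j. continuous_on UNIV (G j)"
  shows "(\<lambda>t\<in>{0..1}. G (nat \<lfloor>t * real n\<rfloor>) t) \<in> cadlag_space"
proof -
  let ?x = "\<lambda>t\<in>{0..1}. G (nat \<lfloor>t * real n\<rfloor>) t"
  have lim: "(G j \<longlongrightarrow> G j t) (at_right t)" "(G j \<longlongrightarrow> G j t) (at_left t)" for j and t :: real
  proof -
    have "(G j \<longlongrightarrow> G j t) (at t)" using G[of j] by (simp add: continuous_on_eq_continuous_at isCont_def)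
    then show "(G j \<longlongrightarrow> G j t) (at_right t)" "(G j \<longlongrightarrow> G j t) (at_left t)"
      by (rule tendsto_within_subset[OF _ subset_UNIV])+
  qed
  have "(?x \<longlongrightarrow> ?x t) (at_right t)" if t: "t \<in> {0..<1}" for t
  proof -
    define j where "j = \<lfloor>t * real n\<rfloor>"
    define d where "d = (if n = 0 then 1 else min 1 ((of_int j + 1) / real n))"
    have "t < d"
    proof (cases "n = 0")
      case False
      have "t * real n < of_int j + 1" unfolding j_def by linarith
      then show ?thesis using t False by (auto simp: d_def field_simps)
    qed (use t in \<open>simp add: d_def\<close>)
    have "\<forall>\<^sub>F s in at_right t. G (nat j) s = ?x s"
    proof (rule eventually_at_rightI[OF _ \<open>t < d\<close>])
      fix s assume s: "s \<in> {t<..<d}"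
      have "\<lfloor>s * real n\<rfloor> = j"
      proof (cases "n = 0")
        case False
        have "t * real n \<le> s * real n" using s by (intro mult_right_mono) auto
        moreover have "s * real n < of_int j + 1" using s False by (simp add: d_def field_simps)
        moreover have "of_int j \<le> t * real n" unfolding j_def by linarith
        ultimately show ?thesis by (intro floor_eq_iff[THEN iffD2]) linarith
      qed (simp add: j_def)
      moreover have "s \<in> {0..1}" using s t by (auto simp: d_def split: if_splits)
      ultimately show "G (nat j) s = ?x s" by simp
    qed
    then have "(?x \<longlongrightarrow> G (nat j) t) (at_right t)" using lim(1)[of "nat j" t] by (rule Lim_transform_eventually[rotated])
    then show ?thesis using t by (simp add: j_def)
  qed
  moreover have "\<exists>l. (?x \<longlongrightarrow> l) (at_left t)" if t: "t \<in> {0<..1}" for t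
  proof -
    define j where "j = \<lceil>t * real n\<rceil> - 1"
    define d where "d = (if n = 0 then 0 else max 0 (of_int j / real n))"
    have "d < t"
    proof (cases "n = 0")
      case False
      have "of_int j < t * real n" unfolding j_def by linarith
      then show ?thesis using t False by (auto simp: d_def field_simps)
    qed (use t in \<open>simp add: d_def\<close>)
    have "\<forall>\<^sub>F s in at_left t. G (if n = 0 then 0 else nat j) s = ?x s"
    proof (rule eventually_at_leftI[OF _ \<open>d < t\<close>])
      fix s assume s: "s \<in> {d<..<t}"
      have "\<lfloor>s * real n\<rfloor> = j" if "n \<noteq> 0"
      proof -
        have "of_int j < s * real n" using s that by (simp add: d_def field_simps)
        moreover have "s * real n < t * real n" using s that by simp
        moreover have "t * real n \<le> of_int j + 1" unfolding j_def by linarith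
        ultimately show ?thesis by (intro floor_eq_iff[THEN iffD2]) linarith
      qed
      moreover have "s \<in> {0..1}" using s t by (auto simp: d_def split: if_splits)
      ultimately show "G (if n = 0 then 0 else nat j) s = ?x s" by simp
    qed
    then show ?thesis using lim(2)[of "if n = 0 then 0 else nat j" t] Lim_transform_eventually by blast
  qed
  ultimately show ?thesis unfolding cadlag_space_def by auto
qed

lemma const_cadlag: "(\<lambda>t\<in>{0..1}. c) \<in> cadlag_space"
  using cadlag_step[of "\<lambda>_ _. c" 0] by simp

text \<open>With the identity as time change, uniform balls lie in Skorokhod balls: the uniform
  topology is finer than J1.\<close>

lemma open_J1_path_dist:
  assumes U: "openin skorokhod_J1 U" and x: "x \<in> U"
  obtains e where "e > 0" "\<And>y. y \<in> cadlag_space \<Longrightarrow> path_dist x y < e \<Longrightarrow> y \<in> U"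
proof -
  obtain e where e: "e > 0" "skorokhod_ball x e \<subseteq> U" using U x unfolding openin_skorokhod_J1 by blast
  show ?thesis
  proof (rule that[of "min e 1"])
    show "min e 1 > 0" using e by simp
    fix y assume y: "y \<in> cadlag_space" "path_dist x y < min e 1"
    have "id \<in> time_changes" by (auto simp: time_changes_def strict_mono_on_def)
    moreover have "dist (id t) t \<le> path_dist x y \<and> dist (x t) (y (id t)) \<le> path_dist x y" if "t \<in> {0..1}" for t
      using path_dist_upper[OF that, of x y] y(2) path_dist_nonneg[of x y] by auto
    ultimately have "\<exists>l\<in>time_changes. \<exists>d<e. \<forall>t\<in>{0..1}. dist (l t) t \<le> d \<and> dist (x t) (y (l t)) \<le> d"
      using y(2) by (intro bexI[of _ id] exI[of _ "path_dist x y"]) auto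
    then have "y \<in> skorokhod_ball x e" unfolding skorokhod_ball_def using y(1) by blast
    then show "y \<in> U" using e by blast
  qed
qed

text \<open>As \<open>k\<close> grows, these Lipschitz functions increase to \<open>f\<close> at the points where \<open>f\<close> is lower
  semicontinuous.\<close>

definition lipschitz_env :: "((real \<Rightarrow> 'a::metric_space) \<Rightarrow> real) \<Rightarrow> (real \<Rightarrow> 'a) set \<Rightarrow> real \<Rightarrow> (real \<Rightarrow> 'a) \<Rightarrow> real" where
  "lipschitz_env f D k x = (INF y\<in>D. f y + k * path_dist x y)"

lemma lipschitz_env_bounds:
  assumes D: "D \<noteq> {}" and f: "\<And>y. y \<in> D \<Longrightarrow> \<bar>f y\<bar> \<le> b" and k: "0 \<le> k"
  shows "- b \<le> lipschitz_env f D k x" "y \<in> D \<Longrightarrow> lipschitz_env f D k x \<le> f y + k * path_dist x y"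
    "\<bar>lipschitz_env f D k x - lipschitz_env f D k x'\<bar> \<le> k * path_dist x x'"
    "\<bar>lipschitz_env f D k x\<bar> \<le> b + k"
proof -
  have low: "- b \<le> f y + k * path_dist x y" if "y \<in> D" for x y
    using f[OF that] mult_nonneg_nonneg[OF k path_dist_nonneg[of x y]] by auto
  show 1: "- b \<le> lipschitz_env f D k x" unfolding lipschitz_env_def using D low by (intro cINF_greatest)
  have 2: "lipschitz_env f D k x \<le> f y + k * path_dist x y" if "y \<in> D" for x y
    unfolding lipschitz_env_def using low that by (intro cINF_lower) (auto intro!: bdd_belowI[of _ "- b"])
  then show "y \<in> D \<Longrightarrow> lipschitz_env f D k x \<le> f y + k * path_dist x y" .
  have 3: "lipschitz_env f D k x - k * path_dist x x' \<le> lipschitz_env f D k x'" for x x'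
    unfolding lipschitz_env_def[of f D k x'] using D
  proof (intro cINF_greatest)
    fix y assume "y \<in> D"
    from 2[OF this, of x] have "lipschitz_env f D k x \<le> f y + k * path_dist x y" .
    also have "\<dots> \<le> f y + k * (path_dist x x' + path_dist x' y)"
      using k path_dist_triangle[of x y x'] by (intro add_left_mono mult_left_mono)
    finally show "lipschitz_env f D k x - k * path_dist x x' \<le> f y + k * path_dist x' y"
      by (simp add: algebra_simps)
  qed
  show "\<bar>lipschitz_env f D k x - lipschitz_env f D k x'\<bar> \<le> k * path_dist x x'"
    using 3[of x x'] 3[of x' x] by (simp add: path_dist_commute[of x' x] abs_le_iff)
  obtain y where y: "y \<in> D" using D by blast
  have "k * path_dist x y \<le> k * 1" using k path_dist_le_1 by (intro mult_left_mono)
  then show "\<bar>lipschitz_env f D k x\<bar> \<le> b + k" using 1 2[OF y, of x] f[OF y] k by auto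
qed

lemma lipschitz_env_tendsto:
  assumes f: "\<And>y. y \<in> D \<Longrightarrow> \<bar>f y\<bar> \<le> b" and x: "x \<in> D"
    and cont: "\<And>e. e > 0 \<Longrightarrow> \<exists>d>0. \<forall>y\<in>D. path_dist x y < d \<longrightarrow> f x - e < f y"
  shows "(\<lambda>k. lipschitz_env f D (real k) x) \<longlonglongrightarrow> f x"
proof (rule tendstoI)
  fix e :: real assume e: "e > 0"
  have D: "D \<noteq> {}" using x by blast
  obtain d where d: "d > 0" "\<And>y. y \<in> D \<Longrightarrow> path_dist x y < d \<Longrightarrow> f x - e / 2 < f y" using cont[of "e / 2"] e by auto
  \<comment> \<open>Outside the ball of radius \<open>d\<close> the penalty is at least
    \<open>2 * b\<close>, which makes up for any difference of two values of \<open>f\<close>. So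
    the values in the ball decide.\<close>
  have "dist (lipschitz_env f D (real k) x) (f x) < e" if k: "real k \<ge> 2 * b / d" for k
  proof -
    have "lipschitz_env f D (real k) x \<le> f x"
      using lipschitz_env_bounds(2)[where b = b and k = "real k" and x = x, OF D f _ x] by (simp add: path_dist_self)
    moreover have "f x - e / 2 \<le> lipschitz_env f D (real k) x"
      unfolding lipschitz_env_def
    proof (rule cINF_greatest[OF D])
      fix y assume y: "y \<in> D"
      have nn: "0 \<le> real k * path_dist x y" by (intro mult_nonneg_nonneg path_dist_nonneg) simp
      show "f x - e / 2 \<le> f y + real k * path_dist x y"
      proof (cases "path_dist x y < d")
        case True
        then show ?thesis using d(2)[OF y] nn by linarith
      next
        case False
        have "2 * b \<le> real k * d" using k d(1) by (simp add: field_simps)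
        also have "\<dots> \<le> real k * path_dist x y" using False by (intro mult_left_mono) auto
        finally show ?thesis using f[OF y] f[OF x] e by linarith
      qed
    qed
    ultimately show ?thesis using e by (auto simp: dist_real_def)
  qed
  moreover have "\<forall>\<^sub>F k in sequentially. real k \<ge> 2 * b / d"
    using filterlim_real_sequentially by (auto simp: filterlim_at_top)
  ultimately show "\<forall>\<^sub>F k in sequentially. dist (lipschitz_env f D (real k) x) (f x) < e"
    by (auto elim: eventually_mono)
qed

section \<open>Convergence in distribution tested on Lipschitz functionals\<close>

lemma space_borel_of_top: "space (borel_of_top T) = topspace T"
  by (simp add: borel_of_top_def space_measure_of_conv)

lemma measurable_borel_of_topI:
  assumes "\<And>\<omega>. \<omega> \<in> space M \<Longrightarrow> X \<omega> \<in> topspace T"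
    and "\<And>U. openin T U \<Longrightarrow> {\<omega> \<in> space M. X \<omega> \<in> U} \<in> sets M"
  shows "X \<in> M \<rightarrow>\<^sub>M borel_of_top T"
  unfolding borel_of_top_def
proof (rule measurable_measure_of)
  show "{U. openin T U} \<subseteq> Pow (topspace T)" using openin_subset by blast
  show "X \<in> space M \<rightarrow> topspace T" using assms(1) by blast
  fix U assume "U \<in> {U. openin T U}"
  then have "{\<omega> \<in> space M. X \<omega> \<in> U} \<in> sets M" using assms(2) by blast
  moreover have "X -` U \<inter> space M = {\<omega> \<in> space M. X \<omega> \<in> U}" by blast
  ultimately show "X -` U \<inter> space M \<in> sets M" by simp
qed

lemma continuous_map_measurable:
  assumes f: "continuous_map T euclideanreal f"
  shows "f \<in> borel_of_top T \<rightarrow>\<^sub>M borel"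
proof (rule borel_measurableI)
  fix S :: "real set" assume "open S"
  then have "openin T {x \<in> topspace T. f x \<in> S}"
    using openin_continuous_map_preimage[OF f, of S] by simp
  then have "{x \<in> topspace T. f x \<in> S} \<in> sets (borel_of_top T)"
    unfolding borel_of_top_def using openin_subset by (subst sets_measure_of) (auto intro: sigma_sets.Basic)
  moreover have "f -` S \<inter> space (borel_of_top T) = {x \<in> topspace T. f x \<in> S}"
    by (auto simp: space_borel_of_top)
  ultimately show "f -` S \<inter> space (borel_of_top T) \<in> sets (borel_of_top T)" by simp
qed

text \<open>Functionals that are Lipschitz for the uniform distance are needed because the
  comparison of walk and grid gives uniform bounds. \<open>Ym\<close> restricts measurability on the
  limit side to such functionals; \<open>Xm\<close> asks it of all functionals, which discrete
  spaces provide.\<close>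

context
  fixes M :: "nat \<Rightarrow> 'w measure" and X :: "nat \<Rightarrow> 'w \<Rightarrow> real \<Rightarrow> 'a::metric_space"
    and N :: "'v measure" and Y :: "'v \<Rightarrow> real \<Rightarrow> 'a"
  assumes M: "\<And>n. prob_space (M n)" and X: "\<And>n. X n \<in> M n \<rightarrow>\<^sub>M borel_of_top skorokhod_J1"
    and N: "prob_space N" and Y: "\<And>\<omega>. \<omega> \<in> space N \<Longrightarrow> Y \<omega> \<in> cadlag_space"
    and Xm: "\<And>n h. (\<lambda>\<omega>. h (X n \<omega>) :: real) \<in> borel_measurable (M n)"
    and Ym: "\<And>h b k. (\<And>x. \<bar>h x\<bar> \<le> b) \<Longrightarrow> (\<And>x y. \<bar>h x - h y\<bar> \<le> k * path_dist x y) \<Longrightarrow>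
      (\<lambda>\<omega>. h (Y \<omega>) :: real) \<in> borel_measurable N"
    and lim: "\<And>h b k. (\<And>x. \<bar>h x\<bar> \<le> b) \<Longrightarrow> (\<And>x y. \<bar>h x - h y\<bar> \<le> k * path_dist x y) \<Longrightarrow>
      (\<lambda>n. \<integral>\<omega>. h (X n \<omega>) \<partial>M n) \<longlonglongrightarrow> (\<integral>\<omega>. h (Y \<omega>) \<partial>N :: real)"
begin

text \<open>A J1-open set is open for \<open>path_dist\<close> within the cadlag functions, so it is
  where the distance to its complement is positive. This distance is Lipschitz, and it is the
  envelope of 0 with slope 1.\<close>

lemma path_limit_measurable: "Y \<in> N \<rightarrow>\<^sub>M borel_of_top skorokhod_J1"
proof (rule measurable_borel_of_topI)
  show "\<omega> \<in> space N \<Longrightarrow> Y \<omega> \<in> topspace skorokhod_J1" for \<omega> using Y by (simp add: topspace_skorokhod_J1)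
  fix U :: "(real \<Rightarrow> 'a) set" assume U: "openin skorokhod_J1 U"
  show "{\<omega> \<in> space N. Y \<omega> \<in> U} \<in> sets N"
  proof (cases "cadlag_space - U = {}")
    case True
    then have "{\<omega> \<in> space N. Y \<omega> \<in> U} = space N" using Y by blast
    then show ?thesis by simp
  next
    case False
    define h where "h = lipschitz_env (\<lambda>_. 0) (cadlag_space - U) 1"
    note b = lipschitz_env_bounds[OF False, of "\<lambda>_. 0" 0 1, folded h_def, simplified]
    have "(\<lambda>\<omega>. h (Y \<omega>)) \<in> borel_measurable N"
      by (rule Ym[of h 1 1]) (use b(3,4) in auto)
    then have "{\<omega> \<in> space N. h (Y \<omega>) > 0} \<in> sets N" by measurable
    moreover have "Y \<omega> \<in> U \<longleftrightarrow> h (Y \<omega>) > 0" if w: "\<omega> \<in> space N" for \<omega>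
    proof
      assume "Y \<omega> \<in> U"
      from open_J1_path_dist[OF U this] obtain e where
        e: "e > 0" "\<And>y. y \<in> cadlag_space \<Longrightarrow> path_dist (Y \<omega>) y < e \<Longrightarrow> y \<in> U" by blast
      have "e \<le> h (Y \<omega>)" unfolding h_def lipschitz_env_def
        using False e(2) by (intro cINF_greatest) (auto simp: not_less[symmetric])
      then show "h (Y \<omega>) > 0" using e(1) by simp
    next
      assume "h (Y \<omega>) > 0"
      show "Y \<omega> \<in> U"
      proof (rule ccontr)
        assume "Y \<omega> \<notin> U"
        then have "h (Y \<omega>) \<le> path_dist (Y \<omega>) (Y \<omega>)" using b(2) Y[OF w] by auto
        then show False using \<open>h (Y \<omega>) > 0\<close> by (simp add: path_dist_self)
      qed
    qed
    ultimately show ?thesis by (simp cong: conj_cong)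
  qed
qed

text \<open>One half of a portmanteau argument: an envelope lies below \<open>f\<close>, its limit
  expectation is nearly that of \<open>f\<close>, and its expectations converge. The other half is
  the same statement for \<open>- f\<close>.\<close>

lemma expectation_lower_limit:
  fixes f :: "(real \<Rightarrow> 'a) \<Rightarrow> real"
  assumes f: "continuous_map skorokhod_J1 euclideanreal f" and b: "\<And>x. x \<in> cadlag_space \<Longrightarrow> \<bar>f x\<bar> \<le> b" and e: "e > 0"
  shows "\<forall>\<^sub>F n in sequentially. (\<integral>\<omega>. f (Y \<omega>) \<partial>N) - e < (\<integral>\<omega>. f (X n \<omega>) \<partial>M n)"
proof -
  interpret N: prob_space N by (rule N)
  have ne: "cadlag_space \<noteq> ({} :: (real \<Rightarrow> 'a) set)" using const_cadlag by blast
  define F where "F k = lipschitz_env f cadlag_space (real k)" for k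
  have F: "\<bar>F k x\<bar> \<le> b + real k" "\<bar>F k x - F k y\<bar> \<le> real k * path_dist x y" "- b \<le> F k x" for k x y
    unfolding F_def using lipschitz_env_bounds(1,3,4)[where b = b and k = "real k", OF ne b] by auto
  have Ff: "F k x \<le> f x" if "x \<in> cadlag_space" for k x
    using lipschitz_env_bounds(2)[where b = b and k = "real k" and x = x and y = x, OF ne b] that by (simp add: F_def path_dist_self)
  have fY: "(\<lambda>\<omega>. f (Y \<omega>)) \<in> borel_measurable N"
    using measurable_compose[OF path_limit_measurable continuous_map_measurable[OF f]] .
  have FY: "(\<lambda>\<omega>. F k (Y \<omega>)) \<in> borel_measurable N" for k
    by (rule Ym[of "F k" "b + real k" "real k"]) (use F in auto)
  have "(\<lambda>k. \<integral>\<omega>. F k (Y \<omega>) \<partial>N) \<longlonglongrightarrow> (\<integral>\<omega>. f (Y \<omega>) \<partial>N)"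
  proof (rule integral_dominated_convergence[where w = "\<lambda>_. b"])
    show "AE \<omega> in N. (\<lambda>k. F k (Y \<omega>)) \<longlonglongrightarrow> f (Y \<omega>)"
    proof (rule AE_I2)
      fix \<omega> assume w: "\<omega> \<in> space N"
      show "(\<lambda>k. F k (Y \<omega>)) \<longlonglongrightarrow> f (Y \<omega>)"
        unfolding F_def
      proof (rule lipschitz_env_tendsto[OF b Y[OF w]])
        fix e :: real assume "e > 0"
        have "openin skorokhod_J1 {x \<in> cadlag_space. f x \<in> {f (Y \<omega>) - e<..}}"
          using openin_continuous_map_preimage[OF f, of "{f (Y \<omega>) - e<..}"] by (simp add: topspace_skorokhod_J1)
        moreover have "Y \<omega> \<in> {x \<in> cadlag_space. f x \<in> {f (Y \<omega>) - e<..}}" using Y[OF w] \<open>e > 0\<close> by simp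
        ultimately obtain d where "d > 0" "\<And>y. y \<in> cadlag_space \<Longrightarrow> path_dist (Y \<omega>) y < d \<Longrightarrow> y \<in> {x \<in> cadlag_space. f x \<in> {f (Y \<omega>) - e<..}}"
          by (rule open_J1_path_dist) blast
        then show "\<exists>d>0. \<forall>y\<in>cadlag_space. path_dist (Y \<omega>) y < d \<longrightarrow> f (Y \<omega>) - e < f y"
          by (intro exI[of _ d]) auto
      qed
    qed
    show "AE \<omega> in N. norm (F k (Y \<omega>)) \<le> b" for k
    proof (rule AE_I2)
      fix \<omega> assume "\<omega> \<in> space N"
      then show "norm (F k (Y \<omega>)) \<le> b" using F(3)[of k "Y \<omega>"] Ff[OF Y, of \<omega> k] b[OF Y, of \<omega>] by auto
    qed
  qed (use fY FY in auto)
  then have "\<forall>\<^sub>F k in sequentially. (\<integral>\<omega>. f (Y \<omega>) \<partial>N) - e < (\<integral>\<omega>. F k (Y \<omega>) \<partial>N)"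
    using e by (intro order_tendstoD) auto
  then obtain k where k: "(\<integral>\<omega>. f (Y \<omega>) \<partial>N) - e < (\<integral>\<omega>. F k (Y \<omega>) \<partial>N)"
    by (auto simp: eventually_sequentially)
  have "(\<lambda>n. \<integral>\<omega>. F k (X n \<omega>) \<partial>M n) \<longlonglongrightarrow> (\<integral>\<omega>. F k (Y \<omega>) \<partial>N)"
    by (rule lim[of "F k" "b + real k" "real k"]) (use F in auto)
  from order_tendstoD(1)[OF this k] show ?thesis
  proof (rule eventually_mono)
    fix n assume "(\<integral>\<omega>. f (Y \<omega>) \<partial>N) - e < (\<integral>\<omega>. F k (X n \<omega>) \<partial>M n)"
    also have "\<dots> \<le> (\<integral>\<omega>. f (X n \<omega>) \<partial>M n)"
    proof -
      interpret P: prob_space "M n" by (rule M)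
      have XD: "X n \<omega> \<in> cadlag_space" if "\<omega> \<in> space (M n)" for \<omega>
        using measurable_space[OF X that] by (simp add: space_borel_of_top topspace_skorokhod_J1)
      show ?thesis
        by (intro integral_mono P.integrable_const_bound[where B = "b + real k"] P.integrable_const_bound[where B = b] Xm AE_I2)
          (use F Ff XD b in auto)
    qed
    finally show "(\<integral>\<omega>. f (Y \<omega>) \<partial>N) - e < (\<integral>\<omega>. f (X n \<omega>) \<partial>M n)" .
  qed
qed

lemma converges_in_distr_by_lipschitz: "converges_in_distr skorokhod_J1 M X N Y"
  unfolding converges_in_distr_def
proof (intro conjI allI impI X path_limit_measurable)
  fix f :: "(real \<Rightarrow> 'a) \<Rightarrow> real"
  assume f: "continuous_map skorokhod_J1 euclideanreal f \<and> bounded (f ` topspace skorokhod_J1)"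
  then obtain b where b: "\<And>x. x \<in> cadlag_space \<Longrightarrow> \<bar>f x\<bar> \<le> b"
    unfolding bounded_iff topspace_skorokhod_J1 by auto
  show "(\<lambda>n. \<integral>\<omega>. f (X n \<omega>) \<partial>M n) \<longlonglongrightarrow> (\<integral>\<omega>. f (Y \<omega>) \<partial>N)"
  proof (rule tendstoI)
    fix e :: real assume e: "e > 0"
    have "continuous_map skorokhod_J1 euclideanreal (\<lambda>x. - f x)" using f by (intro continuous_map_minus) auto
    from expectation_lower_limit[OF this, of b e] b e
    have "\<forall>\<^sub>F n in sequentially. (\<integral>\<omega>. - f (Y \<omega>) \<partial>N) - e < (\<integral>\<omega>. - f (X n \<omega>) \<partial>M n)" by simp
    moreover have "\<forall>\<^sub>F n in sequentially. (\<integral>\<omega>. f (Y \<omega>) \<partial>N) - e < (\<integral>\<omega>. f (X n \<omega>) \<partial>M n)"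
      using expectation_lower_limit[of f b e] f b e by simp
    ultimately show "\<forall>\<^sub>F n in sequentially. dist (\<integral>\<omega>. f (X n \<omega>) \<partial>M n) (\<integral>\<omega>. f (Y \<omega>) \<partial>N) < e"
      by eventually_elim (auto simp: dist_real_def)
  qed
qed

end

section \<open>The random walk of a code\<close>

text \<open>For negative \<open>x\<close> the bound comes from
  \<open>exp x \<le> 1 / (1 - x)\<close> and
  \<open>(1 + x + x\<^sup>2) * (1 - x) = 1 - x ^ 3 \<ge> 1\<close>.\<close>

lemma exp_le_quadratic: "\<bar>x\<bar> \<le> 1 \<Longrightarrow> exp x \<le> 1 + x + x\<^sup>2" for x :: real
proof (cases "x \<ge> 0")
  case False
  assume x: "\<bar>x\<bar> \<le> 1"
  have pos: "0 < 1 - x" using False by simp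
  have "1 - x \<le> exp (- x)" using exp_ge_add_one_self[of "- x"] by simp
  then have "exp x * (1 - x) \<le> exp x * exp (- x)" by (intro mult_left_mono) auto
  then have "exp x * (1 - x) \<le> 1" by (simp add: exp_minus)
  also have "1 \<le> (1 + x + x\<^sup>2) * (1 - x)"
  proof -
    have "(1 + x + x\<^sup>2) * (1 - x) = 1 - x ^ 3" by (simp add: algebra_simps power2_eq_square power3_eq_cube)
    moreover have "x ^ 3 \<le> 0" using False by (simp add: power3_eq_cube mult_nonneg_nonpos)
    ultimately show ?thesis by simp
  qed
  finally show ?thesis using pos by (simp only: mult_le_cancel_right_pos)
qed (use exp_bound in simp)

text \<open>The indicator of the letter 2 minus its probability 1/3: under a uniform letter it has
  mean 0 and variance 2/9.\<close>

definition xi :: "nat \<Rightarrow> real" where "xi y = (if y = 2 then 2 / 3 else - 1 / 3)"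

definition walk :: "(nat \<Rightarrow> nat) \<Rightarrow> nat \<Rightarrow> real" where "walk c k = (\<Sum>i\<in>{1..k}. xi (c i))"

lemma walk_eq: "walk c k = real (twos c k) - real k / 3"
  by (induction k) (simp_all add: walk_def twos_Suc xi_def field_simps)

lemma walk_diff: "walk c (a + k) - walk c a = (\<Sum>i\<in>{a<..a + k}. xi (c i))"
proof -
  have "{1..a + k} = {1..a} \<union> {a<..a + k}" "{1..a} \<inter> {a<..a + k} = {}" by auto
  then show ?thesis by (simp add: walk_def sum.union_disjoint)
qed

text \<open>The linear terms cancel and the quadratic ones add up to the variance 2/9, which is
  rounded up to 1/4. The factor 3 stems from summing over the letters instead of averaging.\<close>

lemma xi_mgf:
  assumes "\<bar>\<theta>\<bar> \<le> 1"
  shows "(\<Sum>y\<in>{0, 1, 2}. exp (\<theta> * xi y)) \<le> 3 * exp (\<theta>\<^sup>2 / 4)"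
proof -
  have "(\<Sum>y\<in>{0, 1, 2}. exp (\<theta> * xi y)) = 2 * exp (- \<theta> / 3) + exp (2 * \<theta> / 3)"
    by (simp add: xi_def)
  also have "\<dots> \<le> 2 * (1 + (- \<theta> / 3) + (- \<theta> / 3)\<^sup>2) + (1 + 2 * \<theta> / 3 + (2 * \<theta> / 3)\<^sup>2)"
    using assms by (intro add_mono mult_left_mono exp_le_quadratic) auto
  also have "\<dots> = 3 * (1 + 2 * \<theta>\<^sup>2 / 9)" by (simp add: power2_eq_square field_simps)
  also have "\<dots> \<le> 3 * (1 + \<theta>\<^sup>2 / 4)" by simp
  also have "\<dots> \<le> 3 * exp (\<theta>\<^sup>2 / 4)" by (intro mult_left_mono exp_ge_add_one_self) simp
  finally show ?thesis .
qed

text \<open>The supermartingale argument for the exponential maximal inequality is an induction that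
  conditions on the first letter.\<close>

lemma card_maximum_ge:
  assumes \<theta>: "\<bar>\<theta>\<bar> \<le> 1" and "finite I" "{a<..a + K} \<subseteq> I"
  shows "real (card {c \<in> I \<rightarrow>\<^sub>E {0, 1, 2}. \<exists>k\<le>K. L \<le> x + \<theta> * (\<Sum>i\<in>{a<..a + k}. xi (c i))})
     \<le> 3 ^ card I * exp (x - L) * exp (\<theta>\<^sup>2 / 4) ^ K"
  using assms(2,3)
proof (induction K arbitrary: a x I)
  case 0
  have "card {c \<in> I \<rightarrow>\<^sub>E {0, 1, 2 :: nat}. L \<le> x} \<le> (if L \<le> x then 3 ^ card I else 0)"
    using 0 by (simp add: card_PiE numeral_3_eq_3)
  then have "real (card {c \<in> I \<rightarrow>\<^sub>E {0, 1, 2 :: nat}. L \<le> x}) \<le> (if L \<le> x then 3 ^ card I else 0)"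
    by (simp split: if_splits flip: of_nat_le_iff)
  also have "\<dots> \<le> 3 ^ card I * exp (x - L)" by simp
  finally show ?case by simp
next
  case (Suc K)
  let ?E = "exp (\<theta>\<^sup>2 / 4)"
  let ?A = "{c \<in> I \<rightarrow>\<^sub>E {0, 1, 2}. \<exists>k\<le>Suc K. L \<le> x + \<theta> * (\<Sum>i\<in>{a<..a + k}. xi (c i))}"
  have E: "1 \<le> ?E ^ K'" for K' by (intro one_le_power) simp
  show ?case
  proof (cases "L \<le> x")
    case True
    have "card ?A \<le> card (I \<rightarrow>\<^sub>E {0, 1, 2 :: nat})" using Suc.prems by (intro card_mono finite_PiE) auto
    also have "\<dots> = 3 ^ card I" using Suc.prems by (simp add: card_PiE numeral_3_eq_3)
    finally have "real (card ?A) \<le> 3 ^ card I * 1 * 1" by (simp flip: of_nat_le_iff)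
    also have "\<dots> \<le> 3 ^ card I * exp (x - L) * ?E ^ Suc K" using True E[of "Suc K"] by (intro mult_mono) auto
    finally show ?thesis .
  next
    case False
    define J where "J = I - {Suc a}"
    have aI: "Suc a \<in> I" using Suc.prems(2) by auto
    have J: "finite J" "{Suc a<..Suc a + K} \<subseteq> J" using Suc.prems aI by (auto simp: J_def)
    have cardI: "card I = Suc (card J)" unfolding J_def by (rule card.remove[OF Suc.prems(1) aI])
    \<comment> \<open>The codes whose first relevant letter is \<open>y\<close>: that letter moves
      the start from \<open>x\<close> to \<open>x + \<theta> * xi y\<close>, and \<open>K\<close>
      letters remain.\<close>
    define B where "B y = {g \<in> J \<rightarrow>\<^sub>E {0, 1, 2}. \<exists>k\<le>K. L \<le> (x + \<theta> * xi y) + \<theta> * (\<Sum>i\<in>{Suc a<..Suc a + k}. xi (g i))}" for y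
    have finB: "finite (B y)" for y
      unfolding B_def using J(1) by (intro finite_subset[OF _ finite_PiE[of J "\<lambda>_. {0, 1, 2}"]]) auto
    have "?A \<subseteq> (\<Union>y\<in>{0, 1, 2}. (\<lambda>g. g(Suc a := y)) ` B y)"
    proof
      fix c assume "c \<in> ?A"
      then have c: "c \<in> I \<rightarrow>\<^sub>E {0, 1, 2}" and "\<exists>k\<le>Suc K. L \<le> x + \<theta> * (\<Sum>i\<in>{a<..a + k}. xi (c i))" by auto
      then obtain k where k: "k \<le> Suc K" "L \<le> x + \<theta> * (\<Sum>i\<in>{a<..a + k}. xi (c i))" by blast
      have "k \<noteq> 0" using k(2) False by (cases "k = 0") auto
      then obtain k' where k': "k = Suc k'" by (cases k) auto
      define g where "g = restrict c J"
      have "{a<..a + k} = insert (Suc a) {Suc a<..Suc a + k'}" using k' by auto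
      then have "(\<Sum>i\<in>{a<..a + k}. xi (c i)) = xi (c (Suc a)) + (\<Sum>i\<in>{Suc a<..Suc a + k'}. xi (c i))" by simp
      also have "(\<Sum>i\<in>{Suc a<..Suc a + k'}. xi (c i)) = (\<Sum>i\<in>{Suc a<..Suc a + k'}. xi (g i))"
      proof (intro sum.cong refl)
        fix i assume "i \<in> {Suc a<..Suc a + k'}"
        then have "i \<in> {Suc a<..Suc a + K}" using k(1) k' by auto
        then have "i \<in> J" using J(2) by blast
        then show "xi (c i) = xi (g i)" by (simp add: g_def)
      qed
      finally have "L \<le> (x + \<theta> * xi (c (Suc a))) + \<theta> * (\<Sum>i\<in>{Suc a<..Suc a + k'}. xi (g i))"
        using k(2) by (simp add: algebra_simps)
      moreover have "g i \<in> {0, 1, 2}" if "i \<in> J" for i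
        using PiE_mem[OF c, of i] that by (simp add: g_def J_def)
      then have "g \<in> J \<rightarrow>\<^sub>E {0, 1, 2}" unfolding g_def by (auto simp: restrict_PiE_iff)
      ultimately have "g \<in> B (c (Suc a))" unfolding B_def using k(1) k' by auto
      moreover have "c = g(Suc a := c (Suc a))"
      proof
        fix i show "c i = (g(Suc a := c (Suc a))) i"
          using PiE_arb[OF c, of i] by (auto simp: g_def J_def)
      qed
      moreover have "c (Suc a) \<in> {0, 1, 2}" by (rule PiE_mem[OF c aI])
      ultimately show "c \<in> (\<Union>y\<in>{0, 1, 2}. (\<lambda>g. g(Suc a := y)) ` B y)" by blast
    qed
    then have "card ?A \<le> card (\<Union>y\<in>{0, 1, 2}. (\<lambda>g. g(Suc a := y)) ` B y)"
      using finB by (intro card_mono) auto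
    also have "\<dots> \<le> (\<Sum>y\<in>{0, 1, 2}. card ((\<lambda>g. g(Suc a := y)) ` B y))" by (intro card_UN_le) auto
    also have "\<dots> \<le> (\<Sum>y\<in>{0, 1, 2}. card (B y))" using finB by (intro sum_mono card_image_le)
    finally have "real (card ?A) \<le> (\<Sum>y\<in>{0, 1, 2}. real (card (B y)))"
      by (simp only: of_nat_sum[symmetric] of_nat_le_iff)
    also have "\<dots> \<le> (\<Sum>y\<in>{0, 1, 2}. 3 ^ card J * exp (x + \<theta> * xi y - L) * ?E ^ K)"
      unfolding B_def by (intro sum_mono Suc.IH[OF J(1,2)])
    also have "\<dots> = 3 ^ card J * exp (x - L) * ?E ^ K * (\<Sum>y\<in>{0, 1, 2}. exp (\<theta> * xi y))"
    proof -
      have "exp (x + \<theta> * xi y - L) = exp (x - L) * exp (\<theta> * xi y)" for y by (simp add: exp_add[symmetric])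
      then show ?thesis unfolding sum_distrib_left by (intro sum.cong refl) simp
    qed
    also have "\<dots> \<le> 3 ^ card J * exp (x - L) * ?E ^ K * (3 * ?E)"
      using xi_mgf[OF \<theta>] by (intro mult_left_mono) auto
    also have "\<dots> = 3 ^ card I * exp (x - L) * ?E ^ Suc K" by (simp add: cardI)
    finally show ?thesis .
  qed
qed

text \<open>The maximal inequality for both signs of the slope, which is why it admits negative
  \<open>\<theta>\<close>.\<close>

lemma card_walk_oscillation:
  assumes \<theta>: "0 \<le> \<theta>" "\<theta> \<le> 1" and aK: "a + K \<le> n"
  shows "real (card {c \<in> codes n. \<exists>k\<le>K. L \<le> \<bar>walk c (a + k) - walk c a\<bar>}) \<le> 2 * 3 ^ n * exp (\<theta>\<^sup>2 * real K / 4 - \<theta> * L)"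
proof -
  define A where "A s = {c \<in> {1..n} \<rightarrow>\<^sub>E {0, 1, 2}. \<exists>k\<le>K. \<theta> * L \<le> 0 + s * \<theta> * (\<Sum>i\<in>{a<..a + k}. xi (c i))}" for s
  have A: "real (card (A s)) \<le> 3 ^ n * exp (\<theta>\<^sup>2 * real K / 4 - \<theta> * L)" if s: "s = 1 \<or> s = - 1" for s
  proof -
    have "real (card (A s)) \<le> 3 ^ card {1..n} * exp (0 - \<theta> * L) * exp ((s * \<theta>)\<^sup>2 / 4) ^ K"
      unfolding A_def using \<theta> aK s by (intro card_maximum_ge) auto
    also have "exp ((s * \<theta>)\<^sup>2 / 4) ^ K = exp (\<theta>\<^sup>2 * real K / 4)"
      using s by (auto simp: exp_of_nat_mult[symmetric] power_mult_distrib mult.commute)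
    also have "3 ^ card {1..n} * exp (0 - \<theta> * L) * exp (\<theta>\<^sup>2 * real K / 4) = 3 ^ n * exp (\<theta>\<^sup>2 * real K / 4 - \<theta> * L)"
    proof -
      have "exp (0 - \<theta> * L) * exp (\<theta>\<^sup>2 * real K / 4) = exp (\<theta>\<^sup>2 * real K / 4 - \<theta> * L)" by (simp add: mult_exp_exp)
      then show ?thesis by (simp only: mult.assoc card_atLeastAtMost diff_Suc_1)
    qed
    finally show ?thesis .
  qed
  have fin: "finite (A s)" for s using finite_codes(1)[of n] unfolding A_def codes_def by simp
  have "{c \<in> codes n. \<exists>k\<le>K. L \<le> \<bar>walk c (a + k) - walk c a\<bar>} \<subseteq> A 1 \<union> A (- 1)"
  proof
    fix c assume "c \<in> {c \<in> codes n. \<exists>k\<le>K. L \<le> \<bar>walk c (a + k) - walk c a\<bar>}"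
    then obtain k where c: "c \<in> codes n" "k \<le> K" "L \<le> \<bar>\<Sum>i\<in>{a<..a + k}. xi (c i)\<bar>" by (auto simp: walk_diff)
    let ?S = "\<Sum>i\<in>{a<..a + k}. xi (c i)"
    have "\<theta> * L \<le> \<theta> * \<bar>?S\<bar>" using c(3) \<theta> by (intro mult_left_mono)
    then have "\<theta> * L \<le> 0 + 1 * \<theta> * ?S \<or> \<theta> * L \<le> 0 + (- 1) * \<theta> * ?S" by (cases "?S \<ge> 0") auto
    then show "c \<in> A 1 \<union> A (- 1)" using c(1,2) unfolding A_def codes_def by blast
  qed
  then have "card {c \<in> codes n. \<exists>k\<le>K. L \<le> \<bar>walk c (a + k) - walk c a\<bar>} \<le> card (A 1 \<union> A (- 1))"
    using fin by (intro card_mono) auto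
  also have "\<dots> \<le> card (A 1) + card (A (- 1))" by (rule card_Un_le)
  finally show ?thesis using A[of 1] A[of "- 1"] by simp
qed

lemma measurable_finite_lipschitz:
  fixes F :: "(nat \<Rightarrow> real) \<Rightarrow> real"
  assumes F: "\<And>x y. \<bar>F x - F y\<bar> \<le> C * (\<Sum>i\<in>I. \<bar>x i - y i\<bar>)"
  shows "F \<in> borel_measurable (PiM UNIV (\<lambda>_. borel))" and "(\<And>i. i \<in> I \<Longrightarrow> (\<lambda>k. X k i) \<longlonglongrightarrow> x i) \<Longrightarrow> (\<lambda>k. F (X k)) \<longlonglongrightarrow> F x"
proof -
  have "continuous_on UNIV F"
  proof (rule continuous_at_imp_continuous_on, rule ballI)
    fix x :: "nat \<Rightarrow> real"
    have c: "isCont (\<lambda>y. y i) x" for i :: nat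
      by (rule continuous_on_eq_continuous_at[OF open_UNIV, THEN iffD1, OF continuous_on_product_coordinates, rule_format, OF UNIV_I])
    have "isCont (\<lambda>y. C * (\<Sum>i\<in>I. \<bar>y i - x i\<bar>)) x" by (intro continuous_intros c)
    then have "((\<lambda>y. C * (\<Sum>i\<in>I. \<bar>y i - x i\<bar>)) \<longlongrightarrow> C * (\<Sum>i\<in>I. \<bar>x i - x i\<bar>)) (at x)"
      unfolding isCont_def .
    then have "((\<lambda>y. C * (\<Sum>i\<in>I. \<bar>y i - x i\<bar>)) \<longlongrightarrow> 0) (at x)" by simp
    then have "((\<lambda>y. F y - F x) \<longlongrightarrow> 0) (at x)"
      by (rule Lim_null_comparison[rotated]) (use F in auto)
    then show "isCont F x" unfolding isCont_def by (rule LIM_zero_cancel)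
  qed
  then have "F \<in> borel_measurable borel" by (rule borel_measurable_continuous_onI)
  then show "F \<in> borel_measurable (PiM UNIV (\<lambda>_. borel))"
    \<comment> \<open>The index set is countable, so the product sigma-algebra consists of the Borel
      sets of the product topology.\<close>
    using measurable_cong_sets[OF sets_PiM_equal_borel refl] by blast
  assume "\<And>i. i \<in> I \<Longrightarrow> (\<lambda>k. X k i) \<longlonglongrightarrow> x i"
  then have "(\<lambda>k. C * (\<Sum>i\<in>I. \<bar>X k i - x i\<bar>)) \<longlonglongrightarrow> C * (\<Sum>i\<in>I. \<bar>x i - x i\<bar>)"
    by (intro tendsto_intros) auto
  then have "(\<lambda>k. C * (\<Sum>i\<in>I. \<bar>X k i - x i\<bar>)) \<longlonglongrightarrow> 0" by simp
  then have "(\<lambda>k. F (X k) - F x) \<longlonglongrightarrow> 0"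
    by (rule Lim_null_comparison[rotated]) (use F in auto)
  then show "(\<lambda>k. F (X k)) \<longlonglongrightarrow> F x" by (rule LIM_zero_cancel)
qed

text \<open>Under independence the joint law is the product of the marginals, so equal marginals
  give equal laws of any functional.\<close>

lemma indep_expectation_transfer:
  fixes X :: "'i \<Rightarrow> 'a \<Rightarrow> real" and Z :: "'i \<Rightarrow> 'b \<Rightarrow> real" and G :: "('i \<Rightarrow> real) \<Rightarrow> real"
  assumes M: "prob_space M" "prob_space.indep_vars M (\<lambda>_. borel) X I"
    and N: "prob_space N" "prob_space.indep_vars N (\<lambda>_. borel) Z I"
    and I: "I \<noteq> {}" and law: "\<And>i. i \<in> I \<Longrightarrow> distr M borel (X i) = distr N borel (Z i)"
    and G: "G \<in> borel_measurable (PiM I (\<lambda>_. borel))"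
  shows "(\<integral>\<omega>. G (\<lambda>i\<in>I. X i \<omega>) \<partial>M) = (\<integral>\<omega>. G (\<lambda>i\<in>I. Z i \<omega>) \<partial>N)"
    and "distr M borel (\<lambda>\<omega>. G (\<lambda>i\<in>I. X i \<omega>)) = distr N borel (\<lambda>\<omega>. G (\<lambda>i\<in>I. Z i \<omega>))"
proof -
  interpret M: prob_space M by fact
  interpret N: prob_space N by fact
  have X: "X i \<in> borel_measurable M" if "i \<in> I" for i using M(2) that by (auto simp: M.indep_vars_def)
  have Z: "Z i \<in> borel_measurable N" if "i \<in> I" for i using N(2) that by (auto simp: N.indep_vars_def)
  have MX: "(\<lambda>\<omega>. \<lambda>i\<in>I. X i \<omega>) \<in> M \<rightarrow>\<^sub>M PiM I (\<lambda>_. borel)" using X by (rule measurable_restrict)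
  have NZ: "(\<lambda>\<omega>. \<lambda>i\<in>I. Z i \<omega>) \<in> N \<rightarrow>\<^sub>M PiM I (\<lambda>_. borel)" using Z by (rule measurable_restrict)
  have "distr M (PiM I (\<lambda>_. borel)) (\<lambda>\<omega>. \<lambda>i\<in>I. X i \<omega>) = PiM I (\<lambda>i. distr M borel (X i))"
    using M.indep_vars_iff_distr_eq_PiM'[of I X "\<lambda>_. borel", OF I X] M(2) by blast
  also have "\<dots> = PiM I (\<lambda>i. distr N borel (Z i))" by (intro PiM_cong refl law)
  also have "\<dots> = distr N (PiM I (\<lambda>_. borel)) (\<lambda>\<omega>. \<lambda>i\<in>I. Z i \<omega>)"
    using N.indep_vars_iff_distr_eq_PiM'[of I Z "\<lambda>_. borel", OF I Z] N(2) by simp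
  finally have eq: "distr M (PiM I (\<lambda>_. borel)) (\<lambda>\<omega>. \<lambda>i\<in>I. X i \<omega>) = distr N (PiM I (\<lambda>_. borel)) (\<lambda>\<omega>. \<lambda>i\<in>I. Z i \<omega>)" .
  show "(\<integral>\<omega>. G (\<lambda>i\<in>I. X i \<omega>) \<partial>M) = (\<integral>\<omega>. G (\<lambda>i\<in>I. Z i \<omega>) \<partial>N)"
    using integral_distr[OF MX G] integral_distr[OF NZ G] eq by simp
  show "distr M borel (\<lambda>\<omega>. G (\<lambda>i\<in>I. X i \<omega>)) = distr N borel (\<lambda>\<omega>. G (\<lambda>i\<in>I. Z i \<omega>))"
    using distr_distr[OF G MX] distr_distr[OF G NZ] eq by (simp add: comp_def)
qed

lemma indep_vars_coordinates:
  assumes M: "\<And>i. prob_space (M i)" and I: "I \<noteq> {}"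
  shows "prob_space.indep_vars (PiM I M) M (\<lambda>i x. x i) I"
proof -
  interpret product_prob_space M I by (intro product_prob_spaceI M)
  interpret P: prob_space "PiM I M" by (rule prob_space_PiM[OF M])
  have "distr (PiM I M) (PiM I M) (\<lambda>x. \<lambda>i\<in>I. x i) = distr (PiM I M) (PiM I M) (\<lambda>x. x)"
    by (intro distr_cong refl) (auto simp: space_PiM PiE_def extensional_restrict)
  also have "\<dots> = PiM I M" by (rule distr_id)
  also have "\<dots> = PiM I (\<lambda>i. distr (PiM I M) (M i) (\<lambda>x. x i))"
    by (intro PiM_cong refl) (simp add: PiM_component)
  finally show ?thesis
    using P.indep_vars_iff_distr_eq_PiM'[of I "\<lambda>i x. x i" M, OF I measurable_component_singleton] by blast
qed

lemma (in prob_space) indep_vars_reindex: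
  assumes X: "indep_vars M' X I" and h: "inj_on h J" "h ` J \<subseteq> I"
  shows "indep_vars (\<lambda>j. M' (h j)) (\<lambda>j. X (h j)) J"
proof -
  have "indep_vars (\<lambda>j. PiM {h j} M') (\<lambda>j \<omega>. restrict (\<lambda>i. X i \<omega>) {h j}) J"
    using X h by (intro indep_vars_restrict[of M' X I]) (auto simp: disjoint_family_on_def inj_on_def)
  from indep_vars_compose2[OF this, of "\<lambda>j f. f (h j)" "\<lambda>j. M' (h j)"]
  show ?thesis by simp
qed

section \<open>The central limit theorem along blocks\<close>

definition letter_pmf :: "nat pmf" where "letter_pmf = pmf_of_set {0, 1, 2}"

definition step_law :: "real measure" where "step_law = distr (measure_pmf letter_pmf) borel xi"

abbreviation code_measure :: "nat \<Rightarrow> (nat \<Rightarrow> nat) measure" where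
  "code_measure n \<equiv> measure_pmf (pmf_of_set (codes n))"

abbreviation iid_steps :: "(nat \<Rightarrow> real) measure" where
  "iid_steps \<equiv> PiM UNIV (\<lambda>_. step_law)"

lemma codes_nonempty [simp]: "codes n \<noteq> {}"
  using card_codes[of n] by force

lemma sets_step_law [simp, measurable_cong]: "sets step_law = sets borel"
  by (simp add: step_law_def)

lemma prob_space_step_law: "prob_space step_law"
  unfolding step_law_def by (intro measure_pmf.prob_space_distr) simp

lemma codes_pmf: "pmf_of_set (codes n) = Pi_pmf {1..n} undefined (\<lambda>_. letter_pmf)"
proof -
  have "PiE_dflt {1..n} undefined (\<lambda>_. {0, 1, 2}) = codes n"
    unfolding PiE_dflt_def codes_def PiE_def Pi_def extensional_def by blast
  then show ?thesis unfolding letter_pmf_def by (subst Pi_pmf_of_set) auto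
qed

lemma indep_code_steps: "prob_space.indep_vars (code_measure n) (\<lambda>_. borel) (\<lambda>j c. xi (c j)) {1..n}"
  unfolding codes_pmf
  using prob_space.indep_vars_compose2[OF measure_pmf.prob_space_axioms
    indep_vars_Pi_pmf[of "{1..n}" undefined "\<lambda>_. letter_pmf"], of "\<lambda>_. xi" "\<lambda>_. borel"]
  by simp

lemma code_step_law:
  assumes "j \<in> {1..n}"
  shows "distr (code_measure n) borel (\<lambda>c. xi (c j)) = step_law"
proof -
  have "map_pmf (\<lambda>c. c j) (pmf_of_set (codes n)) = letter_pmf"
    unfolding codes_pmf using assms by (subst Pi_pmf_component) auto
  then have "distr (code_measure n) (count_space UNIV) (\<lambda>c. c j) = measure_pmf letter_pmf"
    by (simp flip: map_pmf_rep_eq)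
  then have "distr (distr (code_measure n) (count_space UNIV) (\<lambda>c. c j)) borel xi = step_law"
    by (simp add: step_law_def)
  then show ?thesis by (subst (asm) distr_distr) (auto simp: comp_def)
qed

lemma iid_step_law: "distr iid_steps borel (\<lambda>\<omega>. \<omega> i) = step_law"
proof -
  interpret product_prob_space "\<lambda>_. step_law" UNIV by (intro product_prob_spaceI prob_space_step_law)
  have "distr iid_steps borel (\<lambda>\<omega>. \<omega> i) = distr iid_steps step_law (\<lambda>\<omega>. \<omega> i)"
    by (intro distr_cong) auto
  also have "\<dots> = step_law" by (rule PiM_component) simp
  finally show ?thesis .
qed

lemma prob_space_iid: "prob_space iid_steps"
  by (intro prob_space_PiM prob_space_step_law)

lemma indep_iid: "prob_space.indep_vars iid_steps (\<lambda>_. borel) (\<lambda>i \<omega>. \<omega> i) UNIV"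
proof -
  have "prob_space.indep_vars iid_steps (\<lambda>_. step_law) (\<lambda>i \<omega>. \<omega> i) UNIV"
    by (rule indep_vars_coordinates) (auto simp: prob_space_step_law)
  from prob_space.indep_vars_compose2[OF prob_space_iid this, of "\<lambda>_ x. x" "\<lambda>_. borel"]
  show ?thesis by simp
qed

text \<open>The blocks change with \<open>n\<close>, while the central limit theorem speaks of one
  fixed sequence. In law, a block sum is a partial sum of that sequence, so the theorem applies to
  it.\<close>

lemma block_law:
  assumes B: "B \<subseteq> {1..n}" and k: "card B = k"
  shows "distr (code_measure n) borel (\<lambda>c. \<Sum>j\<in>B. xi (c j)) = distr iid_steps borel (\<lambda>\<omega>. \<Sum>i<k. \<omega> i)"
proof (cases "k = 0")
  case True
  have "finite B" using B finite_subset by blast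
  then have "B = {}" using True k by simp
  then show ?thesis
    using True by (simp add: prob_space.distr_const[OF prob_space_iid] measure_pmf.distr_const)
next
  case False
  have fin: "finite B" using B finite_subset by blast
  obtain h where h: "bij_betw h {..<k} B"
    using ex_bij_betw_nat_finite[OF fin] k by (auto simp: lessThan_atLeast0)
  define G :: "(nat \<Rightarrow> real) \<Rightarrow> real" where "G f = (\<Sum>i<k. f i)" for f
  have "distr (code_measure n) borel (\<lambda>c. G (\<lambda>i\<in>{..<k}. xi (c (h i)))) = distr iid_steps borel (\<lambda>\<omega>. G (\<lambda>i\<in>{..<k}. \<omega> i))"
  proof (rule indep_expectation_transfer(2))
    show "prob_space (code_measure n)" by (rule measure_pmf.prob_space_axioms)
    show "prob_space.indep_vars (code_measure n) (\<lambda>_. borel) (\<lambda>i c. xi (c (h i))) {..<k}"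
      using prob_space.indep_vars_reindex[OF measure_pmf.prob_space_axioms indep_code_steps, of h "{..<k}" n] h B
      by (simp add: bij_betw_def)
    show "prob_space iid_steps" by (rule prob_space_iid)
    show "prob_space.indep_vars iid_steps (\<lambda>_. borel) (\<lambda>i \<omega>. \<omega> i) {..<k}"
      by (rule prob_space.indep_vars_subset[OF prob_space_iid indep_iid]) simp
    show "{..<k} \<noteq> {}" using False by auto
    show "distr (code_measure n) borel (\<lambda>c. xi (c (h i))) = distr iid_steps borel (\<lambda>\<omega>. \<omega> i)" if "i \<in> {..<k}" for i
    proof -
      have "h i \<in> {1..n}" using bij_betwE[OF h] that B by blast
      then show ?thesis by (simp only: code_step_law iid_step_law)
    qed
    show "G \<in> borel_measurable (PiM {..<k} (\<lambda>_. borel))" unfolding G_def by measurable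
  qed
  moreover have "G (\<lambda>i\<in>{..<k}. xi (c (h i))) = (\<Sum>j\<in>B. xi (c j))" for c
    unfolding G_def using sum.reindex_bij_betw[OF h, of "\<lambda>j. xi (c j)"] by simp
  moreover have "G (\<lambda>i\<in>{..<k}. \<omega> i) = (\<Sum>i<k. \<omega> i)" for \<omega> unfolding G_def by simp
  ultimately show ?thesis by simp
qed

lemma integral_step_law:
  fixes f :: "real \<Rightarrow> real"
  assumes [measurable]: "f \<in> borel_measurable borel"
  shows "integrable step_law f" "(\<integral>x. f x \<partial>step_law) = (f (2 / 3) + 2 * f (- 1 / 3)) / 3"
proof -
  have "finite (set_pmf letter_pmf)" by (simp add: letter_pmf_def)
  then have "integrable (measure_pmf letter_pmf) (\<lambda>y. f (xi y))" by (rule integrable_measure_pmf_finite)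
  then show "integrable step_law f" unfolding step_law_def by (subst integrable_distr_eq) auto
  have "(\<integral>x. f x \<partial>step_law) = (\<integral>y. f (xi y) \<partial>letter_pmf)"
    unfolding step_law_def by (subst integral_distr) auto
  also have "\<dots> = (f (2 / 3) + 2 * f (- 1 / 3)) / 3"
    unfolding letter_pmf_def by (subst integral_pmf_of_set) (auto simp: xi_def)
  finally show "(\<integral>x. f x \<partial>step_law) = (f (2 / 3) + 2 * f (- 1 / 3)) / 3" .
qed

text \<open>Convergence in law is replaced by pointwise convergence of copies on another space, so
  that dominated convergence will handle functionals of several blocks.\<close>

lemma walk_skorohod:
  "\<exists>(\<Omega> :: real measure) (Z :: nat \<Rightarrow> real \<Rightarrow> real) (Y :: real \<Rightarrow> real). prob_space \<Omega> \<and>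
    (\<forall>k. Z k \<in> borel_measurable \<Omega>) \<and>
    (\<forall>k. distr \<Omega> borel (Z k) = distr iid_steps borel (\<lambda>\<omega>. (\<Sum>i<k. \<omega> i) / sqrt (real k * (2 / 9)))) \<and>
    Y \<in> \<Omega> \<rightarrow>\<^sub>M lborel \<and> distr \<Omega> borel Y = std_normal_distribution \<and> (\<forall>x\<in>space \<Omega>. (\<lambda>k. Z k x) \<longlonglongrightarrow> Y x)"
proof -
  interpret P: prob_space iid_steps by (rule prob_space_iid)
  have X [measurable]: "(\<lambda>\<omega>. \<omega> i) \<in> borel_measurable iid_steps" for i
    using indep_iid by (simp add: P.indep_vars_def)
  have tr: "integrable iid_steps (\<lambda>\<omega>. f (\<omega> i))" "P.expectation (\<lambda>\<omega>. f (\<omega> i)) = (f (2 / 3) + 2 * f (- 1 / 3)) / 3"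
    if f: "f \<in> borel_measurable borel" for f :: "real \<Rightarrow> real" and i
  proof -
    show "integrable iid_steps (\<lambda>\<omega>. f (\<omega> i))"
      using integrable_distr_eq[OF X f, of i] integral_step_law(1)[OF f] by (simp add: iid_step_law)
    show "P.expectation (\<lambda>\<omega>. f (\<omega> i)) = (f (2 / 3) + 2 * f (- 1 / 3)) / 3"
      using integral_distr[OF X f, of i] integral_step_law(2)[OF f] by (simp add: iid_step_law)
  qed
  define \<sigma> :: real where "\<sigma> = sqrt (2 / 9)"
  have \<sigma>: "\<sigma>\<^sup>2 = 2 / 9" "\<sigma> > 0" by (auto simp: \<sigma>_def)
  have mean: "P.expectation (\<lambda>\<omega>. \<omega> i) = 0" for i using tr(2)[of "\<lambda>x. x" i] by simp
  have "weak_conv_m (\<lambda>k. distr iid_steps borel (\<lambda>\<omega>. (\<Sum>i<k. \<omega> i) / sqrt (real k * \<sigma>\<^sup>2))) std_normal_distribution"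
  proof (rule P.central_limit_theorem_zero_mean)
    show "P.indep_vars (\<lambda>i. borel) (\<lambda>i \<omega>. \<omega> i) UNIV" by (rule indep_iid)
    show "P.expectation (\<lambda>\<omega>. \<omega> k) = 0" for k by (rule mean)
    show "integrable iid_steps (\<lambda>\<omega>. (\<omega> k)\<^sup>2)" for k using tr(1)[of "\<lambda>x. x\<^sup>2" k] by simp
    show "P.variance (\<lambda>\<omega>. \<omega> k) = \<sigma>\<^sup>2" for k
      unfolding mean using tr(2)[of "\<lambda>x. x\<^sup>2" k] by (simp add: \<sigma> power_divide)
    show "distr iid_steps borel (\<lambda>\<omega>. \<omega> k) = step_law" for k by (rule iid_step_law)
  qed (rule \<sigma>)
  then have w: "weak_conv_m (\<lambda>k. distr iid_steps borel (\<lambda>\<omega>. (\<Sum>i<k. \<omega> i) / sqrt (real k * (2 / 9)))) std_normal_distribution"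
    by (simp only: \<sigma>)
  have "real_distribution (distr iid_steps borel (\<lambda>\<omega>. (\<Sum>i<k. \<omega> i) / sqrt (real k * (2 / 9))))" for k
    by (intro P.real_distribution_distr) measurable
  from Skorohod[OF this real_dist_normal_dist w] show ?thesis .
qed

lemma scaled_block_law:
  fixes Z :: "nat \<Rightarrow> real \<Rightarrow> real"
  assumes B: "B \<subseteq> {1..n}" "card B = k"
    and Z: "Z k \<in> borel_measurable \<Omega>" "distr \<Omega> borel (Z k) = distr iid_steps borel (\<lambda>\<omega>. (\<Sum>i<k. \<omega> i) / sqrt (real k * (2 / 9)))"
  shows "distr (code_measure n) borel (\<lambda>c. (\<Sum>j\<in>B. xi (c j)) / s) = distr \<Omega> borel (\<lambda>x. sqrt (real k * (2 / 9)) / s * Z k x)"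
proof -
  have X [measurable]: "(\<lambda>\<omega>. \<omega> i) \<in> borel_measurable iid_steps" for i
    using indep_iid by (simp add: prob_space.indep_vars_def[OF prob_space_iid])
  have "distr (code_measure n) borel (\<lambda>c. (\<Sum>j\<in>B. xi (c j)) / s)
      = distr (distr (code_measure n) borel (\<lambda>c. \<Sum>j\<in>B. xi (c j))) borel (\<lambda>x. x / s)"
    by (subst distr_distr) (auto simp: comp_def)
  also have "\<dots> = distr iid_steps borel (\<lambda>\<omega>. (\<Sum>i<k. \<omega> i) / s)"
    unfolding block_law[OF B] by (subst distr_distr) (auto simp: comp_def)
  also have "\<dots> = distr iid_steps borel (\<lambda>\<omega>. sqrt (real k * (2 / 9)) / s * ((\<Sum>i<k. \<omega> i) / sqrt (real k * (2 / 9))))"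
    by (cases "k = 0") simp_all
  also have "\<dots> = distr (distr iid_steps borel (\<lambda>\<omega>. (\<Sum>i<k. \<omega> i) / sqrt (real k * (2 / 9)))) borel (\<lambda>x. sqrt (real k * (2 / 9)) / s * x)"
    by (subst distr_distr) (auto simp: comp_def)
  also have "\<dots> = distr \<Omega> borel (\<lambda>x. sqrt (real k * (2 / 9)) / s * Z k x)"
    unfolding Z(2)[symmetric] using Z(1) by (subst distr_distr) (auto simp: comp_def)
  finally show ?thesis .
qed

section \<open>Blocks of letters between grid times\<close>

definition zpath :: "nat \<Rightarrow> (nat \<Rightarrow> nat) \<Rightarrow> real \<Rightarrow> real" where
  "zpath n c t = walk c (nat \<lfloor>t * real n\<rfloor>) / sqrt (real n)"

definition on_grid :: "nat \<Rightarrow> (real \<Rightarrow> real) \<Rightarrow> real \<Rightarrow> real" where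
  "on_grid m z t = z (real (nat \<lfloor>t * real m\<rfloor>) / real m)"

text \<open>The number of letters read by the grid time \<open>l / m\<close>, rounded exactly as in
  \<open>zpath\<close>, so that grid values of the path are sums over whole blocks.\<close>

definition cut :: "nat \<Rightarrow> nat \<Rightarrow> nat \<Rightarrow> nat" where
  "cut m n l = nat \<lfloor>real l / real m * real n\<rfloor>"

lemma cut_bounds:
  "real (cut m n l) \<le> real l / real m * real n" "real l / real m * real n < real (cut m n l) + 1"
proof -
  have "0 \<le> real l / real m * real n" by simp
  then show "real (cut m n l) \<le> real l / real m * real n" "real l / real m * real n < real (cut m n l) + 1"
    unfolding cut_def by linarith+
qed

lemma cut_mono: "i \<le> j \<Longrightarrow> cut m n i \<le> cut m n j"
  unfolding cut_def by (intro nat_mono floor_mono mult_right_mono divide_right_mono) auto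

lemma cut_0 [simp]: "cut m n 0 = 0" and cut_top: "m \<noteq> 0 \<Longrightarrow> cut m n m = n"
  by (simp_all add: cut_def)

definition block :: "nat \<Rightarrow> nat \<Rightarrow> nat \<Rightarrow> nat set" where
  "block m n l = {cut m n l<..cut m n (Suc l)}"

lemma block_subset: "l < m \<Longrightarrow> block m n l \<subseteq> {1..n}"
  using cut_mono[of "Suc l" m m n] cut_top[of m n] by (auto simp: block_def)

lemma walk_cut: "walk c (cut m n i) = (\<Sum>l<i. \<Sum>j\<in>block m n l. xi (c j))"
proof (induction i)
  case (Suc i)
  have "cut m n (Suc i) = cut m n i + (cut m n (Suc i) - cut m n i)" using cut_mono[of i "Suc i" m n] by simp
  then have "walk c (cut m n (Suc i)) - walk c (cut m n i) = (\<Sum>j\<in>block m n i. xi (c j))"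
    using walk_diff[of c "cut m n i" "cut m n (Suc i) - cut m n i"] by (simp add: block_def)
  then show ?case using Suc by simp
qed (simp add: walk_def)

lemma grid_index: "t \<in> {0..1} \<Longrightarrow> nat \<lfloor>t * real m\<rfloor> \<le> m"
proof -
  assume t: "t \<in> {0..1}"
  then have "t * real m \<le> 1 * real m" by (intro mult_right_mono) auto
  then have "\<lfloor>t * real m\<rfloor> \<le> int m" by linarith
  then show ?thesis by simp
qed

lemma card_block: "\<bar>real (card (block m n l)) - real n / real m\<bar> \<le> 1"
proof -
  have "card (block m n l) = cut m n (Suc l) - cut m n l" by (simp add: block_def)
  then have "real (card (block m n l)) = real (cut m n (Suc l)) - real (cut m n l)"
    using cut_mono[of l "Suc l" m n] by (simp add: of_nat_diff)
  moreover have "real (Suc l) / real m * real n = real l / real m * real n + real n / real m"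
    by (simp add: add_divide_distrib algebra_simps)
  ultimately show ?thesis using cut_bounds[where m = m and n = n and l = l] cut_bounds[where m = m and n = n and l = "Suc l"] by linarith
qed

text \<open>A block has \<open>n / m\<close> letters up to an error of 1. So normalizing a block by
  its own length differs from normalizing by \<open>n\<close> by a convergent factor, and the blocks
  grow as the central limit theorem requires.\<close>

lemma card_block_limits:
  assumes m: "m > 0"
  shows "(\<lambda>n. sqrt (real (card (block m n l)) * (2 / 9)) / sqrt (real n)) \<longlonglongrightarrow> sqrt (2 / (9 * real m))"
    and "filterlim (\<lambda>n. card (block m n l)) at_top sequentially"
proof -
  have inv: "(\<lambda>n. 1 / real n) \<longlonglongrightarrow> 0" by (rule lim_1_over_n)
  have "(\<lambda>n. real (card (block m n l)) / real n - 1 / real m) \<longlonglongrightarrow> 0"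
  proof (rule Lim_null_comparison[OF _ inv])
    show "\<forall>\<^sub>F n in sequentially. norm (real (card (block m n l)) / real n - 1 / real m) \<le> 1 / real n"
    proof (rule eventually_mono[OF eventually_gt_at_top[of 0]])
      fix n :: nat assume n: "0 < n"
      have "real (card (block m n l)) / real n - 1 / real m = (real (card (block m n l)) - real n / real m) / real n"
        using n m by (simp add: field_simps)
      then show "norm (real (card (block m n l)) / real n - 1 / real m) \<le> 1 / real n"
        using card_block[of m n l] n by (simp add: abs_divide divide_right_mono)
    qed
  qed
  then have "(\<lambda>n. real (card (block m n l)) / real n) \<longlonglongrightarrow> 1 / real m" by (rule LIM_zero_cancel)
  then have "(\<lambda>n. sqrt (real (card (block m n l)) / real n * (2 / 9))) \<longlonglongrightarrow> sqrt (1 / real m * (2 / 9))"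
    by (intro tendsto_real_sqrt tendsto_mult tendsto_const)
  moreover have "sqrt (real (card (block m n l)) / real n * (2 / 9)) = sqrt (real (card (block m n l)) * (2 / 9)) / sqrt (real n)" for n
    by (simp flip: real_sqrt_divide)
  ultimately show "(\<lambda>n. sqrt (real (card (block m n l)) * (2 / 9)) / sqrt (real n)) \<longlonglongrightarrow> sqrt (2 / (9 * real m))"
    by (simp add: mult.commute)
  show "filterlim (\<lambda>n. card (block m n l)) at_top sequentially"
    unfolding filterlim_at_top
  proof
    fix C :: nat
    have "\<forall>\<^sub>F n in sequentially. n \<ge> (C + 1) * m" by (rule eventually_ge_at_top)
    then show "\<forall>\<^sub>F n in sequentially. C \<le> card (block m n l)"
    proof (rule eventually_mono)
      fix n assume "(C + 1) * m \<le> n"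
      then have "real (C + 1) * real m \<le> real n" by (metis of_nat_le_iff of_nat_mult)
      then have "real C + 1 \<le> real n / real m" using m by (simp add: field_simps)
      then show "C \<le> card (block m n l)" using card_block[of m n l] by linarith
    qed
  qed
qed

section \<open>Functionals of the rescaled walk\<close>

lemma codes_expectation: "(\<integral>c. g c \<partial>code_measure n) = sum g (codes n) / 3 ^ n" for g :: "_ \<Rightarrow> real"
  by (subst integral_pmf_of_set) (auto simp: card_codes)

text \<open>Scalar paths suffice, because the three coordinates of the limit are multiples of one
  process; \<open>triple\<close> is composed with the functional later.\<close>

locale path_functional =
  fixes H :: "(real \<Rightarrow> real) \<Rightarrow> real" and b K :: real
  assumes H_bound: "\<bar>H z\<bar> \<le> b" and H_lipschitz: "\<bar>H z - H z'\<bar> \<le> K * path_dist z z'"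
    and K_nonneg: "0 \<le> K"
begin

lemma H_cong: "(\<And>t. t \<in> {0..1} \<Longrightarrow> z t = z' t) \<Longrightarrow> H z = H z'"
proof -
  assume "\<And>t. t \<in> {0..1} \<Longrightarrow> z t = z' t"
  then have "path_dist z z' \<le> 0" by (intro path_dist_least) auto
  then have "path_dist z z' = 0" using path_dist_nonneg[of z z'] by simp
  then show ?thesis using H_lipschitz[of z z'] by simp
qed

text \<open>The functional of the step path with given increments. The intersection with
  \<open>{..<m}\<close> makes it depend on \<open>m\<close> coordinates even at times outside the
  unit interval.\<close>

definition of_increments :: "nat \<Rightarrow> (nat \<Rightarrow> real) \<Rightarrow> real" where
  "of_increments m x = H (\<lambda>t. \<Sum>l\<in>{..<m} \<inter> {..<nat \<lfloor>t * real m\<rfloor>}. x l)"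

lemma of_increments_lipschitz:
  "\<bar>of_increments m x - of_increments m y\<bar> \<le> K * (\<Sum>l\<in>{..<m}. \<bar>x l - y l\<bar>)"
proof -
  have "path_dist (\<lambda>t. \<Sum>l\<in>{..<m} \<inter> {..<nat \<lfloor>t * real m\<rfloor>}. x l) (\<lambda>t. \<Sum>l\<in>{..<m} \<inter> {..<nat \<lfloor>t * real m\<rfloor>}. y l)
    \<le> (\<Sum>l\<in>{..<m}. \<bar>x l - y l\<bar>)"
  proof (rule path_dist_least)
    fix t :: real
    let ?A = "{..<m} \<inter> {..<nat \<lfloor>t * real m\<rfloor>}"
    have "dist (sum x ?A) (sum y ?A) = \<bar>\<Sum>l\<in>?A. x l - y l\<bar>" by (simp add: dist_real_def sum_subtractf)
    also have "\<dots> \<le> (\<Sum>l\<in>?A. \<bar>x l - y l\<bar>)" by (rule sum_abs)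
    also have "\<dots> \<le> (\<Sum>l\<in>{..<m}. \<bar>x l - y l\<bar>)" by (intro sum_mono2) auto
    finally show "min 1 (dist (sum x ?A) (sum y ?A)) \<le> (\<Sum>l\<in>{..<m}. \<bar>x l - y l\<bar>)" by simp
  qed
  then have "K * path_dist (\<lambda>t. \<Sum>l\<in>{..<m} \<inter> {..<nat \<lfloor>t * real m\<rfloor>}. x l) (\<lambda>t. \<Sum>l\<in>{..<m} \<inter> {..<nat \<lfloor>t * real m\<rfloor>}. y l)
    \<le> K * (\<Sum>l\<in>{..<m}. \<bar>x l - y l\<bar>)" using K_nonneg by (rule mult_left_mono)
  then show ?thesis unfolding of_increments_def by (rule order.trans[OF H_lipschitz])
qed

lemma of_increments_cong: "(\<And>l. l < m \<Longrightarrow> x l = y l) \<Longrightarrow> of_increments m x = of_increments m y"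
  unfolding of_increments_def by (intro arg_cong[of _ _ H] ext sum.cong) auto

lemma of_increments_measurable: "of_increments m \<in> borel_measurable (PiM {..<m} (\<lambda>_. borel))"
proof -
  have e: "(\<lambda>x i. if i \<in> {..<m} then x i else 0 :: real) \<in> PiM {..<m} (\<lambda>_. borel) \<rightarrow>\<^sub>M PiM UNIV (\<lambda>_. borel)"
  proof (rule measurable_abs_UNIV)
    fix i show "(\<lambda>x. if i \<in> {..<m} then x i else 0 :: real) \<in> borel_measurable (PiM {..<m} (\<lambda>_. borel))"
      by (cases "i \<in> {..<m}") auto
  qed
  have "(\<lambda>x. of_increments m (\<lambda>i. if i \<in> {..<m} then x i else 0)) \<in> borel_measurable (PiM {..<m} (\<lambda>_. borel))"
    by (rule measurable_compose[OF e measurable_finite_lipschitz(1)[OF of_increments_lipschitz]])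
  also have "(\<lambda>x. of_increments m (\<lambda>i. if i \<in> {..<m} then x i else 0)) = of_increments m"
    by (intro ext of_increments_cong) auto
  finally show ?thesis .
qed

lemma on_grid_telescope:
  assumes m: "m > 0" and x: "\<And>i. i \<le> m \<Longrightarrow> z (real i / real m) = (\<Sum>l<i. x l)"
  shows "H (on_grid m z) = of_increments m x"
  unfolding of_increments_def
proof (rule H_cong)
  fix t :: real assume t: "t \<in> {0..1}"
  have i: "nat \<lfloor>t * real m\<rfloor> \<le> m" by (rule grid_index[OF t])
  then have "{..<m} \<inter> {..<nat \<lfloor>t * real m\<rfloor>} = {..<nat \<lfloor>t * real m\<rfloor>}" by auto
  then show "on_grid m z t = (\<Sum>l\<in>{..<m} \<inter> {..<nat \<lfloor>t * real m\<rfloor>}. x l)"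
    using x[OF i] by (simp add: on_grid_def)
qed

lemma grid_zpath:
  assumes "m > 0"
  shows "H (on_grid m (zpath n c)) = of_increments m (\<lambda>l\<in>{..<m}. (\<Sum>j\<in>block m n l. xi (c j)) / sqrt (real n))"
proof -
  have "H (on_grid m (zpath n c)) = of_increments m (\<lambda>l. (\<Sum>j\<in>block m n l. xi (c j)) / sqrt (real n))"
  proof (rule on_grid_telescope[OF assms])
    fix i
    have "zpath n c (real i / real m) = walk c (cut m n i) / sqrt (real n)" by (simp add: zpath_def cut_def)
    then show "zpath n c (real i / real m) = (\<Sum>l<i. (\<Sum>j\<in>block m n l. xi (c j)) / sqrt (real n))"
      by (simp add: walk_cut sum_divide_distrib)
  qed
  also have "\<dots> = of_increments m (\<lambda>l\<in>{..<m}. (\<Sum>j\<in>block m n l. xi (c j)) / sqrt (real n))"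
    by (rule of_increments_cong) simp
  finally show ?thesis .
qed

section \<open>Brownian motion on a grid\<close>

context
  fixes N :: "'v measure" and W :: "real \<Rightarrow> 'v \<Rightarrow> real"
  assumes W: "brownian_motion N W (2 / 9)"
begin

lemma N_prob: "prob_space N" using W by (simp only: brownian_motion_def)

lemma W_measurable: "t \<in> {0..1} \<Longrightarrow> W t \<in> borel_measurable N"
  using W unfolding brownian_motion_def by blast

lemma W_continuous: "\<omega> \<in> space N \<Longrightarrow> continuous_on {0..1} (\<lambda>t. W t \<omega>)"
  using W unfolding brownian_motion_def by blast

lemma grid_frac: "i \<le> m \<Longrightarrow> real i / real m \<in> {0..1}"
  by (cases "m = 0") (auto simp: field_simps)

lemma grid_W_measurable: "(\<lambda>\<omega>. H (on_grid m (\<lambda>t. W t \<omega>))) \<in> borel_measurable N"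
proof -
  \<comment> \<open>The index is capped at \<open>m\<close>, so that \<open>F\<close> depends on
    finitely many coordinates; within the unit interval the cap has no effect.\<close>
  define F where "F x = H (\<lambda>t. x (min m (nat \<lfloor>t * real m\<rfloor>)))" for x :: "nat \<Rightarrow> real"
  have lip: "\<bar>F x - F y\<bar> \<le> K * (\<Sum>i\<in>{..m}. \<bar>x i - y i\<bar>)" for x y
  proof -
    have "path_dist (\<lambda>t. x (min m (nat \<lfloor>t * real m\<rfloor>))) (\<lambda>t. y (min m (nat \<lfloor>t * real m\<rfloor>))) \<le> (\<Sum>i\<in>{..m}. \<bar>x i - y i\<bar>)"
    proof (rule path_dist_least)
      fix t :: real
      let ?i = "min m (nat \<lfloor>t * real m\<rfloor>)"
      have "\<bar>x ?i - y ?i\<bar> \<le> (\<Sum>i\<in>{..m}. \<bar>x i - y i\<bar>)" by (rule member_le_sum) auto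
      then show "min 1 (dist (x ?i) (y ?i)) \<le> (\<Sum>i\<in>{..m}. \<bar>x i - y i\<bar>)"
        by (simp add: dist_real_def min.coboundedI2)
    qed
    then have "K * path_dist (\<lambda>t. x (min m (nat \<lfloor>t * real m\<rfloor>))) (\<lambda>t. y (min m (nat \<lfloor>t * real m\<rfloor>))) \<le> K * (\<Sum>i\<in>{..m}. \<bar>x i - y i\<bar>)"
      using K_nonneg by (rule mult_left_mono)
    then show ?thesis unfolding F_def by (rule order.trans[OF H_lipschitz])
  qed
  have "(\<lambda>\<omega> i. if i \<le> m then W (real i / real m) \<omega> else 0) \<in> N \<rightarrow>\<^sub>M PiM UNIV (\<lambda>_. borel)"
  proof (rule measurable_abs_UNIV)
    fix i show "(\<lambda>\<omega>. if i \<le> m then W (real i / real m) \<omega> else 0) \<in> borel_measurable N"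
      by (cases "i \<le> m") (simp_all add: W_measurable[OF grid_frac])
  qed
  then have "(\<lambda>\<omega>. F (\<lambda>i. if i \<le> m then W (real i / real m) \<omega> else 0)) \<in> borel_measurable N"
    by (rule measurable_compose[OF _ measurable_finite_lipschitz(1)[OF lip]])
  also have "(\<lambda>\<omega>. F (\<lambda>i. if i \<le> m then W (real i / real m) \<omega> else 0)) = (\<lambda>\<omega>. H (on_grid m (\<lambda>t. W t \<omega>)))"
    unfolding F_def
  proof (intro ext H_cong)
    fix \<omega> and t :: real assume "t \<in> {0..1}"
    note i = grid_index[OF this, of m]
    show "(if min m (nat \<lfloor>t * real m\<rfloor>) \<le> m then W (real (min m (nat \<lfloor>t * real m\<rfloor>)) / real m) \<omega> else 0) = on_grid m (\<lambda>t. W t \<omega>) t"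
      by (simp only: on_grid_def min_absorb2[OF i] i if_True)
  qed
  finally show ?thesis .
qed

text \<open>A continuous path on a compact interval is uniformly continuous, so freezing it at the
  grid times is a uniformly small change.\<close>

lemma on_grid_W_tendsto:
  assumes w: "\<omega> \<in> space N"
  shows "(\<lambda>m. H (on_grid (Suc m) (\<lambda>t. W t \<omega>))) \<longlonglongrightarrow> H (\<lambda>t. W t \<omega>)"
proof -
  have "(\<lambda>m. path_dist (on_grid (Suc m) (\<lambda>t. W t \<omega>)) (\<lambda>t. W t \<omega>)) \<longlonglongrightarrow> 0"
  proof (rule tendstoI)
    fix e :: real assume e: "e > 0"
    have "uniformly_continuous_on {0..1} (\<lambda>t. W t \<omega>)"
      by (rule compact_uniformly_continuous[OF W_continuous[OF w] compact_Icc])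
    then obtain d where d: "d > 0" "\<And>s t. s \<in> {0..1} \<Longrightarrow> t \<in> {0..1} \<Longrightarrow> dist s t < d \<Longrightarrow> dist (W s \<omega>) (W t \<omega>) < e / 2"
      unfolding uniformly_continuous_on_def using e by (metis half_gt_zero)
    have "dist (path_dist (on_grid (Suc m) (\<lambda>t. W t \<omega>)) (\<lambda>t. W t \<omega>)) 0 < e" if m: "1 / real (Suc m) < d" for m
    proof -
      have "path_dist (on_grid (Suc m) (\<lambda>t. W t \<omega>)) (\<lambda>t. W t \<omega>) \<le> e / 2"
      proof (rule path_dist_least)
        fix t :: real assume t: "t \<in> {0..1}"
        define i where "i = nat \<lfloor>t * real (Suc m)\<rfloor>"
        have "0 \<le> t * real (Suc m)" using t by simp
        then have "real i \<le> t * real (Suc m)" "t * real (Suc m) < real i + 1" unfolding i_def by linarith+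
        then have "real i / real (Suc m) \<le> t" "t < real i / real (Suc m) + 1 / real (Suc m)"
          by (simp_all add: field_simps)
        then have "dist (real i / real (Suc m)) t < d" using m by (auto simp: dist_real_def)
        moreover have "real i / real (Suc m) \<in> {0..1}" unfolding i_def by (rule grid_frac[OF grid_index[OF t]])
        ultimately have "dist (W (real i / real (Suc m)) \<omega>) (W t \<omega>) < e / 2" using d(2) t by blast
        then show "min 1 (dist (on_grid (Suc m) (\<lambda>t. W t \<omega>) t) (W t \<omega>)) \<le> e / 2"
          unfolding on_grid_def i_def by simp
      qed
      then show ?thesis using e path_dist_nonneg[of "on_grid (Suc m) (\<lambda>t. W t \<omega>)" "\<lambda>t. W t \<omega>"] by simp
    qed
    moreover have "\<forall>\<^sub>F m in sequentially. 1 / real (Suc m) < d"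
      using order_tendstoD(2)[OF LIMSEQ_inverse_real_of_nat d(1)] by (simp add: inverse_eq_divide)
    ultimately show "\<forall>\<^sub>F m in sequentially. dist (path_dist (on_grid (Suc m) (\<lambda>t. W t \<omega>)) (\<lambda>t. W t \<omega>)) 0 < e"
      by (rule eventually_mono[rotated])
  qed
  then have "(\<lambda>m. K * path_dist (on_grid (Suc m) (\<lambda>t. W t \<omega>)) (\<lambda>t. W t \<omega>)) \<longlonglongrightarrow> K * 0"
    by (intro tendsto_mult tendsto_const)
  then have "(\<lambda>m. K * path_dist (on_grid (Suc m) (\<lambda>t. W t \<omega>)) (\<lambda>t. W t \<omega>)) \<longlonglongrightarrow> 0" by simp
  then have "(\<lambda>m. H (on_grid (Suc m) (\<lambda>t. W t \<omega>)) - H (\<lambda>t. W t \<omega>)) \<longlonglongrightarrow> 0"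
    by (rule Lim_null_comparison[rotated]) (auto intro!: always_eventually H_lipschitz)
  then show ?thesis by (rule LIM_zero_cancel)
qed

lemma H_W_measurable: "(\<lambda>\<omega>. H (\<lambda>t. W t \<omega>)) \<in> borel_measurable N"
  by (rule borel_measurable_LIMSEQ_real[OF on_grid_W_tendsto grid_W_measurable])

lemma on_grid_W_expectation: "(\<lambda>m. \<integral>\<omega>. H (on_grid (Suc m) (\<lambda>t. W t \<omega>)) \<partial>N) \<longlonglongrightarrow> (\<integral>\<omega>. H (\<lambda>t. W t \<omega>) \<partial>N)"
proof (rule integral_dominated_convergence[where w = "\<lambda>_. b"])
  interpret prob_space N by (rule N_prob)
  show "integrable N (\<lambda>_. b)" by simp
qed (auto intro: H_W_measurable grid_W_measurable on_grid_W_tendsto H_bound)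

text \<open>The path is the sum of its increments only where \<open>W 0\<close> vanishes, which
  holds almost everywhere; hence a statement about expectations.\<close>

lemma grid_W_increments:
  assumes m: "m > 0"
  shows "(\<integral>\<omega>. H (on_grid m (\<lambda>t. W t \<omega>)) \<partial>N)
    = (\<integral>\<omega>. of_increments m (\<lambda>l\<in>{..<m}. W (real (Suc l) / real m) \<omega> - W (real l / real m) \<omega>) \<partial>N)"
proof (rule integral_cong_AE)
  show "(\<lambda>\<omega>. H (on_grid m (\<lambda>t. W t \<omega>))) \<in> borel_measurable N" by (rule grid_W_measurable)
  have "(\<lambda>\<omega>. \<lambda>l\<in>{..<m}. W (real (Suc l) / real m) \<omega> - W (real l / real m) \<omega>) \<in> N \<rightarrow>\<^sub>M PiM {..<m} (\<lambda>_. borel)"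
    by (intro measurable_restrict borel_measurable_diff W_measurable grid_frac) auto
  then show "(\<lambda>\<omega>. of_increments m (\<lambda>l\<in>{..<m}. W (real (Suc l) / real m) \<omega> - W (real l / real m) \<omega>)) \<in> borel_measurable N"
    by (rule measurable_compose[OF _ of_increments_measurable])
  have "AE \<omega> in N. W 0 \<omega> = 0" using W by (simp only: brownian_motion_def)
  then show "AE \<omega> in N. H (on_grid m (\<lambda>t. W t \<omega>)) = of_increments m (\<lambda>l\<in>{..<m}. W (real (Suc l) / real m) \<omega> - W (real l / real m) \<omega>)"
  proof (rule AE_mp, intro AE_I2 impI)
    fix \<omega> assume "W 0 \<omega> = 0"
    moreover have "(\<Sum>l<i. W (real (Suc l) / real m) \<omega> - W (real l / real m) \<omega>) = W (real i / real m) \<omega> - W (real 0 / real m) \<omega>" for i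
      by (rule sum_lessThan_telescope)
    ultimately have "H (on_grid m (\<lambda>t. W t \<omega>)) = of_increments m (\<lambda>l. W (real (Suc l) / real m) \<omega> - W (real l / real m) \<omega>)"
      by (intro on_grid_telescope[OF m]) (simp only: of_nat_0 div_0 diff_zero)
    also have "\<dots> = of_increments m (\<lambda>l\<in>{..<m}. W (real (Suc l) / real m) \<omega> - W (real l / real m) \<omega>)"
      by (rule of_increments_cong) simp
    finally show "H (on_grid m (\<lambda>t. W t \<omega>)) = of_increments m (\<lambda>l\<in>{..<m}. W (real (Suc l) / real m) \<omega> - W (real l / real m) \<omega>)" .
  qed
qed

lemma W_increments_indep:
  "prob_space.indep_vars N (\<lambda>_. borel) (\<lambda>l \<omega>. W (real (Suc l) / real m) \<omega> - W (real l / real m) \<omega>) {..<m}"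
proof -
  have "mono_on {..m} (\<lambda>l. real l / real m) \<and> (\<lambda>l. real l / real m) ` {..m} \<subseteq> {0..1}"
    using grid_frac by (auto simp: mono_on_def intro!: divide_right_mono)
  then show ?thesis using W unfolding brownian_motion_def by blast
qed

lemma W_increment_law:
  assumes \<Omega>: "prob_space \<Omega>" and Y: "Y \<in> borel_measurable \<Omega>" "distr \<Omega> borel Y = std_normal_distribution"
    and l: "l < m"
  shows "distr N borel (\<lambda>\<omega>. W (real (Suc l) / real m) \<omega> - W (real l / real m) \<omega>) = distr \<Omega> borel (\<lambda>x. sqrt (2 / (9 * real m)) * Y x)"
proof -
  interpret O: prob_space \<Omega> by fact
  have sd: "real (Suc l) / real m - real l / real m = 1 / real m" using l by (simp add: field_simps)
  have "0 \<le> real l / real m \<and> real l / real m < real (Suc l) / real m \<and> real (Suc l) / real m \<le> 1"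
    using l by (simp add: field_simps)
  then have "distributed N lborel (\<lambda>\<omega>. W (real (Suc l) / real m) \<omega> - W (real l / real m) \<omega>) (normal_density 0 (sqrt (2 / 9 * (real (Suc l) / real m - real l / real m))))"
    using W unfolding brownian_motion_def by blast
  then have 1: "distr N lborel (\<lambda>\<omega>. W (real (Suc l) / real m) \<omega> - W (real l / real m) \<omega>) = density lborel (normal_density 0 (sqrt (2 / (9 * real m))))"
    unfolding sd by (simp add: distributed_distr_eq_density)
  have "distr \<Omega> lborel Y = distr \<Omega> borel Y" by (intro distr_cong) auto
  then have "distributed \<Omega> lborel Y std_normal_density"
    using Y by (simp add: distributed_def)
  from O.normal_density_affine[OF this, of "sqrt (2 / (9 * real m))" 0] l
  have "distributed \<Omega> lborel (\<lambda>x. sqrt (2 / (9 * real m)) * Y x) (normal_density 0 (sqrt (2 / (9 * real m))))"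
    by simp
  then have 2: "distr \<Omega> lborel (\<lambda>x. sqrt (2 / (9 * real m)) * Y x) = density lborel (normal_density 0 (sqrt (2 / (9 * real m))))"
    by (simp add: distributed_distr_eq_density)
  have "distr N borel (\<lambda>\<omega>. W (real (Suc l) / real m) \<omega> - W (real l / real m) \<omega>) = distr N lborel (\<lambda>\<omega>. W (real (Suc l) / real m) \<omega> - W (real l / real m) \<omega>)"
    by (intro distr_cong) auto
  also have "\<dots> = distr \<Omega> lborel (\<lambda>x. sqrt (2 / (9 * real m)) * Y x)" unfolding 1 2 ..
  also have "\<dots> = distr \<Omega> borel (\<lambda>x. sqrt (2 / (9 * real m)) * Y x)" by (intro distr_cong) auto
  finally show ?thesis .
qed

text \<open>Each block of letters gets an independent copy of the Skorohod representation of the central limit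
  theorem, so that the convergence becomes pointwise.\<close>

lemma finite_dimensional_limit:
  assumes m: "m > 0"
  shows "(\<lambda>n. \<integral>c. H (on_grid m (zpath n c)) \<partial>code_measure n) \<longlonglongrightarrow> (\<integral>\<omega>. H (on_grid m (\<lambda>t. W t \<omega>)) \<partial>N)"
proof -
  obtain \<Omega> :: "real measure" and Z :: "nat \<Rightarrow> real \<Rightarrow> real" and Y :: "real \<Rightarrow> real" where \<Omega>: "prob_space \<Omega>"
    and Z': "\<forall>k. Z k \<in> borel_measurable \<Omega>"
    and lawZ': "\<forall>k. distr \<Omega> borel (Z k) = distr iid_steps borel (\<lambda>\<omega>. (\<Sum>i<k. \<omega> i) / sqrt (real k * (2 / 9)))"
    and Y': "Y \<in> \<Omega> \<rightarrow>\<^sub>M lborel" and lawY: "distr \<Omega> borel Y = std_normal_distribution"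
    and ZY': "\<forall>x\<in>space \<Omega>. (\<lambda>k. Z k x) \<longlonglongrightarrow> Y x"
    using walk_skorohod by (elim exE conjE) (rule that)
  note Z = Z'[rule_format] and lawZ = lawZ'[rule_format] and ZY = ZY'[rule_format]
  have Y: "Y \<in> borel_measurable \<Omega>" using Y' by simp
  define S where "S = PiM {..<m} (\<lambda>_. \<Omega>)"
  have S: "prob_space S" unfolding S_def by (intro prob_space_PiM \<Omega>)
  interpret S: prob_space S by (rule S)
  have ne: "{..<m} \<noteq> {}" using m by auto
  have coord: "prob_space.indep_vars S (\<lambda>_. \<Omega>) (\<lambda>l x. x l) {..<m}"
    unfolding S_def by (rule indep_vars_coordinates[OF \<Omega> ne])
  have indS: "S.indep_vars (\<lambda>_. borel) (\<lambda>l x. f l (x l)) {..<m}" if "\<And>l. f l \<in> borel_measurable \<Omega>" for f :: "nat \<Rightarrow> real \<Rightarrow> real"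
    by (rule S.indep_vars_compose2[OF coord]) (rule that)
  have component: "distr S \<Omega> (\<lambda>x. x l) = \<Omega>" if "l < m" for l
  proof -
    interpret product_prob_space "\<lambda>_. \<Omega>" "{..<m}" by (intro product_prob_spaceI \<Omega>)
    show ?thesis unfolding S_def using that by (intro PiM_component) simp
  qed
  have lawS: "distr S borel (\<lambda>x. f (x l)) = distr \<Omega> borel f" if "l < m" "f \<in> borel_measurable \<Omega>" for f :: "real \<Rightarrow> real" and l
  proof -
    have "(\<lambda>x. x l) \<in> S \<rightarrow>\<^sub>M \<Omega>" unfolding S_def using that(1) by (intro measurable_component_singleton) simp
    then have "distr (distr S \<Omega> (\<lambda>x. x l)) borel f = distr S borel (\<lambda>x. f (x l))"
      by (subst distr_distr[OF that(2)]) (simp_all add: comp_def)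
    then show ?thesis by (simp only: component[OF that(1)])
  qed
  define k where "k n l = card (block m n l)" for n l
  \<comment> \<open>Converts the normalization by the standard deviation of a block into the one by
    \<open>sqrt (real n)\<close>.\<close>
  define r where "r n l = sqrt (real (k n l) * (2 / 9)) / sqrt (real n)" for n l
  define V where "V n x = (\<lambda>l\<in>{..<m}. r n l * Z (k n l) (x l))" for n x
  define V' where "V' x = (\<lambda>l\<in>{..<m}. sqrt (2 / (9 * real m)) * Y (x l))" for x
  have rZ: "(\<lambda>y. r n l * Z (k n l) y) \<in> borel_measurable \<Omega>" for n l using Z by measurable
  have rY: "(\<lambda>y. sqrt (2 / (9 * real m)) * Y y) \<in> borel_measurable \<Omega>" using Y by measurable
  \<comment> \<open>The coordinates of \<open>V n\<close> are independent with the laws of the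
    scaled block sums; those of \<open>V'\<close> in turn have the laws of the Brownian increments.
    So both expectations move to the single space \<open>S\<close>.\<close>
  have 1: "(\<integral>c. H (on_grid m (zpath n c)) \<partial>code_measure n) = (\<integral>x. of_increments m (V n x) \<partial>S)" for n
    unfolding grid_zpath[OF m] V_def
  proof (rule indep_expectation_transfer(1)[OF measure_pmf.prob_space_axioms _ S indS ne])
    have "prob_space.indep_vars (code_measure n) (\<lambda>l. PiM (block m n l) (\<lambda>_. borel)) (\<lambda>l c. \<lambda>j\<in>block m n l. xi (c j)) {..<m}"
    proof (rule prob_space.indep_vars_restrict[OF measure_pmf.prob_space_axioms indep_code_steps])
      show "l \<in> {..<m} \<Longrightarrow> block m n l \<subseteq> {1..n}" for l by (rule block_subset) simp
      show "disjoint_family_on (block m n) {..<m}"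
        unfolding disjoint_family_on_def
      proof (intro ballI impI)
        fix i j :: nat assume "i \<noteq> j"
        then have "Suc i \<le> j \<or> Suc j \<le> i" by auto
        then show "block m n i \<inter> block m n j = {}"
          using cut_mono[of "Suc i" j m n] cut_mono[of "Suc j" i m n] by (auto simp: block_def)
      qed
    qed
    from prob_space.indep_vars_compose2[OF measure_pmf.prob_space_axioms this, of "\<lambda>l f. (\<Sum>j\<in>block m n l. f j) / sqrt (real n)" "\<lambda>_. borel"]
    have "prob_space.indep_vars (code_measure n) (\<lambda>_. borel) (\<lambda>l c. (\<Sum>j\<in>block m n l. (\<lambda>j\<in>block m n l. xi (c j)) j) / sqrt (real n)) {..<m}"
      by measurable
    then show "prob_space.indep_vars (code_measure n) (\<lambda>_. borel) (\<lambda>l c. (\<Sum>j\<in>block m n l. xi (c j)) / sqrt (real n)) {..<m}"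
      by (simp cong: sum.cong)
    show "(\<lambda>y. r n l * Z (k n l) y) \<in> borel_measurable \<Omega>" for l by (rule rZ)
    show "distr (code_measure n) borel (\<lambda>c. (\<Sum>j\<in>block m n l. xi (c j)) / sqrt (real n)) = distr S borel (\<lambda>x. r n l * Z (k n l) (x l))"
      if "l \<in> {..<m}" for l
    proof -
      have l: "l < m" using that by simp
      have "distr (code_measure n) borel (\<lambda>c. (\<Sum>j\<in>block m n l. xi (c j)) / sqrt (real n)) = distr \<Omega> borel (\<lambda>y. r n l * Z (k n l) y)"
        unfolding r_def by (rule scaled_block_law[where k = "k n l" and Z = Z, OF block_subset[OF l] k_def[symmetric] Z lawZ])
      then show ?thesis by (simp only: lawS[OF l rZ])
    qed
  qed (rule of_increments_measurable)
  have 2: "(\<integral>\<omega>. H (on_grid m (\<lambda>t. W t \<omega>)) \<partial>N) = (\<integral>x. of_increments m (V' x) \<partial>S)"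
    unfolding grid_W_increments[OF m] V'_def
  proof (rule indep_expectation_transfer(1)[OF N_prob W_increments_indep S indS ne])
    show "(\<lambda>y. sqrt (2 / (9 * real m)) * Y y) \<in> borel_measurable \<Omega>" by (rule rY)
    show "distr N borel (\<lambda>\<omega>. W (real (Suc l) / real m) \<omega> - W (real l / real m) \<omega>) = distr S borel (\<lambda>x. sqrt (2 / (9 * real m)) * Y (x l))"
      if "l \<in> {..<m}" for l
      using that W_increment_law[OF \<Omega> Y lawY, of l m] lawS[OF _ rY, of l] by simp
  qed (rule of_increments_measurable)
  have coordM: "(\<lambda>x. x l) \<in> S \<rightarrow>\<^sub>M \<Omega>" if "l < m" for l
    unfolding S_def using that by (intro measurable_component_singleton) simp
  have VM: "V n \<in> S \<rightarrow>\<^sub>M PiM {..<m} (\<lambda>_. borel)" for n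
    unfolding V_def
  proof (rule measurable_restrict)
    fix l assume "l \<in> {..<m}"
    then have "l < m" by simp
    show "(\<lambda>x. r n l * Z (k n l) (x l)) \<in> borel_measurable S" by (rule measurable_compose[OF coordM[OF \<open>l < m\<close>] rZ])
  qed
  have V'M: "V' \<in> S \<rightarrow>\<^sub>M PiM {..<m} (\<lambda>_. borel)"
    unfolding V'_def
  proof (rule measurable_restrict)
    fix l assume "l \<in> {..<m}"
    then have "l < m" by simp
    show "(\<lambda>x. sqrt (2 / (9 * real m)) * Y (x l)) \<in> borel_measurable S" by (rule measurable_compose[OF coordM[OF \<open>l < m\<close>] rY])
  qed
  have "(\<lambda>n. \<integral>x. of_increments m (V n x) \<partial>S) \<longlonglongrightarrow> (\<integral>x. of_increments m (V' x) \<partial>S)"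
  proof (rule integral_dominated_convergence[where w = "\<lambda>_. b"])
    show "AE x in S. (\<lambda>n. of_increments m (V n x)) \<longlonglongrightarrow> of_increments m (V' x)"
    proof (rule AE_I2)
      fix x assume x: "x \<in> space S"
      show "(\<lambda>n. of_increments m (V n x)) \<longlonglongrightarrow> of_increments m (V' x)"
      proof (rule measurable_finite_lipschitz(2)[OF of_increments_lipschitz])
        fix l assume l: "l \<in> {..<m}"
        then have xl: "x l \<in> space \<Omega>" using x unfolding S_def space_PiM by (rule_tac PiE_mem)
        have "(\<lambda>n. r n l * Z (k n l) (x l)) \<longlonglongrightarrow> sqrt (2 / (9 * real m)) * Y (x l)"
          unfolding r_def k_def
          by (intro tendsto_mult card_block_limits(1)[OF m] filterlim_compose[OF ZY[OF xl] card_block_limits(2)[OF m]])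
        then show "(\<lambda>n. V n x l) \<longlonglongrightarrow> V' x l" using l by (simp add: V_def V'_def)
      qed
    qed
    show "integrable S (\<lambda>_. b)" by simp
    show "AE x in S. norm (of_increments m (V n x)) \<le> b" for n
      unfolding of_increments_def by (rule AE_I2) (simp add: H_bound)
  qed (use measurable_compose[OF VM of_increments_measurable] measurable_compose[OF V'M of_increments_measurable] in auto)
  then show ?thesis by (simp only: 1 2)
qed

end

end

section \<open>From the grid to the whole path\<close>

context path_functional
begin

text \<open>The exceptional codes of one grid cell. The window \<open>n div m + 1\<close> bounds the
  number of letters from the cut to any time of the cell, rounding included, and the minimum keeps
  it inside the code.\<close>

definition oscillating :: "nat \<Rightarrow> nat \<Rightarrow> real \<Rightarrow> nat \<Rightarrow> (nat \<Rightarrow> nat) set" where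
  "oscillating m n e i = {c \<in> codes n. \<exists>k\<le>min (n div m + 1) (n - cut m n i).
     e * sqrt (real n) \<le> \<bar>walk c (cut m n i + k) - walk c (cut m n i)\<bar>}"

lemma card_oscillating:
  assumes m: "0 < m" "m \<le> n" and e: "0 < e" "e * real m \<le> sqrt (real n)" and i: "i \<le> m"
  shows "real (card (oscillating m n e i)) \<le> 2 * 3 ^ n * exp (- (e\<^sup>2) / 2) ^ m"
proof -
  \<comment> \<open>The exponent \<open>\<theta>\<^sup>2 * k / 4 - \<theta> * L\<close> with
    \<open>L = e * sqrt n\<close> and \<open>k\<close> about \<open>2 * n / m\<close> is minimal for
    this value, where it equals \<open>- m * e\<^sup>2 / 2\<close>. The assumption on
    \<open>sqrt (real n)\<close> ensures \<open>\<theta> \<le> 1\<close>.\<close>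
  define \<theta> where "\<theta> = e * real m / sqrt (real n)"
  define k where "k = min (n div m + 1) (n - cut m n i)"
  have n: "0 < real n" using m by simp
  have \<theta>: "0 \<le> \<theta>" "\<theta> \<le> 1" using e n by (auto simp: \<theta>_def)
  have "cut m n i \<le> n" using cut_mono[OF i, of m n] cut_top[of m n] m by simp
  then have "cut m n i + k \<le> n" by (simp add: k_def)
  from card_walk_oscillation[OF \<theta> this]
  have "real (card (oscillating m n e i)) \<le> 2 * 3 ^ n * exp (\<theta>\<^sup>2 * real k / 4 - \<theta> * (e * sqrt (real n)))"
    unfolding oscillating_def k_def .
  also have "\<theta>\<^sup>2 * real k / 4 - \<theta> * (e * sqrt (real n)) \<le> real m * (- (e\<^sup>2) / 2)"
  proof -
    have "real (n div m) \<le> real n / real m" by (rule of_nat_div_le_of_nat)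
    moreover have "1 \<le> real n / real m" using m by simp
    moreover have "real k \<le> real (n div m) + 1" by (simp add: k_def)
    ultimately have "real k \<le> 2 * (real n / real m)" by linarith
    then have "\<theta>\<^sup>2 * real k / 4 \<le> \<theta>\<^sup>2 * (2 * (real n / real m)) / 4" by (intro divide_right_mono mult_left_mono) auto
    also have "\<dots> = real m * (e\<^sup>2 / 2)"
      using n m by (simp add: \<theta>_def power_divide power_mult_distrib power2_eq_square field_simps)
    finally have "\<theta>\<^sup>2 * real k / 4 \<le> real m * (e\<^sup>2 / 2)" .
    moreover have "\<theta> * (e * sqrt (real n)) = real m * e\<^sup>2"
      using n by (simp add: \<theta>_def power2_eq_square)
    ultimately show ?thesis by (simp add: field_simps)
  qed
  finally have "real (card (oscillating m n e i)) \<le> 2 * 3 ^ n * exp (real m * (- (e\<^sup>2) / 2))" by simp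
  then show ?thesis by (simp only: exp_of_nat_mult)
qed

lemma grid_approximation:
  assumes m: "0 < m" and n: "0 < n" and c: "c \<in> codes n" and good: "\<And>i. i \<le> m \<Longrightarrow> c \<notin> oscillating m n e i"
  shows "path_dist (zpath n c) (on_grid m (zpath n c)) \<le> e"
proof (rule path_dist_least)
  fix t :: real assume t: "t \<in> {0..1}"
  define i where "i = nat \<lfloor>t * real m\<rfloor>"
  define j where "j = nat \<lfloor>t * real n\<rfloor>"
  have im: "i \<le> m" unfolding i_def by (rule grid_index[OF t])
  have jn: "j \<le> n" unfolding j_def by (rule grid_index[OF t])
  have "0 \<le> t * real m" "0 \<le> t * real n" using t by simp_all
  then have ti: "real i \<le> t * real m" "t * real m < real i + 1" and tj: "real j \<le> t * real n"
    unfolding i_def j_def by linarith+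
  have it: "real i / real m \<le> t" "t \<le> real i / real m + 1 / real m" using ti m by (simp_all add: field_simps)
  have "real i / real m * real n \<le> t * real n" using it(1) by (intro mult_right_mono) auto
  then have aj: "cut m n i \<le> j" unfolding cut_def j_def by (intro nat_mono floor_mono)
  have "t * real n \<le> (real i / real m + 1 / real m) * real n" using it(2) by (intro mult_right_mono) auto
  then have "real j \<le> real i / real m * real n + real n / real m" using tj by (simp add: algebra_simps)
  then have "real j < real (cut m n i) + 1 + real n / real m"
    using cut_bounds(2)[where m = m and n = n and l = i] by linarith
  moreover have "real n / real m < real (n div m) + 1"
  proof -
    have "n < m * (n div m + 1)" using m by (simp add: dividend_less_times_div)
    then have "real n < real m * (real (n div m) + 1)" by (metis of_nat_1 of_nat_add of_nat_less_iff of_nat_mult)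
    then show ?thesis using m by (simp add: pos_divide_less_eq mult.commute)
  qed
  ultimately have "real j < real (cut m n i + (n div m + 2))" by simp
  then have "j < cut m n i + (n div m + 2)" by (simp only: of_nat_less_iff)
  then have k: "j - cut m n i \<le> min (n div m + 1) (n - cut m n i)" using jn by auto
  have "\<not> e * sqrt (real n) \<le> \<bar>walk c (cut m n i + (j - cut m n i)) - walk c (cut m n i)\<bar>"
    using good[OF im] c k unfolding oscillating_def by blast
  then have "\<bar>walk c j - walk c (cut m n i)\<bar> < e * sqrt (real n)" using aj by simp
  then have "\<bar>walk c j / sqrt (real n) - walk c (cut m n i) / sqrt (real n)\<bar> \<le> e"
    using n by (simp add: diff_divide_distrib[symmetric] abs_divide pos_divide_le_eq less_imp_le)
  moreover have "on_grid m (zpath n c) t = walk c (cut m n i) / sqrt (real n)"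
    by (simp add: on_grid_def zpath_def cut_def i_def)
  moreover have "zpath n c t = walk c j / sqrt (real n)" by (simp add: zpath_def j_def)
  ultimately show "min 1 (dist (zpath n c t) (on_grid m (zpath n c) t)) \<le> e"
    by (simp add: dist_real_def min.coboundedI2)
qed

text \<open>Off the exceptional codes the Lipschitz bound applies, on them only the bound
  \<open>2 * b\<close>. The union over the \<open>m + 1\<close> grid times costs a factor that the
  exponential decay in \<open>m\<close> outweighs.\<close>

lemma grid_error:
  assumes m: "0 < m" "m \<le> n" and e: "0 < e" "e * real m \<le> sqrt (real n)"
  shows "\<bar>(\<integral>c. H (zpath n c) \<partial>code_measure n) - (\<integral>c. H (on_grid m (zpath n c)) \<partial>code_measure n)\<bar>
    \<le> K * e + 4 * b * (real m + 1) * exp (- (e\<^sup>2) / 2) ^ m"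
proof -
  have b: "0 \<le> b" using H_bound[of "\<lambda>_. 0"] by linarith
  have one: "\<bar>H (zpath n c) - H (on_grid m (zpath n c))\<bar> \<le> K * e + 2 * b * (\<Sum>i\<le>m. indicat_real (oscillating m n e i) c)"
    if c: "c \<in> codes n" for c
  proof (cases "\<exists>i\<le>m. c \<in> oscillating m n e i")
    case True
    then obtain i where i: "i \<le> m" "c \<in> oscillating m n e i" by blast
    have "indicat_real (oscillating m n e i) c \<le> (\<Sum>i\<le>m. indicat_real (oscillating m n e i) c)"
      using i by (intro member_le_sum) auto
    then have "2 * b * 1 \<le> 2 * b * (\<Sum>i\<le>m. indicat_real (oscillating m n e i) c)"
      using b i by (intro mult_left_mono) auto
    moreover have "\<bar>H (zpath n c) - H (on_grid m (zpath n c))\<bar> \<le> 2 * b"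
      using H_bound[of "zpath n c"] H_bound[of "on_grid m (zpath n c)"] by linarith
    moreover have "0 \<le> K * e" using K_nonneg e by simp
    ultimately show ?thesis by linarith
  next
    case False
    then have "path_dist (zpath n c) (on_grid m (zpath n c)) \<le> e" using m c by (intro grid_approximation) auto
    then have "K * path_dist (zpath n c) (on_grid m (zpath n c)) \<le> K * e" using K_nonneg by (rule mult_left_mono)
    moreover have "0 \<le> 2 * b * (\<Sum>i\<le>m. indicat_real (oscillating m n e i) c)" using b by (intro mult_nonneg_nonneg sum_nonneg) auto
    ultimately show ?thesis using H_lipschitz[of "zpath n c" "on_grid m (zpath n c)"] by linarith
  qed
  have "\<bar>(\<Sum>c\<in>codes n. H (zpath n c)) - (\<Sum>c\<in>codes n. H (on_grid m (zpath n c)))\<bar>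
      \<le> (\<Sum>c\<in>codes n. \<bar>H (zpath n c) - H (on_grid m (zpath n c))\<bar>)"
    unfolding sum_subtractf[symmetric] by (rule sum_abs)
  also have "\<dots> \<le> (\<Sum>c\<in>codes n. K * e + 2 * b * (\<Sum>i\<le>m. indicat_real (oscillating m n e i) c))"
    by (intro sum_mono one)
  also have "\<dots> = 3 ^ n * (K * e) + 2 * b * (\<Sum>i\<le>m. \<Sum>c\<in>codes n. indicat_real (oscillating m n e i) c)"
    by (simp add: sum.distrib card_codes sum_distrib_left[symmetric] sum.swap[of _ "codes n"])
  also have "(\<Sum>i\<le>m. \<Sum>c\<in>codes n. indicat_real (oscillating m n e i) c) \<le> (\<Sum>i\<le>m. 2 * 3 ^ n * exp (- (e\<^sup>2) / 2) ^ m)"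
  proof (intro sum_mono)
    fix i assume i: "i \<in> {..m}"
    have "oscillating m n e i \<subseteq> codes n" by (auto simp: oscillating_def)
    then have "(\<Sum>c\<in>codes n. indicat_real (oscillating m n e i) c) = real (card (oscillating m n e i))"
      by (simp add: indicator_def sum.If_cases Int_absorb1)
    then show "(\<Sum>c\<in>codes n. indicat_real (oscillating m n e i) c) \<le> 2 * 3 ^ n * exp (- (e\<^sup>2) / 2) ^ m"
      using card_oscillating[OF m e, of i] i by simp
  qed
  also have "(\<Sum>i\<le>m. 2 * 3 ^ n * exp (- (e\<^sup>2) / 2) ^ m) = 3 ^ n * (2 * (real m + 1) * exp (- (e\<^sup>2) / 2) ^ m)"
    by (simp add: algebra_simps)
  finally have "\<bar>(\<Sum>c\<in>codes n. H (zpath n c)) - (\<Sum>c\<in>codes n. H (on_grid m (zpath n c)))\<bar>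
      \<le> 3 ^ n * (K * e) + 2 * b * (3 ^ n * (2 * (real m + 1) * exp (- (e\<^sup>2) / 2) ^ m))"
    using b by (simp add: mult_left_mono)
  also have "\<dots> = 3 ^ n * (K * e + 4 * b * (real m + 1) * exp (- (e\<^sup>2) / 2) ^ m)" by (simp add: algebra_simps)
  finally have "\<bar>(\<Sum>c\<in>codes n. H (zpath n c)) - (\<Sum>c\<in>codes n. H (on_grid m (zpath n c)))\<bar> / 3 ^ n
      \<le> K * e + 4 * b * (real m + 1) * exp (- (e\<^sup>2) / 2) ^ m"
    by (simp add: pos_divide_le_eq mult.commute)
  then show ?thesis unfolding codes_expectation by (simp add: diff_divide_distrib[symmetric] abs_divide)
qed

text \<open>The order of choices matters: first \<open>e\<close> for the Lipschitz term, then
  \<open>m\<close> for the exceptional codes and for the grid error of Brownian motion, and finally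
  \<open>n\<close> for the limit at fixed \<open>m\<close>.\<close>

lemma codes_limit:
  assumes W: "brownian_motion N W (2 / 9)"
  shows "(\<lambda>n. sum (\<lambda>c. H (zpath n c)) (codes n) / 3 ^ n) \<longlonglongrightarrow> (\<integral>\<omega>. H (\<lambda>t. W t \<omega>) \<partial>N)"
proof (rule tendstoI)
  fix \<epsilon> :: real assume \<epsilon>: "\<epsilon> > 0"
  define e where "e = \<epsilon> / (4 * (K + 1))"
  have e: "e > 0" "K * e < \<epsilon> / 4 + \<epsilon> / 100"
  proof -
    show "e > 0" using \<epsilon> K_nonneg by (simp add: e_def)
    have "K * e \<le> (K + 1) * e" using \<open>e > 0\<close> by (intro mult_right_mono) auto
    also have "\<dots> = \<epsilon> / 4"
    proof -
      have "K + 1 \<noteq> 0" using K_nonneg by linarith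
      then show ?thesis by (simp add: e_def divide_simps)
    qed
    finally show "K * e < \<epsilon> / 4 + \<epsilon> / 100" using \<epsilon> by simp
  qed
  define x where "x = exp (- (e\<^sup>2) / 2)"
  have x: "norm x < 1" using e by (simp add: x_def)
  have "(\<lambda>m. 4 * b * (real m * x ^ m + x ^ m)) \<longlonglongrightarrow> 4 * b * (0 + 0)"
    by (intro tendsto_intros powser_times_n_limit_0 LIMSEQ_power_zero x)
  then have "(\<lambda>m. 4 * b * (real m * x ^ m + x ^ m)) \<longlonglongrightarrow> 0" by simp
  then have "(\<lambda>m. 4 * b * (real (Suc m) * x ^ Suc m + x ^ Suc m)) \<longlonglongrightarrow> 0" by (rule LIMSEQ_Suc)
  then have 1: "\<forall>\<^sub>F m in sequentially. 4 * b * (real (Suc m) * x ^ Suc m + x ^ Suc m) < \<epsilon> / 4"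
    using \<epsilon> by (intro order_tendstoD) auto
  have 2: "\<forall>\<^sub>F m in sequentially. dist (\<integral>\<omega>. H (on_grid (Suc m) (\<lambda>t. W t \<omega>)) \<partial>N) (\<integral>\<omega>. H (\<lambda>t. W t \<omega>) \<partial>N) < \<epsilon> / 8"
    using tendstoD[OF on_grid_W_expectation[OF W], of "\<epsilon> / 8"] \<epsilon> by simp
  from eventually_conj[OF 1 2] obtain m' where
    m': "4 * b * (real (Suc m') * x ^ Suc m' + x ^ Suc m') < \<epsilon> / 4"
      "dist (\<integral>\<omega>. H (on_grid (Suc m') (\<lambda>t. W t \<omega>)) \<partial>N) (\<integral>\<omega>. H (\<lambda>t. W t \<omega>) \<partial>N) < \<epsilon> / 8"
    unfolding eventually_sequentially by blast
  define m where "m = Suc m'"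
  have m: "0 < m" "4 * b * (real m + 1) * x ^ m < \<epsilon> / 4"
      "dist (\<integral>\<omega>. H (on_grid m (\<lambda>t. W t \<omega>)) \<partial>N) (\<integral>\<omega>. H (\<lambda>t. W t \<omega>) \<partial>N) < \<epsilon> / 8"
    using m' by (simp_all add: m_def algebra_simps)
  have 3: "\<forall>\<^sub>F n in sequentially. dist (\<integral>c. H (on_grid m (zpath n c)) \<partial>code_measure n) (\<integral>\<omega>. H (on_grid m (\<lambda>t. W t \<omega>)) \<partial>N) < \<epsilon> / 8"
    using tendstoD[OF finite_dimensional_limit[OF W m(1)], of "\<epsilon> / 8"] \<epsilon> by simp
  have "filterlim (\<lambda>n. sqrt (real n)) at_top sequentially"
    by (rule filterlim_compose[OF sqrt_at_top filterlim_real_sequentially])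
  then have 4: "\<forall>\<^sub>F n in sequentially. e * real m \<le> sqrt (real n)" by (simp add: filterlim_at_top)
  show "\<forall>\<^sub>F n in sequentially. dist (sum (\<lambda>c. H (zpath n c)) (codes n) / 3 ^ n) (\<integral>\<omega>. H (\<lambda>t. W t \<omega>) \<partial>N) < \<epsilon>"
    using 3 4 eventually_ge_at_top[of m]
  proof eventually_elim
    case (elim n)
    have "\<bar>(\<integral>c. H (zpath n c) \<partial>code_measure n) - (\<integral>c. H (on_grid m (zpath n c)) \<partial>code_measure n)\<bar>
      \<le> K * e + 4 * b * (real m + 1) * x ^ m"
      unfolding x_def by (rule grid_error[OF m(1) elim(3) e(1) elim(2)])
    then have "\<bar>sum (\<lambda>c. H (zpath n c)) (codes n) / 3 ^ n - (\<integral>c. H (on_grid m (zpath n c)) \<partial>code_measure n)\<bar>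
      < \<epsilon> / 4 + \<epsilon> / 100 + \<epsilon> / 4" using e(2) m(2) unfolding codes_expectation[of n "\<lambda>c. H (zpath n c)"] by linarith
    then show ?case using elim(1) m(3) \<epsilon> unfolding dist_real_def by linarith
  qed
qed

end

section \<open>Letter counts in terms of the walk\<close>

definition sig_count :: "nat \<Rightarrow> (nat \<Rightarrow> nat) \<Rightarrow> nat \<Rightarrow> nat \<Rightarrow> nat" where
  "sig_count n v k j = card {i\<in>{1..j}. signature n v i = k}"

lemma sig_count_Suc: "sig_count n v k (Suc j) = sig_count n v k j + (if signature n v (Suc j) = k then 1 else 0)"
proof -
  have "{i\<in>{1..Suc j}. signature n v i = k} = (if signature n v (Suc j) = k then insert (Suc j) {i\<in>{1..j}. signature n v i = k} else {i\<in>{1..j}. signature n v i = k})"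
    by (auto simp: le_Suc_eq)
  then show ?thesis by (simp add: sig_count_def)
qed

lemma letter_count_eq: "letter_count n v k x = real (sig_count n v k (nat \<lfloor>x\<rfloor>))"
  by (simp add: letter_count_def sig_count_def)

text \<open>The last identity is the telescoped recursion of the states. It expresses the
  alternation of the letters 0 and 2.\<close>

lemma sig_count_code_word:
  fixes a :: nat
  assumes c: "c \<in> codes n" and j: "j \<le> n"
  defines "F \<equiv> sig_count n (code_word n a c)"
  shows "F 1 j + twos c j = j" "F 0 j + F 2 j = twos c j" "F 2 j + code_state a c 0 = F 0 j + code_state a c j"
proof -
  have "F 1 j + twos c j = j \<and> F 0 j + F 2 j = twos c j \<and> F 2 j + code_state a c 0 = F 0 j + code_state a c j"
    using j
  proof (induction j)
    case 0
    show ?case by (simp add: F_def sig_count_def)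
  next
    case (Suc j)
    then have k: "Suc j \<in> {1..n}" by simp
    have IH: "F 1 j + twos c j = j" "F 0 j + F 2 j = twos c j" "F 2 j + code_state a c 0 = F 0 j + code_state a c j"
      using Suc by simp_all
    have s: "signature n (code_word n a c) (Suc j) + code_state a c j = 1 + code_state a c (Suc j)"
      using code_word_step[OF c k, of a] by (simp add: signature_def)
    have st: "code_state a c (Suc j) = (if c (Suc j) = 2 then 1 - code_state a c j else code_state a c j)"
      using code_state_step[of "Suc j" a c] by simp
    show ?case
      using IH s st code_state_le[of a c j] unfolding F_def sig_count_Suc twos_Suc
      by (cases "code_state a c j") (auto split: if_splits)
  qed
  then show "F 1 j + twos c j = j" "F 0 j + F 2 j = twos c j" "F 2 j + code_state a c 0 = F 0 j + code_state a c j" by auto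
qed

text \<open>The counts of 0 and 2 add up to the number of letters 2 of the code and differ by at
  most 1. So twice either of them is that number up to 1, and \<open>2 * (j / 6)\<close> is its mean
  \<open>j / 3\<close>.\<close>

lemma counts_near_walk:
  fixes a :: nat
  assumes c: "c \<in> codes n" and j: "j \<le> n"
  defines "F \<equiv> \<lambda>k. real (sig_count n (code_word n a c) k j)"
  shows "\<bar>2 * (F 0 - real j / 6) - walk c j\<bar> \<le> 1" "2 * (F 1 - 2 * real j / 3) = - 2 * walk c j"
    "\<bar>2 * (F 2 - real j / 6) - walk c j\<bar> \<le> 1"
proof -
  note s = sig_count_code_word[OF c j, of a]
  have 1: "F 1 + real (twos c j) = real j" "F 0 + F 2 = real (twos c j)"
    unfolding F_def using s(1,2) by (simp_all flip: of_nat_add)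
  have "real (sig_count n (code_word n a c) 2 j + code_state a c 0) = real (sig_count n (code_word n a c) 0 j + code_state a c j)"
    using s(3) by simp
  then have 2: "F 2 + real (code_state a c 0) = F 0 + real (code_state a c j)" by (simp add: F_def)
  have 3: "real (code_state a c 0) \<le> 1" "real (code_state a c j) \<le> 1" "0 \<le> real (code_state a c 0)" "0 \<le> real (code_state a c j)"
    using code_state_le by (simp_all add: of_nat_le_1_iff)
  have "2 * (F 0 - real j / 6) - walk c j = real (code_state a c 0) - real (code_state a c j)"
    "2 * (F 2 - real j / 6) - walk c j = real (code_state a c j) - real (code_state a c 0)"
    using 1 2 by (simp_all add: walk_eq algebra_simps)
  then show "\<bar>2 * (F 0 - real j / 6) - walk c j\<bar> \<le> 1" "\<bar>2 * (F 2 - real j / 6) - walk c j\<bar> \<le> 1"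
    using 3 by (simp_all add: abs_le_iff)
  show "2 * (F 1 - 2 * real j / 3) = - 2 * walk c j" using 1(1) by (simp add: walk_eq algebra_simps)
qed

definition count_path :: "nat \<Rightarrow> (nat \<Rightarrow> nat) \<Rightarrow> real \<Rightarrow> real \<times> real \<times> real" where
  "count_path n w = (\<lambda>c\<in>{0..1}. (2 / sqrt (real n)) *\<^sub>R
     (letter_count n w 0 (c * real n) - c * real n / 6,
      letter_count n w 1 (c * real n) - 2 * c * real n / 3,
      letter_count n w 2 (c * real n) - c * real n / 6))"

definition triple :: "(real \<Rightarrow> real) \<Rightarrow> real \<Rightarrow> real \<times> real \<times> real" where
  "triple z = (\<lambda>c\<in>{0..1}. (z c, - 2 * z c, z c))"

lemma count_path_cadlag: "count_path n w \<in> cadlag_space"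
proof -
  have "count_path n w = (\<lambda>t\<in>{0..1}. (\<lambda>j t. (2 / sqrt (real n)) *\<^sub>R
     (real (sig_count n w 0 j) - t * real n / 6, real (sig_count n w 1 j) - 2 * t * real n / 3, real (sig_count n w 2 j) - t * real n / 6)) (nat \<lfloor>t * real n\<rfloor>) t)"
    by (simp add: count_path_def letter_count_eq)
  also have "\<dots> \<in> cadlag_space" by (rule cadlag_step) (intro continuous_intros; simp)
  finally show ?thesis .
qed

lemma dist_triple: "dist (x1, x2, x3) (y1, y2, y3) \<le> \<bar>x1 - y1\<bar> + \<bar>x2 - y2\<bar> + \<bar>x3 - y3\<bar>" for x1 x2 x3 y1 y2 y3 :: real
proof -
  have "norm (x1 - y1, x2 - y2, x3 - y3) \<le> norm (x1 - y1) + norm (x2 - y2, x3 - y3)" by (rule norm_Pair_le)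
  also have "norm (x2 - y2, x3 - y3) \<le> norm (x2 - y2) + norm (x3 - y3)" by (rule norm_Pair_le)
  finally show ?thesis by (simp add: dist_norm)
qed

lemma count_path_near:
  assumes c: "c \<in> codes n" and n: "n > 0"
  shows "path_dist (count_path n (code_word n a c)) (triple (zpath n c)) \<le> 6 / sqrt (real n)"
proof (rule path_dist_least)
  fix t :: real assume t: "t \<in> {0..1}"
  define j where "j = nat \<lfloor>t * real n\<rfloor>"
  have j: "j \<le> n" unfolding j_def by (rule grid_index[OF t])
  have "0 \<le> t * real n" using t by simp
  then have tj: "real j \<le> t * real n" "t * real n < real j + 1" unfolding j_def by linarith+
  define F where "F k = real (sig_count n (code_word n a c) k j)" for k
  note near = counts_near_walk[OF c j, of a, folded F_def]
  define s where "s = 1 / sqrt (real n)"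
  have s: "0 \<le> s" by (simp add: s_def)
  have sc: "\<bar>2 / sqrt (real n) * x - y / sqrt (real n)\<bar> = s * \<bar>2 * x - y\<bar>" for x y
  proof -
    have "2 / sqrt (real n) * x - y / sqrt (real n) = s * (2 * x - y)" by (simp add: s_def algebra_simps)
    then show ?thesis using s by (simp add: abs_mult)
  qed
  have "dist (count_path n (code_word n a c) t) (triple (zpath n c) t)
     \<le> \<bar>2 / sqrt (real n) * (F 0 - t * real n / 6) - walk c j / sqrt (real n)\<bar>
     + \<bar>2 / sqrt (real n) * (F 1 - 2 * t * real n / 3) - (- 2 * walk c j) / sqrt (real n)\<bar>
     + \<bar>2 / sqrt (real n) * (F 2 - t * real n / 6) - walk c j / sqrt (real n)\<bar>"
  proof -
    have "count_path n (code_word n a c) t = (2 / sqrt (real n) * (F 0 - t * real n / 6), 2 / sqrt (real n) * (F 1 - 2 * t * real n / 3), 2 / sqrt (real n) * (F 2 - t * real n / 6))"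
      using t by (simp add: count_path_def letter_count_eq F_def j_def)
    moreover have "triple (zpath n c) t = (walk c j / sqrt (real n), (- 2 * walk c j) / sqrt (real n), walk c j / sqrt (real n))"
      using t by (simp add: triple_def zpath_def j_def)
    ultimately show ?thesis by (simp only: dist_triple)
  qed
  \<comment> \<open>Per coordinate, the alternation contributes at most 1, and replacing
    \<open>j\<close> by \<open>t * real n\<close> contributes at most 1/3 in the outer coordinates
    and 4/3 in the middle one. Together this is at most 2.\<close>
  also have "\<dots> \<le> s * 2 + s * 2 + s * 2"
  proof -
    define T where "T = t * real n"
    have T: "real j \<le> T" "T < real j + 1" using tj by (simp_all add: T_def)
    have "\<bar>2 * (F 0 - T / 6) - walk c j\<bar> \<le> 2" "\<bar>2 * (F 2 - T / 6) - walk c j\<bar> \<le> 2"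
      using near(1,3) T by (simp_all add: abs_le_iff field_simps)
    moreover have "\<bar>2 * (F 1 - 2 * T / 3) - (- 2 * walk c j)\<bar> \<le> 2"
      using near(2) T by (simp add: abs_le_iff field_simps)
    moreover have "2 * t * real n = 2 * T" by (simp add: T_def)
    ultimately show ?thesis unfolding sc T_def[symmetric] by (intro add_mono mult_left_mono s) simp_all
  qed
  finally show "min 1 (dist (count_path n (code_word n a c) t) (triple (zpath n c) t)) \<le> 6 / sqrt (real n)"
    by (simp add: s_def min.coboundedI2)
qed

lemma triple_lipschitz: "path_dist (triple z) (triple z') \<le> 4 * path_dist z z'"
proof (rule path_dist_least)
  fix t :: real assume t: "t \<in> {0..1}"
  have "dist (triple z t) (triple z' t) \<le> \<bar>z t - z' t\<bar> + \<bar>- 2 * z t - (- 2 * z' t)\<bar> + \<bar>z t - z' t\<bar>"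
    using t unfolding triple_def by (simp only: restrict_apply if_True dist_triple)
  also have "\<dots> = 4 * dist (z t) (z' t)" by (auto simp: dist_real_def abs_if)
  finally have "min 1 (dist (triple z t) (triple z' t)) \<le> 4 * min 1 (dist (z t) (z' t))" by (auto simp: min_def)
  also have "\<dots> \<le> 4 * path_dist z z'" using path_dist_upper[OF t, of z z'] by simp
  finally show "min 1 (dist (triple z t) (triple z' t)) \<le> 4 * path_dist z z'" .
qed

text \<open>Meant for a code and its image under \<open>flip\<close>: changing the parity moves the
  rescaled path by a vanishing amount.\<close>

lemma zpath_twos:
  assumes "\<And>j. \<bar>int (twos c' j) - int (twos c j)\<bar> \<le> 1"
  shows "path_dist (zpath n c) (zpath n c') \<le> 1 / sqrt (real n)"
proof (rule path_dist_least)
  fix t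
  let ?j = "nat \<lfloor>t * real n\<rfloor>"
  have "real_of_int \<bar>int (twos c' ?j) - int (twos c ?j)\<bar> \<le> 1" using assms[of ?j] by linarith
  then have "\<bar>walk c ?j - walk c' ?j\<bar> \<le> 1" by (simp add: walk_eq)
  then have "\<bar>walk c ?j - walk c' ?j\<bar> / sqrt (real n) \<le> 1 / sqrt (real n)" by (rule divide_right_mono) simp
  then show "min 1 (dist (zpath n c t) (zpath n c' t)) \<le> 1 / sqrt (real n)"
    by (simp add: zpath_def dist_real_def diff_divide_distrib[symmetric] abs_divide min.coboundedI2)
qed

text \<open>Numerator and denominator of the average are both divided by \<open>3 ^ n\<close>. The
  comparison with codes is proved for general functions, since it serves \<open>g\<close> and also
  the constant 1.\<close>

lemma realizable_average:
  fixes g H :: "nat \<Rightarrow> (nat \<Rightarrow> nat) \<Rightarrow> real"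
  assumes b: "\<And>n v. \<bar>g n v\<bar> \<le> b" "\<And>n c. \<bar>H n c\<bar> \<le> b" and \<epsilon>: "\<epsilon> \<longlonglongrightarrow> 0" "\<And>n. 0 \<le> \<epsilon> n"
    and g: "\<And>n a c. n > 0 \<Longrightarrow> a \<le> 1 \<Longrightarrow> c \<in> codes n \<Longrightarrow> \<bar>g n (code_word n a c) - H n c\<bar> \<le> \<epsilon> n"
    and H: "\<And>n c c'. c \<in> codes n \<Longrightarrow> c' \<in> codes n \<Longrightarrow> (\<And>j. \<bar>int (twos c' j) - int (twos c j)\<bar> \<le> 1) \<Longrightarrow> \<bar>H n c - H n c'\<bar> \<le> \<epsilon> n"
    and lim: "(\<lambda>n. sum (H n) (codes n) / 3 ^ n) \<longlonglongrightarrow> L"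
  shows "(\<lambda>n. \<integral>v. g n v \<partial>random_word n) \<longlonglongrightarrow> L"
proof -
  have approx: "(\<lambda>n. sum (g n) (realizable_words n) / 3 ^ n) \<longlonglongrightarrow> L"
    if b: "\<And>n v. \<bar>g n v\<bar> \<le> b" "\<And>n c. \<bar>H n c\<bar> \<le> b" and \<epsilon>: "\<epsilon> \<longlonglongrightarrow> 0" "\<And>n. 0 \<le> \<epsilon> n"
    and g: "\<And>n a c. n > 0 \<Longrightarrow> a \<le> 1 \<Longrightarrow> c \<in> codes n \<Longrightarrow> \<bar>g n (code_word n a c) - H n c\<bar> \<le> \<epsilon> n"
    and H: "\<And>n c c'. c \<in> codes n \<Longrightarrow> c' \<in> codes n \<Longrightarrow> (\<And>j. \<bar>int (twos c' j) - int (twos c j)\<bar> \<le> 1) \<Longrightarrow> \<bar>H n c - H n c'\<bar> \<le> \<epsilon> n"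
    and lim: "(\<lambda>n. sum (H n) (codes n) / 3 ^ n) \<longlonglongrightarrow> L"
    for g H :: "nat \<Rightarrow> (nat \<Rightarrow> nat) \<Rightarrow> real" and b \<epsilon> L
  proof -
    have "(\<lambda>n. 3 * b * (2 / 3) ^ n + b * (1 / 3) ^ n + 3 * \<epsilon> n) \<longlonglongrightarrow> 3 * b * 0 + b * 0 + 3 * 0"
      by (intro tendsto_intros \<epsilon>(1) LIMSEQ_power_zero) auto
    then have lim0: "(\<lambda>n. 3 * b * (2 / 3) ^ n + b * (1 / 3) ^ n + 3 * \<epsilon> n) \<longlonglongrightarrow> 0" by simp
    have "(\<lambda>n. sum (g n) (realizable_words n) / 3 ^ n - sum (H n) (codes n) / 3 ^ n) \<longlonglongrightarrow> 0"
    proof (rule Lim_null_comparison[OF _ lim0], rule eventually_mono[OF eventually_ge_at_top[of 3]])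
      fix n :: nat assume n: "3 \<le> n"
      have "\<bar>sum (g n) (realizable_words n) - sum (H n) (codes n)\<bar> \<le> 3 * b * 2 ^ n + b + 3 ^ n * (2 * \<epsilon> n + \<epsilon> n)"
        using n b \<epsilon>(2) g[of n] H[of _ n] by (intro sum_realizable_words_codes) auto
      then have "\<bar>sum (g n) (realizable_words n) - sum (H n) (codes n)\<bar> / 3 ^ n \<le> (3 * b * 2 ^ n + b + 3 ^ n * (2 * \<epsilon> n + \<epsilon> n)) / 3 ^ n"
        by (rule divide_right_mono) simp
      also have "\<dots> = 3 * b * (2 / 3) ^ n + b * (1 / 3) ^ n + 3 * \<epsilon> n"
        by (simp add: add_divide_distrib power_divide)
      finally show "norm (sum (g n) (realizable_words n) / 3 ^ n - sum (H n) (codes n) / 3 ^ n) \<le> 3 * b * (2 / 3) ^ n + b * (1 / 3) ^ n + 3 * \<epsilon> n"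
        by (simp add: diff_divide_distrib[symmetric] abs_divide)
    qed
    from tendsto_add[OF this lim] show ?thesis by simp
  qed
  have num: "(\<lambda>n. sum (g n) (realizable_words n) / 3 ^ n) \<longlonglongrightarrow> L" by (rule approx[OF b \<epsilon> g H lim])
  \<comment> \<open>For the constant function this says that the number of realizable words is
    asymptotic to \<open>3 ^ n\<close>. In particular realizable words exist for large
    \<open>n\<close>, where \<open>random_word\<close> is then uniform on them.\<close>
  have "(\<lambda>n. sum (\<lambda>_. 1) (realizable_words n) / 3 ^ n :: real) \<longlonglongrightarrow> 1"
  proof (rule approx[where b = 1 and \<epsilon> = "\<lambda>_. 0" and H = "\<lambda>_ _. 1"])
    have "(\<lambda>n. sum (\<lambda>_. 1) (codes n) / 3 ^ n :: real) = (\<lambda>_. 1)" by (simp add: card_codes)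
    then show "(\<lambda>n. sum (\<lambda>_. 1) (codes n) / 3 ^ n :: real) \<longlonglongrightarrow> 1" by simp
  qed auto
  then have den: "(\<lambda>n. real (card (realizable_words n)) / 3 ^ n) \<longlonglongrightarrow> 1" by simp
  have "(\<lambda>n. (sum (g n) (realizable_words n) / 3 ^ n) / (real (card (realizable_words n)) / 3 ^ n)) \<longlonglongrightarrow> L / 1"
    by (intro tendsto_divide num den) simp
  then have "(\<lambda>n. (sum (g n) (realizable_words n) / 3 ^ n) / (real (card (realizable_words n)) / 3 ^ n)) \<longlonglongrightarrow> L" by simp
  moreover have "\<forall>\<^sub>F n in sequentially. (sum (g n) (realizable_words n) / 3 ^ n) / (real (card (realizable_words n)) / 3 ^ n) = (\<integral>v. g n v \<partial>random_word n)"
    using order_tendstoD(1)[OF den zero_less_one]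
  proof eventually_elim
    case (elim n)
    then have "realizable_words n \<noteq> {}" by auto
    then show ?case unfolding random_word_def
      by (subst integral_pmf_of_set) (auto simp: finite_realizable_words)
  qed
  ultimately show ?thesis by (rule Lim_transform_eventually)
qed

section \<open>Convergence of the letter counts\<close>

lemma prob_space_random_word: "prob_space (random_word n)"
  unfolding random_word_def by (rule measure_pmf.prob_space_axioms)

lemma sets_random_word [simp]: "sets (random_word n) = UNIV"
  by (simp add: random_word_def)

lemma measurable_random_word [measurable]: "f \<in> random_word n \<rightarrow>\<^sub>M M'" if "\<And>x. f x \<in> space M'"
  using that by (simp add: random_word_def)

lemma count_path_converges:
  assumes W: "brownian_motion N W (2 / 9)"
  shows "converges_in_distr skorokhod_J1 random_word count_path N (\<lambda>\<omega>. triple (\<lambda>t. W t \<omega>))"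
proof (rule converges_in_distr_by_lipschitz)
  have func: "path_functional (\<lambda>z. h (triple z)) b (4 * \<bar>k\<bar>)"
    if "\<And>x. \<bar>h x\<bar> \<le> b" "\<And>x y. \<bar>h x - h y\<bar> \<le> k * path_dist x y" for h b k
  proof
    fix z z'
    have "\<bar>h (triple z) - h (triple z')\<bar> \<le> k * path_dist (triple z) (triple z')" by (rule that)
    also have "\<dots> \<le> \<bar>k\<bar> * path_dist (triple z) (triple z')" by (intro mult_right_mono path_dist_nonneg) simp
    also have "\<dots> \<le> \<bar>k\<bar> * (4 * path_dist z z')" by (intro mult_left_mono triple_lipschitz) simp
    finally show "\<bar>h (triple z) - h (triple z')\<bar> \<le> 4 * \<bar>k\<bar> * path_dist z z'" by simp
  qed (use that in auto)
  show "prob_space (random_word n)" for n by (rule prob_space_random_word)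
  show "prob_space N" using W by (simp only: brownian_motion_def)
  show "count_path n \<in> random_word n \<rightarrow>\<^sub>M borel_of_top skorokhod_J1" for n
    by (rule measurable_borel_of_topI) (simp_all add: topspace_skorokhod_J1 count_path_cadlag)
  show "(\<lambda>v. h (count_path n v) :: real) \<in> borel_measurable (random_word n)" for n h
    by (rule measurable_random_word) simp
  show "triple (\<lambda>t. W t \<omega>) \<in> cadlag_space" if "\<omega> \<in> space N" for \<omega>
  proof -
    have W: "continuous_on {0..1} (\<lambda>t. W t \<omega>)" using W that unfolding brownian_motion_def by blast
    \<comment> \<open>The path is extended by constants to the whole line, where
      \<open>cadlag_step\<close> requires continuity.\<close>
    define w where "w t = W (max 0 (min 1 t)) \<omega>" for t
    have "continuous_on UNIV w"
      unfolding w_def by (rule continuous_on_compose2[OF W]) (auto intro!: continuous_intros)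
    then have "(\<lambda>t\<in>{0..1}. (\<lambda>_ t. (w t, - 2 * w t, w t)) (nat \<lfloor>t * real 0\<rfloor>) t) \<in> cadlag_space"
      by (intro cadlag_step continuous_intros)
    also have "(\<lambda>t\<in>{0..1}. (\<lambda>_ t. (w t, - 2 * w t, w t)) (nat \<lfloor>t * real 0\<rfloor>) t) = triple (\<lambda>t. W t \<omega>)"
      by (auto simp: triple_def w_def restrict_def fun_eq_iff)
    finally show ?thesis .
  qed
  show "(\<lambda>\<omega>. h (triple (\<lambda>t. W t \<omega>)) :: real) \<in> borel_measurable N"
    if "\<And>x. \<bar>h x\<bar> \<le> b" "\<And>x y. \<bar>h x - h y\<bar> \<le> k * path_dist x y" for h b k
    by (rule path_functional.H_W_measurable[OF func[OF that] W])
  show "(\<lambda>n. \<integral>v. h (count_path n v) \<partial>random_word n) \<longlonglongrightarrow> (\<integral>\<omega>. h (triple (\<lambda>t. W t \<omega>)) \<partial>N :: real)"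
    if h: "\<And>x. \<bar>h x\<bar> \<le> b" "\<And>x y. \<bar>h x - h y\<bar> \<le> k * path_dist x y" for h b k
  proof (rule realizable_average[where b = b and \<epsilon> = "\<lambda>n. \<bar>k\<bar> * (6 / sqrt (real n))" and H = "\<lambda>n c. h (triple (zpath n c))"])
    have "(\<lambda>n. \<bar>k\<bar> * (6 * (1 / sqrt (real n)))) \<longlonglongrightarrow> \<bar>k\<bar> * (6 * 0)"
      by (intro tendsto_intros) real_asymp
    then show "(\<lambda>n. \<bar>k\<bar> * (6 / sqrt (real n))) \<longlonglongrightarrow> 0" by simp
    have lip: "\<bar>h x - h y\<bar> \<le> \<bar>k\<bar> * e" if "path_dist x y \<le> e" for x y e
    proof -
      have "k * path_dist x y \<le> \<bar>k\<bar> * path_dist x y" by (intro mult_right_mono path_dist_nonneg) simp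
      also have "\<dots> \<le> \<bar>k\<bar> * e" using that by (intro mult_left_mono) auto
      finally show ?thesis using h(2)[of x y] by linarith
    qed
    show "\<bar>h (count_path n (code_word n a c)) - h (triple (zpath n c))\<bar> \<le> \<bar>k\<bar> * (6 / sqrt (real n))"
      if "n > 0" "c \<in> codes n" for n a c
      by (rule lip[OF count_path_near[OF that(2,1)]])
    show "\<bar>h (triple (zpath n c)) - h (triple (zpath n c'))\<bar> \<le> \<bar>k\<bar> * (6 / sqrt (real n))"
      if "\<And>j. \<bar>int (twos c' j) - int (twos c j)\<bar> \<le> 1" for n c c'
    proof (rule lip)
      have "path_dist (triple (zpath n c)) (triple (zpath n c')) \<le> 4 * path_dist (zpath n c) (zpath n c')"
        by (rule triple_lipschitz)
      also have "\<dots> \<le> 4 * (1 / sqrt (real n))" by (intro mult_left_mono zpath_twos that) auto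
      also have "\<dots> \<le> 6 / sqrt (real n)" by (simp add: divide_right_mono)
      finally show "path_dist (triple (zpath n c)) (triple (zpath n c')) \<le> 6 / sqrt (real n)" .
    qed
    show "(\<lambda>n. (\<Sum>c\<in>codes n. h (triple (zpath n c))) / 3 ^ n) \<longlonglongrightarrow> (\<integral>\<omega>. h (triple (\<lambda>t. W t \<omega>)) \<partial>N)"
      by (rule path_functional.codes_limit[OF func[OF h] W])
  qed (use h in auto)
qed

text \<open>The maximal inequality with slope \<open>\<eta>\<close> and level
  \<open>\<eta> * real n\<close> leaves the exponent
  \<open>- (3 / 4) * \<eta>\<^sup>2 * n\<close>.\<close>

lemma walk_endpoint_average:
  assumes \<eta>: "0 < \<eta>" "\<eta> \<le> 1"
  shows "(\<lambda>n. real (card {c \<in> codes n. \<eta> * real n \<le> \<bar>walk c n\<bar>}) / 3 ^ n) \<longlonglongrightarrow> 0"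
proof (rule Lim_null_comparison)
  show "\<forall>\<^sub>F n in sequentially. norm (real (card {c \<in> codes n. \<eta> * real n \<le> \<bar>walk c n\<bar>}) / 3 ^ n) \<le> 2 * exp (- (3 * \<eta>\<^sup>2 / 4)) ^ n"
  proof (rule always_eventually, rule allI)
    fix n
    have "{c \<in> codes n. \<eta> * real n \<le> \<bar>walk c n\<bar>} \<subseteq> {c \<in> codes n. \<exists>k\<le>n. \<eta> * real n \<le> \<bar>walk c (0 + k) - walk c 0\<bar>}"
      by (auto simp: walk_def)
    then have "card {c \<in> codes n. \<eta> * real n \<le> \<bar>walk c n\<bar>} \<le> card {c \<in> codes n. \<exists>k\<le>n. \<eta> * real n \<le> \<bar>walk c (0 + k) - walk c 0\<bar>}"
      by (intro card_mono) auto
    then have "real (card {c \<in> codes n. \<eta> * real n \<le> \<bar>walk c n\<bar>}) \<le> 2 * 3 ^ n * exp (\<eta>\<^sup>2 * real n / 4 - \<eta> * (\<eta> * real n))"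
      using card_walk_oscillation[of \<eta> 0 n n "\<eta> * real n"] \<eta> by linarith
    also have "\<eta>\<^sup>2 * real n / 4 - \<eta> * (\<eta> * real n) = real n * (- (3 * \<eta>\<^sup>2 / 4))"
      by (simp add: power2_eq_square algebra_simps)
    also have "exp (real n * (- (3 * \<eta>\<^sup>2 / 4))) = exp (- (3 * \<eta>\<^sup>2 / 4)) ^ n" by (rule exp_of_nat_mult)
    finally show "norm (real (card {c \<in> codes n. \<eta> * real n \<le> \<bar>walk c n\<bar>}) / 3 ^ n) \<le> 2 * exp (- (3 * \<eta>\<^sup>2 / 4)) ^ n"
      by (simp add: pos_divide_le_eq mult_ac)
  qed
  have "(\<lambda>n. 2 * exp (- (3 * \<eta>\<^sup>2 / 4)) ^ n) \<longlonglongrightarrow> 2 * 0"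
    using \<eta> by (intro tendsto_intros LIMSEQ_power_zero) auto
  then show "(\<lambda>n. 2 * exp (- (3 * \<eta>\<^sup>2 / 4)) ^ n) \<longlonglongrightarrow> 0" by simp
qed

definition final_counts :: "nat \<Rightarrow> (nat \<Rightarrow> nat) \<Rightarrow> real \<times> real \<times> real" where
  "final_counts n w = (letter_count n w 0 (real n) / real n,
     letter_count n w 1 (real n) / real n, letter_count n w 2 (real n) / real n)"

text \<open>Proved from the exponential inequality and not from the process limit, which is a
  statement about a given Brownian motion and does not supply one.\<close>

lemma final_counts_converge: "converges_in_prob_to_const random_word final_counts (1/6, 2/3, 1/6)"
  unfolding converges_in_prob_to_const_def
proof (intro allI impI)
  fix e :: real assume e: "e > 0"
  \<comment> \<open>The truncated distance is bounded, so \<open>realizable_average\<close> applies;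
    convergence in probability then follows from Markov's inequality at the level
    \<open>min 1 e\<close>.\<close>
  define g where "g n v = min 1 (dist (final_counts n v) (1/6, 2/3, 1/6))" for n v
  \<comment> \<open>The proportions as an affine function of the endpoint \<open>w\<close> of the
    walk, exact up to the bounded error of the alternation; at \<open>w = 0\<close> they are the
    limit.\<close>
  define P where "P n w = (1 / 6 + w / (2 * real n), 2 / 3 - w / real n, 1 / 6 + w / (2 * real n))" for n w
  define H where "H n c = min 1 (dist (P n (walk c n)) (1/6, 2/3, 1/6))" for n c
  have P: "dist (P n w) (P n w') \<le> 2 * \<bar>w - w'\<bar> / real n" for n w w'
  proof -
    have 1: "1 / 6 + w / (2 * real n) - (1 / 6 + w' / (2 * real n)) = (w - w') / (2 * real n)"
      "2 / 3 - w / real n - (2 / 3 - w' / real n) = - ((w - w') / real n)"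
      by (simp_all add: diff_divide_distrib)
    have "dist (P n w) (P n w') \<le> \<bar>(w - w') / (2 * real n)\<bar> + \<bar>- ((w - w') / real n)\<bar> + \<bar>(w - w') / (2 * real n)\<bar>"
      using dist_triple[of "1 / 6 + w / (2 * real n)" "2 / 3 - w / real n" "1 / 6 + w / (2 * real n)"] unfolding P_def 1[symmetric] .
    also have "\<dots> = 2 * \<bar>w - w'\<bar> / real n" by (simp add: abs_divide)
    finally show ?thesis .
  qed
  have P0: "P n 0 = (1/6, 2/3, 1/6)" for n by (simp add: P_def)
  have near: "\<bar>min 1 (dist x z) - min 1 (dist y z)\<bar> \<le> dist x y" for x y z :: "real \<times> real \<times> real"
    using dist_triangle[of x z y] dist_triangle[of y z x] zero_le_dist[of x y] by (auto simp: min_def dist_commute[of y x])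
  have "(\<lambda>n. \<integral>v. g n v \<partial>random_word n) \<longlonglongrightarrow> 0"
  proof (rule realizable_average[where b = 1 and \<epsilon> = "\<lambda>n. 2 / real n" and H = H])
    show "(\<lambda>n. 2 / real n) \<longlonglongrightarrow> 0" by real_asymp
    show "\<bar>g n (code_word n a c) - H n c\<bar> \<le> 2 / real n" if n: "n > 0" and c: "c \<in> codes n" for n a c
    proof -
      let ?F = "\<lambda>k. real (sig_count n (code_word n a c) k n)"
      note w = counts_near_walk[OF c order.refl, of a]
      have F: "final_counts n (code_word n a c) = (?F 0 / real n, ?F 1 / real n, ?F 2 / real n)"
        using letter_count_eq[of n "code_word n a c" _ "real n"] by (simp add: final_counts_def)
      have eq: "x / real n - (1 / 6 + y / (2 * real n)) = (2 * (x - real n / 6) - y) / (2 * real n)" for x y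
        using n by (simp add: divide_simps)
      have "\<bar>?F 0 / real n - (1 / 6 + walk c n / (2 * real n))\<bar> \<le> 1 / (2 * real n)"
        "\<bar>?F 2 / real n - (1 / 6 + walk c n / (2 * real n))\<bar> \<le> 1 / (2 * real n)"
        unfolding eq abs_divide using w(1,3) n by (auto intro!: divide_right_mono)
      moreover have "?F 1 = 2 * real n / 3 - walk c n" using w(2) by (simp add: field_simps)
      then have "\<bar>?F 1 / real n - (2 / 3 - walk c n / real n)\<bar> \<le> 0"
        using n by (simp add: diff_divide_distrib)
      ultimately have "dist (final_counts n (code_word n a c)) (P n (walk c n)) \<le> 1 / (2 * real n) + 0 + 1 / (2 * real n)"
        unfolding F P_def by (intro order.trans[OF dist_triple] add_mono)
      also have "\<dots> \<le> 2 / real n" using n by (simp add: divide_simps)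
      finally show ?thesis using near[of "final_counts n (code_word n a c)" _ "P n (walk c n)"] unfolding g_def H_def by (rule order.trans[rotated])
    qed
    show "\<bar>H n c - H n c'\<bar> \<le> 2 / real n" if tw: "\<And>j. \<bar>int (twos c' j) - int (twos c j)\<bar> \<le> 1" for n c c'
    proof -
      have "real_of_int \<bar>int (twos c' n) - int (twos c n)\<bar> \<le> 1" using tw[of n] by linarith
      then have "\<bar>walk c n - walk c' n\<bar> \<le> 1" by (simp add: walk_eq)
      then have "2 * \<bar>walk c n - walk c' n\<bar> / real n \<le> 2 * 1 / real n" by (intro divide_right_mono mult_left_mono) auto
      then have "2 * \<bar>walk c n - walk c' n\<bar> / real n \<le> 2 / real n" by (simp only: mult_1_right)
      from order.trans[OF P this] near[of "P n (walk c n)" _ "P n (walk c' n)"] show ?thesis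
        unfolding H_def by (rule order.trans[rotated])
    qed
    show "(\<lambda>n. sum (H n) (codes n) / 3 ^ n) \<longlonglongrightarrow> 0"
    proof (rule tendstoI)
      fix \<epsilon> :: real assume \<epsilon>: "\<epsilon> > 0"
      \<comment> \<open>Codes with a small endpoint contribute at most
        \<open>2 * \<eta> \<le> \<epsilon> / 4\<close>, the others at most their proportion,
        eventually below \<open>\<epsilon> / 2\<close>. The cap at 1 is required by the exponential
        inequality.\<close>
      define \<eta> where "\<eta> = min 1 (\<epsilon> / 8)"
      have \<eta>: "0 < \<eta>" "\<eta> \<le> 1" "2 * \<eta> \<le> \<epsilon> / 4" using \<epsilon> by (auto simp: \<eta>_def)
      have "\<forall>\<^sub>F n in sequentially. real (card {c \<in> codes n. \<eta> * real n \<le> \<bar>walk c n\<bar>}) / 3 ^ n < \<epsilon> / 2"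
        using walk_endpoint_average[OF \<eta>(1,2)] \<epsilon> by (intro order_tendstoD) auto
      then show "\<forall>\<^sub>F n in sequentially. dist (sum (H n) (codes n) / 3 ^ n) 0 < \<epsilon>"
        using eventually_gt_at_top[of 0]
      proof eventually_elim
        case (elim n)
        have H1: "H n c \<le> 2 * \<eta> + (if \<eta> * real n \<le> \<bar>walk c n\<bar> then 1 else 0)" for c
        proof (cases "\<eta> * real n \<le> \<bar>walk c n\<bar>")
          case False
          have "H n c \<le> 2 * \<bar>walk c n\<bar> / real n" using P[of n "walk c n" 0] by (simp add: H_def P0)
          also have "\<dots> \<le> 2 * \<eta>" using False elim(2) by (simp add: pos_divide_le_eq)
          finally show ?thesis using False by simp
        qed (use \<eta> in \<open>simp add: H_def min.coboundedI1\<close>)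
        have "sum (H n) (codes n) \<le> (\<Sum>c\<in>codes n. 2 * \<eta> + (if \<eta> * real n \<le> \<bar>walk c n\<bar> then 1 else 0))"
          by (rule sum_mono) (rule H1)
        also have "\<dots> = 3 ^ n * (2 * \<eta>) + real (card {c \<in> codes n. \<eta> * real n \<le> \<bar>walk c n\<bar>})"
          by (simp add: sum.distrib card_codes sum.If_cases Collect_conj_eq)
        finally have "sum (H n) (codes n) / 3 ^ n \<le> (3 ^ n * (2 * \<eta>) + real (card {c \<in> codes n. \<eta> * real n \<le> \<bar>walk c n\<bar>})) / 3 ^ n"
          by (rule divide_right_mono) simp
        also have "\<dots> = 2 * \<eta> + real (card {c \<in> codes n. \<eta> * real n \<le> \<bar>walk c n\<bar>}) / 3 ^ n" by (simp add: add_divide_distrib)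
        finally have "sum (H n) (codes n) / 3 ^ n < \<epsilon>" using elim(1) \<eta>(3) \<epsilon> by linarith
        moreover have "0 \<le> sum (H n) (codes n) / 3 ^ n" by (intro divide_nonneg_nonneg sum_nonneg) (auto simp: H_def)
        ultimately show ?case by (simp add: dist_real_def)
      qed
    qed
  qed (auto simp: g_def H_def)
  then have "(\<lambda>n. (\<integral>v. g n v \<partial>random_word n) / min 1 e) \<longlonglongrightarrow> 0 / min 1 e"
    using e by (intro tendsto_intros) auto
  then have lim0: "(\<lambda>n. (\<integral>v. g n v \<partial>random_word n) / min 1 e) \<longlonglongrightarrow> 0" by simp
  show "(\<lambda>n. measure (random_word n) {\<omega> \<in> space (random_word n). dist (final_counts n \<omega>) (1/6, 2/3, 1/6) > e}) \<longlonglongrightarrow> 0"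
  proof (rule Lim_null_comparison[OF always_eventually lim0], rule allI)
    fix n
    interpret prob_space "random_word n" by (rule prob_space_random_word)
    have g: "integrable (random_word n) (g n)"
    proof (rule integrable_const_bound[where B = 1])
      show "AE v in random_word n. norm (g n v) \<le> 1" by (simp add: g_def)
      show "g n \<in> borel_measurable (random_word n)" by (rule measurable_random_word) simp
    qed
    have "measure (random_word n) {\<omega> \<in> space (random_word n). dist (final_counts n \<omega>) (1/6, 2/3, 1/6) > e}
        \<le> measure (random_word n) {\<omega> \<in> space (random_word n). g n \<omega> \<ge> min 1 e}"
    proof (rule finite_measure_mono)
      show "{\<omega> \<in> space (random_word n). dist (final_counts n \<omega>) (1/6, 2/3, 1/6) > e} \<subseteq> {\<omega> \<in> space (random_word n). g n \<omega> \<ge> min 1 e}"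
        unfolding g_def by force
    qed simp
    also have "\<dots> \<le> (\<integral>v. g n v \<partial>random_word n) / min 1 e"
    proof (rule integral_Markov_inequality_measure[OF g, where A = "{}"])
      show "AE v in random_word n. 0 \<le> g n v" by (simp add: g_def)
    qed (use e in simp_all)
    finally show "norm (measure (random_word n) {\<omega> \<in> space (random_word n). dist (final_counts n \<omega>) (1/6, 2/3, 1/6) > e})
        \<le> (\<integral>v. g n v \<partial>random_word n) / min 1 e" by simp
  qed
qed

theorem theorem12:
  shows "converges_in_prob_to_const random_word
           (\<lambda>n w. (letter_count n w 0 (real n) / real n,
                   letter_count n w 1 (real n) / real n,
                   letter_count n w 2 (real n) / real n))
           (1/6, 2/3, 1/6) \<and>
         (\<forall>(N :: 'v measure) W. brownian_motion N W (2/9) \<longrightarrow>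
           converges_in_distr skorokhod_J1 random_word
             (\<lambda>n w. \<lambda>c\<in>{0..1}. (2 / sqrt (real n)) *\<^sub>R
                (letter_count n w 0 (c * real n) - c * real n / 6,
                 letter_count n w 1 (c * real n) - 2 * c * real n / 3,
                 letter_count n w 2 (c * real n) - c * real n / 6))
             N (\<lambda>\<omega>. \<lambda>c\<in>{0..1}. (W c \<omega>, - 2 * W c \<omega>, W c \<omega>)))"
  using final_counts_converge count_path_converges
  unfolding final_counts_def[abs_def] count_path_def[abs_def] triple_def by (intro conjI allI impI)

end
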